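(* There is $k_0\in\mathbb{N}$ such that for every $k\ge k_0$ and all compactly supported $\mathbf{A}\in C^k(\mathbb{R}^3;\mathbb{C}^3)$ and $V\in C^k(\mathbb{R}^3;\mathbb{C})$, the scattering amplitude $a(\omega,\theta,\lambda)$ of the biharmonic equation corresponding to $(\mathbf{A},V)$ satisfies $$a(\omega,\theta,\lambda)=\mathrm{i}\lambda\,\theta\cdot\hat{\mathbf{A}}(\lambda(\omega-\theta))+\hat V(\lambda(\omega-\theta))+\mathcal{O}(\lambda^{-1})\quad\text{as }\lambda\to\infty,$$ with the remainder uniform in $\omega,\theta\in S^2$.
   Context: For compactly supported $\mathbf{A}$ (vector-valued) and $V$ (scalar-valued) on $\mathbb{R}^3$, the biharmonic equation is $$(\Delta^2+\mathbf{A}\cdot\nabla+V-\lambda^4)u=0 ,\qquad \lambda>0,$$ where $\mathbf{A}\cdot\nabla=\sum_j A_j\partial_j$ (no complex conjugation in dot products). The outgoing free resolvent $R_0(\lambda)=(\Delta^2-\lambda^4-\mathrm{i}0)^{-1}$ is the integral operator $$[R_0(\lambda)f](x)=\int_{\mathbb{R}^3}G_0(x,y,\lambda)f(y)\,dy,\qquad G_0(x,y,\lambda)=\frac{e^{\mathrm{i}\lambda|x-y|}-e^{-\lambda|x-y|}}{8\pi\lambda^2|x-y|}.$$ For $\theta\in S^2$ and all sufficiently large $\lambda$, the scattering solution is the unique solution of the form $u(x,\theta,\lambda)=e^{\mathrm{i}\lambda x\cdot\theta}+u_{sc}(x,\theta,\lambda)$, where the scattered wave $u_{sc}$ is outgoing,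 i.e. $u_{sc}=-R_0(\lambda)\big[(\mathbf{A}\cdot\nabla+V)u\big]$, with $u_{sc}$ and $\nabla u_{sc}$ in $L^2(\mathbb{R}^3;(1+|x|)^{-2\delta}dx)$ for some $\delta>1/2$. The scattering amplitude is, for $\omega,\theta\in S^2$ and $\lambda$ sufficiently large, $$a(\omega,\theta,\lambda)=\int_{\mathbb{R}^3}e^{-\mathrm{i}\lambda\omega\cdot y}\big(\mathbf{A}(y)\cdot\nabla+V(y)\big)u(y,\theta,\lambda)\,dy .$$ The Fourier transform is $\hat f(\xi)=\int_{\mathbb{R}^3}e^{-\mathrm{i}\xi\cdot y}f(y)\,dy$ (componentwise for vector fields). *)

theory Defs
  imports "HOL-Analysis.Analysis"
begin

section \<open>Differentiability classes and differential operators\<close>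

text \<open>
  A function is \<open>C\<^sup>0\<close> if it is continuous, and \<open>C\<^sup>k\<^sup>+\<^sup>1\<close> if it is (Frechet) differentiable everywhere
  and all its first-order partial derivatives are \<open>C\<^sup>k\<close>.
\<close>

primrec Ck :: "nat \<Rightarrow> ('a::euclidean_space \<Rightarrow> 'b::real_normed_vector) \<Rightarrow> bool" where
  "Ck 0 f \<longleftrightarrow> continuous_on UNIV f"
| "Ck (Suc k) f \<longleftrightarrow> f differentiable_on UNIV \<and>
     (\<forall>b\<in>Basis. Ck k (\<lambda>x. frechet_derivative f (at x) b))"

definition compactly_supported :: "('a::topological_space \<Rightarrow> 'b::zero) \<Rightarrow> bool" where
  "compactly_supported f \<longleftrightarrow> compact (closure {x. f x \<noteq> 0})"

definition test_function :: "(real^3 \<Rightarrow> complex) \<Rightarrow> bool" where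
  "test_function \<phi> \<longleftrightarrow> (\<forall>k. Ck k \<phi>) \<and> compactly_supported \<phi>"

definition partial :: "3 \<Rightarrow> (real^3 \<Rightarrow> complex) \<Rightarrow> real^3 \<Rightarrow> complex" where
  "partial j f x = frechet_derivative f (at x) (axis j 1)"

definition laplacian :: "(real^3 \<Rightarrow> complex) \<Rightarrow> real^3 \<Rightarrow> complex" where
  "laplacian f x = (\<Sum>j\<in>UNIV. partial j (partial j f) x)"

text \<open>Bilinear, in contrast to the inner product of the library, which is real-valued.\<close>

definition cdot :: "complex^3 \<Rightarrow> complex^3 \<Rightarrow> complex" where
  "cdot a b = (\<Sum>j\<in>UNIV. a $ j * b $ j)"

definition cvec :: "real^3 \<Rightarrow> complex^3" where
  "cvec x = (\<chi> j. complex_of_real (x $ j))"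

section \<open>Distributional gradient and weighted spaces\<close>

definition locally_integrable :: "(real^3 \<Rightarrow> complex) \<Rightarrow> bool" where
  "locally_integrable f \<longleftrightarrow> (\<forall>K. compact K \<longrightarrow> set_integrable lborel K f)"

definition has_weak_gradient :: "(real^3 \<Rightarrow> complex) \<Rightarrow> (real^3 \<Rightarrow> complex^3) \<Rightarrow> bool" where
  "has_weak_gradient u g \<longleftrightarrow>
     locally_integrable u \<and> (\<forall>j. locally_integrable (\<lambda>x. g x $ j)) \<and>
     (\<forall>\<phi> j. test_function \<phi> \<longrightarrow>
        (LINT x|lborel. u x * partial j \<phi> x) = - (LINT x|lborel. g x $ j * \<phi> x))"

text \<open>
  A weak gradient is determined only up to a null set; this selects some representative.
  Below it enters only through integrals, which do not depend on the representative.
\<close>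

definition weak_gradient :: "(real^3 \<Rightarrow> complex) \<Rightarrow> real^3 \<Rightarrow> complex^3" where
  "weak_gradient u = (SOME g. has_weak_gradient u g)"

text \<open>Membership in \<open>L\<^sup>2((1 + |x|)\<^sup>-\<^sup>2\<^sup>\<delta> dx)\<close>.\<close>

definition weighted_L2 :: "real \<Rightarrow> (real^3 \<Rightarrow> 'b::euclidean_space) \<Rightarrow> bool" where
  "weighted_L2 \<delta> f \<longleftrightarrow> f \<in> borel_measurable lborel \<and>
     integrable lborel (\<lambda>x. (norm (f x))\<^sup>2 * (1 + norm x) powr (- 2 * \<delta>))"

section \<open>The free resolvent and the scattering amplitude\<close>

text \<open>
  The frequency, usually written \<open>\<lambda>\<close>, is called \<open>\<kappa>\<close>, as the former symbol is reserved.
  On the diagonal the kernel has the irrelevant value \<open>0\<close>, by division by zero.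
\<close>

definition G0 :: "real^3 \<Rightarrow> real^3 \<Rightarrow> real \<Rightarrow> complex" where
  "G0 x y \<kappa> = (exp (\<i> * of_real (\<kappa> * norm (x - y))) - exp (- of_real (\<kappa> * norm (x - y))))
      / of_real (8 * pi * \<kappa>\<^sup>2 * norm (x - y))"

definition R0 :: "real \<Rightarrow> (real^3 \<Rightarrow> complex) \<Rightarrow> real^3 \<Rightarrow> complex" where
  "R0 \<kappa> f x = (LINT y|lborel. G0 x y \<kappa> * f y)"

definition plane_wave :: "real \<Rightarrow> real^3 \<Rightarrow> real^3 \<Rightarrow> complex" where
  "plane_wave \<kappa> \<theta> x = exp (\<i> * of_real (\<kappa> * (x \<bullet> \<theta>)))"

text \<open>The function \<open>(A \<cdot> \<nabla> + V) u\<close>.\<close>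

definition perturbation ::
  "(real^3 \<Rightarrow> complex^3) \<Rightarrow> (real^3 \<Rightarrow> complex) \<Rightarrow> (real^3 \<Rightarrow> complex) \<Rightarrow> real^3 \<Rightarrow> complex" where
  "perturbation A V u x = cdot (A x) (weak_gradient u x) + V x * u x"

text \<open>The equation \<open>(\<Delta>\<^sup>2 + A \<cdot> \<nabla> + V - \<kappa>\<^sup>4) u = 0\<close> in the sense of distributions.\<close>

definition solves_biharmonic ::
  "(real^3 \<Rightarrow> complex^3) \<Rightarrow> (real^3 \<Rightarrow> complex) \<Rightarrow> real \<Rightarrow> (real^3 \<Rightarrow> complex) \<Rightarrow> bool" where
  "solves_biharmonic A V \<kappa> u \<longleftrightarrow>
     (\<forall>\<phi>. test_function \<phi> \<longrightarrow>
        (LINT x|lborel. u x * laplacian (laplacian \<phi>) x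
           + (perturbation A V u x - of_real (\<kappa>^4) * u x) * \<phi> x) = 0)"

text \<open>
  The outgoing condition is required at every point, which selects from an almost-everywhere
  class the representative given by the integral operator.
\<close>

definition is_scattering_solution ::
  "(real^3 \<Rightarrow> complex^3) \<Rightarrow> (real^3 \<Rightarrow> complex) \<Rightarrow> real^3 \<Rightarrow> real \<Rightarrow> (real^3 \<Rightarrow> complex) \<Rightarrow> bool" where
  "is_scattering_solution A V \<theta> \<kappa> u \<longleftrightarrow>
     (let usc = (\<lambda>x. u x - plane_wave \<kappa> \<theta> x) in
        (\<exists>\<delta>>1/2. \<exists>g. has_weak_gradient usc g \<and> weighted_L2 \<delta> usc \<and> weighted_L2 \<delta> g) \<and>
        solves_biharmonic A V \<kappa> u \<and>
        (\<forall>x. usc x = - R0 \<kappa> (perturbation A V u) x))"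

definition scattering_solution ::
  "(real^3 \<Rightarrow> complex^3) \<Rightarrow> (real^3 \<Rightarrow> complex) \<Rightarrow> real^3 \<Rightarrow> real \<Rightarrow> real^3 \<Rightarrow> complex" where
  "scattering_solution A V \<theta> \<kappa> = (THE u. is_scattering_solution A V \<theta> \<kappa> u)"

definition scattering_amplitude ::
  "(real^3 \<Rightarrow> complex^3) \<Rightarrow> (real^3 \<Rightarrow> complex) \<Rightarrow> real^3 \<Rightarrow> real^3 \<Rightarrow> real \<Rightarrow> complex" where
  "scattering_amplitude A V \<omega> \<theta> \<kappa> =
     (LINT y|lborel. exp (- \<i> * of_real (\<kappa> * (\<omega> \<bullet> y)))
        * perturbation A V (scattering_solution A V \<theta> \<kappa>) y)"

section \<open>Fourier transform\<close>

definition fourier :: "(real^3 \<Rightarrow> complex) \<Rightarrow> real^3 \<Rightarrow> complex" where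
  "fourier f \<xi> = (LINT y|lborel. exp (- \<i> * of_real (\<xi> \<bullet> y)) * f y)"

definition fourier_vec :: "(real^3 \<Rightarrow> complex^3) \<Rightarrow> real^3 \<Rightarrow> complex^3" where
  "fourier_vec F \<xi> = (\<chi> j. fourier (\<lambda>y. F y $ j) \<xi>)"

end

theory Submission
  imports Defs "HOL-Real_Asymp.Real_Asymp"
begin

text \<open>
  Put \<open>F = (A \<cdot> \<nabla> + V) u\<close> and \<open>F\<^sub>0 = (A \<cdot> \<nabla> + V) e\<close>, with \<open>e\<close> the incident plane wave. The scattering
  problem is the integral equation \<open>F = F\<^sub>0 - T F\<close>, where \<open>T = (A \<cdot> \<nabla> + V) R\<^sub>0\<close> has a kernel
  supported in \<open>x\<close> in a fixed ball and dominated there by \<open>1 / (\<kappa> |x - y|)\<close>. Hence \<open>T\<close> has norm \<open>O(1/\<kappa>)\<close> both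
  in the sup norm, which gives existence, and in \<open>L\<^sup>1\<close>, which gives uniqueness.

  The amplitude is the Fourier integral of \<open>F\<close> and the Born term that of \<open>F\<^sub>0\<close>, so the error is at most a
  constant times the sup norm of \<open>F - F\<^sub>0\<close>, hence of \<open>T F\<^sub>0\<close>. As \<open>F\<^sub>0\<close> has size \<open>\<kappa>\<close>, the norm bound on \<open>T\<close>
  only gives \<open>O(1)\<close>; the missing factor comes from oscillation. After moving
  the gradient of the kernel onto \<open>F\<^sub>0\<close>, what is needed is that the Helmholtz potential of \<open>e b\<close> is
  \<open>O(1/\<kappa>)\<close> for fixed \<open>b\<close> of class \<open>C\<^sup>2\<close>. Translating \<open>b\<close> by \<open>t \<theta>\<close> changes this potential at rate \<open>O(1/\<kappa>)\<close>,
  because \<open>(\<Delta> + \<kappa>\<^sup>2) (e b) = e (\<Delta> b + 2 \<i> \<kappa> \<theta> \<cdot> \<nabla> b)\<close>; and once \<open>b\<close> has been moved far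
  downstream, averaging over \<open>t\<close> is a one-dimensional oscillatory integral with an explicit primitive.
\<close>

section \<open>Lebesgue measure on Euclidean space\<close>

text \<open>Power count: the leading part of \<open>F\<^sub>0\<close> has size \<kappa>, the
  gradient moved onto it costs another \<kappa>, and the biharmonic kernel returns \<kappa>^-2. Only
  a further 1/\<kappa> from the Helmholtz potential of \<open>e b\<close> takes the result below
  O(1). By partial fractions the biharmonic kernel is a difference of Helmholtz kernels with wave
  numbers \<kappa> and \<i> \<kappa>; the second gains its 1/\<kappa> from exponential decay alone.
  In that difference the singularities cancel so far that the kernel and its gradient are bounded.
  Hence \<open>R0 \<kappa> f\<close> has a weak gradient for every integrable f. Uniqueness depends
  on this: a competing solution is known only through a weak gradient chosen up to null sets, so its
  source is merely integrable, and \<open>L\<^sup>1\<close> is the space in which two sources can be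
  compared. The identities for the Helmholtz kernel come from smoothing |z| instead of excising a
  ball around the pole. Integration by parts then rests on translation invariance of Lebesgue
  measure, and no surface integrals occur.\<close>

lemma integral_lborel_translate:
  fixes f :: "'a::euclidean_space \<Rightarrow> 'b::{banach,second_countable_topology}"
  assumes [measurable]: "f \<in> borel_measurable borel"
  shows "(LINT x|lborel. f (c + x)) = (LINT x|lborel. f x)"
proof -
  have "(LINT x|lborel. f x) = (LINT x|distr lborel borel ((+) c). f x)"
    by (simp add: lborel_distr_plus)
  also have "\<dots> = (LINT x|lborel. f (c + x))"
    by (subst integral_distr) auto
  finally show ?thesis by simp
qed

lemma integrable_lborel_translate:
  fixes f :: "'a::euclidean_space \<Rightarrow> 'b::{banach,second_countable_topology}"
  assumes "integrable lborel f"
  shows "integrable lborel (\<lambda>x. f (c + x))"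
proof -
  have [measurable]: "f \<in> borel_measurable borel"
    using borel_measurable_integrable[OF assms] by simp
  have "integrable (distr lborel borel ((+) c)) f"
    using assms by (simp add: lborel_distr_plus)
  then show ?thesis
    by (subst (asm) integrable_distr_eq) auto
qed

lemma lborel_reflect: "distr lborel borel (\<lambda>x. c - x) = (lborel :: 'a::euclidean_space measure)"
proof -
  have "(lborel :: 'a measure) = density (distr lborel borel (\<lambda>x. c + (-1) *\<^sub>R x)) (\<lambda>_. ennreal (\<bar>-1\<bar>^DIM('a)))"
    using lborel_affine[of "-1" c] by simp
  then show ?thesis
    by (simp add: density_1)
qed

lemma integral_lborel_reflect:
  fixes f :: "'a::euclidean_space \<Rightarrow> 'b::{banach,second_countable_topology}"
  assumes [measurable]: "f \<in> borel_measurable borel"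
  shows "(LINT x|lborel. f (c - x)) = (LINT x|lborel. f x)"
proof -
  have "(LINT x|lborel. f x) = (LINT x|distr lborel borel (\<lambda>x. c - x). f x)"
    by (simp add: lborel_reflect)
  also have "\<dots> = (LINT x|lborel. f (c - x))"
    by (subst integral_distr) auto
  finally show ?thesis by simp
qed

lemma integrable_lborel_reflect:
  fixes f :: "'a::euclidean_space \<Rightarrow> 'b::{banach,second_countable_topology}"
  assumes "integrable lborel f"
  shows "integrable lborel (\<lambda>x. f (c - x))"
proof -
  have [measurable]: "f \<in> borel_measurable borel"
    using borel_measurable_integrable[OF assms] by simp
  have "integrable (distr lborel borel (\<lambda>x. c - x)) f"
    using assms by (simp add: lborel_reflect)
  then show ?thesis
    by (subst (asm) integrable_distr_eq) auto
qed

lemma integral_lborel_scale: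
  fixes f :: "'a::euclidean_space \<Rightarrow> 'b::{banach,second_countable_topology}"
  assumes [measurable]: "f \<in> borel_measurable borel" and "c > 0"
  shows "(LINT x|lborel. f x) = c ^ DIM('a) *\<^sub>R (LINT x|lborel. f (t + c *\<^sub>R x))"
proof -
  have "(LINT x|lborel. f x) = (LINT x|density (distr lborel borel (\<lambda>x. t + c *\<^sub>R x)) (\<lambda>_. ennreal (\<bar>c\<bar>^DIM('a))). f x)"
    using lborel_affine[of c t] assms by (simp add: ennreal_power)
  also have "\<dots> = (LINT x|lborel. \<bar>c\<bar>^DIM('a) *\<^sub>R f (t + c *\<^sub>R x))"
    using assms by (subst integral_density) (auto simp: integral_distr)
  finally show ?thesis using assms by simp
qed

lemmas [measurable] = borel_closed[OF closed_cball]

section \<open>Volumes of balls and radial integrals in three dimensions\<close>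

lemma emeasure_lborel_cball_less_top [simp]:
  "emeasure lborel (cball c r :: 'a::euclidean_space set) < top"
  using emeasure_lborel_cball_finite[of c r] by simp

lemma integrable_indicator_cball [simp]:
  "integrable lborel (indicator (cball c r) :: 'a::euclidean_space \<Rightarrow> real)"
  using emeasure_lborel_cball_finite[of c r] by (simp add: integrable_indicator_iff)

text \<open>The half-lines {..a} are stable under intersection and generate the Borel sets, so it
  suffices to compare there: the volume 4/3 pi a^3 of a ball against the primitive of 4 pi
  r^2.\<close>

lemma distr_norm_lborel:
  "distr lborel borel (norm :: real^3 \<Rightarrow> real)
     = density lborel (\<lambda>r. ennreal (4 * pi * r\<^sup>2) * indicator {0..} r)"
    (is "?M = ?N")
proof (rule measure_eqI_generator_eq[where E = "range (\<lambda>a. {..a})" and \<Omega> = UNIV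
      and A = "\<lambda>i. {..real i}"])
  have eq: "emeasure ?M {..a} = emeasure ?N {..a} \<and> emeasure ?M {..a} < \<infinity>" for a
  proof (cases "a < 0")
    case True
    have "norm -` {..a} = ({} :: (real^3) set)"
      using True by (auto dest: order_trans[OF norm_ge_zero])
    then have "emeasure ?M {..a} = 0"
      by (simp add: emeasure_distr)
    moreover have "emeasure ?N {..a} = 0"
    proof -
      have 0: "ennreal (4 * pi * r\<^sup>2) * indicator {0..} r * indicator {..a} r = 0" for r
        using True by (auto simp: indicator_def)
      have "emeasure ?N {..a} = (\<integral>\<^sup>+r. ennreal (4 * pi * r\<^sup>2) * indicator {0..} r * indicator {..a} r \<partial>lborel)"
        by (subst emeasure_density) auto
      also have "\<dots> = 0" unfolding 0 by simp
      finally show ?thesis .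
    qed
    ultimately show ?thesis by simp
  next
    case False
    have "norm -` {..a} = (cball 0 a :: (real^3) set)"
      by auto
    then have 1: "emeasure ?M {..a} = ennreal (4/3 * pi * a^3)"
      using False emeasure_cball[of a "0::real^3"] by (simp add: emeasure_distr unit_ball_vol_3)
    have "emeasure ?N {..a} = (\<integral>\<^sup>+r. ennreal (4 * pi * r\<^sup>2) * indicator {0..a} r \<partial>lborel)"
      by (subst emeasure_density) (auto intro!: nn_integral_cong simp: indicator_def)
    also have "\<dots> = ennreal (4/3 * pi * a^3 - 4/3*pi*0^3)"
      using False by (intro nn_integral_FTC_Icc) (auto intro!: derivative_eq_intros simp: field_simps)
    finally show ?thesis using 1 by simp
  qed
  show "\<And>X. X \<in> range (\<lambda>a. {..a}) \<Longrightarrow> emeasure ?M X = emeasure ?N X"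
    using eq by auto
  show "emeasure ?M {..real i} \<noteq> \<infinity>" for i using eq[of "real i"] by auto
  show "Int_stable (range (\<lambda>a::real. {..a}))" by (auto simp: Int_stable_def)
  show "(\<Union>i. {..real i}) = UNIV" using real_arch_simple by auto
qed (auto simp: borel_eq_atMost)

lemma nn_integral_radial:
  fixes f :: "real \<Rightarrow> ennreal"
  assumes [measurable]: "f \<in> borel_measurable borel"
  shows "(\<integral>\<^sup>+x. f (norm (x :: real^3)) \<partial>lborel) = (\<integral>\<^sup>+r. ennreal (4 * pi * r\<^sup>2) * f r * indicator {0..} r \<partial>lborel)"
proof -
  have "(\<integral>\<^sup>+x. f (norm (x :: real^3)) \<partial>lborel) = (\<integral>\<^sup>+r. f r \<partial>distr lborel borel (norm :: real^3 \<Rightarrow> real))"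
    by (subst nn_integral_distr) auto
  also have "\<dots> = (\<integral>\<^sup>+r. ennreal (4 * pi * r\<^sup>2) * indicator {0..} r * f r \<partial>lborel)"
    unfolding distr_norm_lborel by (subst nn_integral_density) auto
  finally show ?thesis by (simp add: ac_simps)
qed

text \<open>The surface factor r^2 cancels the singularity. Hence kernels of order -2, such as the
  gradient of the Helmholtz kernel, are locally integrable in dimension three.\<close>

lemma integral_inverse_square_ball:
  "integrable lborel (\<lambda>z::real^3. indicator (cball 0 1) z / (norm z)\<^sup>2)"
  "(LINT z|lborel. indicator (cball 0 1) (z::real^3) / (norm z)\<^sup>2) = 4 * pi"
proof -
  have [measurable]: "(\<lambda>z::real^3. indicator (cball 0 1) z / (norm z)\<^sup>2) \<in> borel_measurable borel"
    by measurable
  have "(\<integral>\<^sup>+z. ennreal (indicator (cball 0 1) (z::real^3) / (norm z)\<^sup>2) \<partial>lborel)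
     = (\<integral>\<^sup>+z. (\<lambda>r. ennreal (indicator {..1} r / r\<^sup>2)) (norm (z::real^3)) \<partial>lborel)"
    by (intro nn_integral_cong) (auto simp: indicator_def)
  also have "\<dots> = (\<integral>\<^sup>+r. ennreal (4 * pi * r\<^sup>2) * ennreal (indicator {..1} r / r\<^sup>2) * indicator {0..} r \<partial>lborel)"
    by (rule nn_integral_radial) measurable
  also have "\<dots> = (\<integral>\<^sup>+r. ennreal (4 * pi) * indicator {0..1::real} r \<partial>lborel)"
  \<comment> \<open>The point r = 0 is discarded: division by zero makes the left side 0 there,
    while the right side is 4 pi.\<close>
  proof (rule nn_integral_cong_AE, rule AE_mp[OF AE_lborel_singleton[of "0::real"]], rule AE_I2, rule impI)
    fix r :: real assume "r \<noteq> 0"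
    then show "ennreal (4 * pi * r\<^sup>2) * ennreal (indicator {..1} r / r\<^sup>2) * indicator {0..} r
        = ennreal (4 * pi) * indicator {0..1} r"
      by (auto simp: indicator_def ennreal_mult[symmetric])
  qed
  also have "\<dots> = ennreal (4 * pi)"
    by (subst nn_integral_cmult_indicator) auto
  finally have nn: "(\<integral>\<^sup>+z. ennreal (indicator (cball 0 1) (z::real^3) / (norm z)\<^sup>2) \<partial>lborel) = ennreal (4*pi)" .
  show "integrable lborel (\<lambda>z::real^3. indicator (cball 0 1) z / (norm z)\<^sup>2)"
    using nn by (intro integrableI_nonneg) auto
  show "(LINT z|lborel. indicator (cball 0 1) (z::real^3) / (norm z)\<^sup>2) = 4 * pi"
    using nn by (intro integral_eq_nn_integral[THEN trans]) auto
qed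

text \<open>A single integrable majorant for all the weakly singular kernels below.\<close>

definition sing :: "real^3 \<Rightarrow> real" where
  "sing z = 1 + indicator (cball 0 1) z / (norm z)\<^sup>2"

lemma sing_measurable [measurable]: "sing \<in> borel_measurable borel"
  unfolding sing_def[abs_def] by measurable

lemma sing_ge1: "1 \<le> sing z"
  by (simp add: sing_def)

lemma sing_minus: "sing (x - y) = sing (y - x)"
  by (simp add: sing_def norm_minus_commute indicator_def)

text \<open>In the unit ball 1/|z| is at most 1/|z|^2; outside it the summand 1 of
  \<open>sing\<close> suffices. At the origin both quotients are 0 by division by zero.\<close>

lemma sing_ge_inverse:
  shows "1 / norm z \<le> sing z" "1 / (norm z)\<^sup>2 \<le> sing z"
proof -
  show 2: "1 / (norm z)\<^sup>2 \<le> sing z"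
  proof (cases "norm z \<le> 1")
    case False
    then have "1 \<le> (norm z)\<^sup>2" by (simp add: one_le_power)
    then have "1 / (norm z)\<^sup>2 \<le> 1" by (simp add: divide_le_eq)
    with False show ?thesis by (simp add: sing_def)
  qed (simp add: sing_def)
  show "1 / norm z \<le> sing z"
  proof (cases "norm z \<le> 1 \<and> z \<noteq> 0")
    case True
    then have "(norm z)\<^sup>2 \<le> norm z" by (simp add: power2_eq_square mult_left_le)
    then have "1 / norm z \<le> 1 / (norm z)\<^sup>2" using True by (intro divide_left_mono) auto
    with 2 show ?thesis by linarith
  next
    case False
    then have "1 / norm z \<le> 1" by (auto simp: divide_le_eq)
    with sing_ge1[of z] show ?thesis by linarith
  qed
qed

text \<open>One summand for each term of \<open>sing\<close>. The singular term is integrated over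
  the whole space, which makes the bound independent of the position of the pole.\<close>

definition sing_bound :: "real \<Rightarrow> real" where
  "sing_bound R = measure lborel (cball (0::real^3) R) + 4 * pi"

lemma sing_bound_pos: "0 < sing_bound R"
  unfolding sing_bound_def by (intro add_nonneg_pos) auto

lemma sing_integral_cball:
  shows "integrable lborel (\<lambda>y. indicator (cball 0 R) y * sing (x - y))"
    and "(LINT y|lborel. indicator (cball 0 R) y * sing (x - y)) \<le> sing_bound R"
proof -
  let ?g = "\<lambda>z::real^3. indicator (cball 0 1) z / (norm z)\<^sup>2"
  have i0: "integrable lborel (\<lambda>y. ?g (x - y))"
    by (rule integrable_lborel_reflect[OF integral_inverse_square_ball(1)])
  have i1 [simp]: "integrable lborel (\<lambda>y::real^3. indicator (cball 0 R) y :: real)"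
    by simp
  have i2: "integrable lborel (\<lambda>y. indicator (cball 0 R) y * ?g (x - y))"
    by (rule Bochner_Integration.integrable_bound[OF i0], measurable) (simp add: indicator_def)
  have eq: "indicator (cball 0 R) y * sing (x - y) = indicator (cball 0 R) y + indicator (cball 0 R) y * ?g (x - y)" for y
    by (simp add: sing_def algebra_simps)
  show "integrable lborel (\<lambda>y. indicator (cball 0 R) y * sing (x - y))"
    unfolding eq using i1 i2 by (intro Bochner_Integration.integrable_add)
  have "(LINT y|lborel. indicator (cball 0 R) y * sing (x - y))
     = (LINT y|lborel. indicator (cball 0 R) (y::real^3)) + (LINT y|lborel. indicator (cball 0 R) y * ?g (x - y))"
    unfolding eq using i1 i2 by (intro Bochner_Integration.integral_add)
  also have "(LINT y|lborel. indicator (cball 0 R) y * ?g (x - y)) \<le> (LINT y|lborel. ?g (x - y))"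
    using i2 i0 by (intro integral_mono) (assumption, assumption, simp add: indicator_def)
  also have "\<dots> = 4 * pi"
    using integral_lborel_reflect[of ?g x] integral_inverse_square_ball(2) by simp
  finally show "(LINT y|lborel. indicator (cball 0 R) y * sing (x - y)) \<le> sing_bound R"
    by (simp add: sing_bound_def)
qed

section \<open>Directional derivatives\<close>

text \<open>A derivative along a single direction, with continuity of function and derivative, is
  all that integration by parts needs. Products, translates and radial functions can then be treated
  without total derivatives.\<close>

definition dirder :: "'a::euclidean_space \<Rightarrow> ('a \<Rightarrow> 'b::real_normed_vector) \<Rightarrow> ('a \<Rightarrow> 'b) \<Rightarrow> bool" where
  "dirder e f f' \<longleftrightarrow> continuous_on UNIV f \<and> continuous_on UNIV f' \<and>
     (\<forall>x. ((\<lambda>t. f (x + t *\<^sub>R e)) has_vector_derivative f' x) (at 0))"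

lemma dirder_at:
  assumes "dirder e f f'"
  shows "((\<lambda>t. f (x + t *\<^sub>R e)) has_vector_derivative f' (x + s *\<^sub>R e)) (at s)"
proof -
  have "((\<lambda>t. f ((x + s *\<^sub>R e) + t *\<^sub>R e)) has_vector_derivative f' (x + s *\<^sub>R e)) (at (s - s))"
    using assms by (simp add: dirder_def)
  moreover have "((\<lambda>t. t - s) has_vector_derivative 1) (at s)"
    by (auto intro!: derivative_eq_intros simp: has_real_derivative_iff_has_vector_derivative[symmetric])
  ultimately have "((\<lambda>t. f ((x + s *\<^sub>R e) + t *\<^sub>R e)) \<circ> (\<lambda>t. t - s) has_vector_derivative 1 *\<^sub>R f' (x + s *\<^sub>R e)) (at s)"
    by (intro vector_diff_chain_at)
  then show ?thesis by (simp add: o_def algebra_simps)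
qed

lemma dirder_support:
  assumes "dirder e f f'" and "\<And>x. norm x > R \<Longrightarrow> f x = 0" and "norm x > R"
  shows "f' x = 0"
proof -
  have "((\<lambda>t. norm (x + t *\<^sub>R e)) \<longlongrightarrow> norm (x + 0 *\<^sub>R e)) (at 0)"
    by (intro tendsto_intros)
  then have "eventually (\<lambda>t. norm (x + t *\<^sub>R e) > R) (at 0)"
    using assms(3) by (intro order_tendstoD) auto
  then have ev: "eventually (\<lambda>t. f (x + t *\<^sub>R e) = 0) (at 0)"
    by eventually_elim (rule assms(2))
  then have ev: "eventually (\<lambda>t. f (x + t *\<^sub>R e) = 0) (nhds 0)"
    using assms(2,3) by (simp add: eventually_nhds_conv_at)
  have "((\<lambda>t. f (x + t *\<^sub>R e)) has_vector_derivative f' x) (at 0)"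
    using assms by (simp add: dirder_def)
  then have "((\<lambda>t. 0) has_vector_derivative f' x) (at 0)"
    using ev assms(2,3) by (subst (asm) has_vector_derivative_cong_ev[where g = "\<lambda>_. 0"]) auto
  then show ?thesis
    using vector_derivative_unique_at[OF _ has_vector_derivative_const] by blast
qed

lemma bounded_of_compact_support:
  fixes f :: "'a::euclidean_space \<Rightarrow> 'b::real_normed_vector"
  assumes "continuous_on UNIV f" and "\<And>x. norm x > R \<Longrightarrow> f x = 0"
  shows "\<exists>M\<ge>0. \<forall>x. norm (f x) \<le> M"
proof -
  have "compact (f ` cball 0 R)"
    using assms by (intro compact_continuous_image continuous_on_subset[OF assms(1)]) auto
  then obtain M where M: "\<forall>y\<in>f ` cball 0 R. norm y \<le> M"
    using compact_imp_bounded bounded_iff by metis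
  have "norm (f x) \<le> max 0 M" for x
    using M assms(2)[of x] by (cases "norm x > R") (auto simp: le_max_iff_disj)
  then show ?thesis by (intro exI[of _ "max 0 M"]) auto
qed

lemma integrable_of_bounded_support:
  fixes f :: "'a::euclidean_space \<Rightarrow> 'b::{banach,second_countable_topology}"
  assumes [measurable]: "f \<in> borel_measurable borel" and "\<And>x. norm x > R \<Longrightarrow> f x = 0" "\<And>x. norm (f x) \<le> M"
  shows "integrable lborel f"
proof (rule Bochner_Integration.integrable_bound)
  show "integrable lborel (\<lambda>x::'a. M * indicator (cball 0 R) x)"
    by simp
  have "norm (f x) \<le> norm (M * indicator (cball 0 R) x)" for x
    using assms(2)[of x] assms(3)[of x] norm_ge_zero[of "f x"] by (auto simp: indicator_def not_le)
  then show "AE x in lborel. norm (f x) \<le> norm (M * indicator (cball 0 R) x)" by simp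
qed simp

lemma integrable_continuous_support:
  fixes f :: "'a::euclidean_space \<Rightarrow> 'b::{banach,second_countable_topology}"
  assumes "continuous_on UNIV f" and "\<And>x. norm x > R \<Longrightarrow> f x = 0"
  shows "integrable lborel f"
proof -
  obtain M where "\<And>x. norm (f x) \<le> M"
    using bounded_of_compact_support[of f R] assms by auto
  then show ?thesis
    using assms by (intro integrable_of_bounded_support[of f R M] borel_measurable_continuous_onI)
qed

text \<open>Difference quotients along \<open>e\<close> have integral 0 by translation invariance
  and converge to the derivative; the mean value inequality supplies the majorant.\<close>

lemma integral_dirder_eq_0:
  fixes f f' :: "'a::euclidean_space \<Rightarrow> 'b::{banach,second_countable_topology}"
  assumes d: "dirder e f f'" and supp: "\<And>x. norm x > R \<Longrightarrow> f x = 0"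
  shows "(LINT x|lborel. f' x) = 0"
proof -
  define s where "s = (\<lambda>(i::nat) x. (real (Suc i)) *\<^sub>R (f (x + (1 / real (Suc i)) *\<^sub>R e) - f x))"
  have cont: "continuous_on UNIV f" "continuous_on UNIV f'" using d by (auto simp: dirder_def)
  have [measurable]: "f \<in> borel_measurable borel" "f' \<in> borel_measurable borel"
    using cont by (auto intro: borel_measurable_continuous_onI)
  obtain M where M: "M \<ge> 0" "\<And>x. norm (f' x) \<le> M"
    using bounded_of_compact_support[of f' R] cont(2) dirder_support[OF d supp] by auto
  have lip: "norm (f (x + h *\<^sub>R e) - f x) \<le> M * \<bar>h\<bar>" for x h
  proof -
    have "norm (f (x + h *\<^sub>R e) - f (x + 0 *\<^sub>R e)) \<le> M * norm (h - 0)"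
    proof (rule differentiable_bound[of UNIV "\<lambda>t. f (x + t *\<^sub>R e)" "\<lambda>s t. t *\<^sub>R f' (x + s *\<^sub>R e)"])
      fix s :: real
      show "((\<lambda>t. f (x + t *\<^sub>R e)) has_derivative (\<lambda>t. t *\<^sub>R f' (x + s *\<^sub>R e))) (at s within UNIV)"
        using dirder_at[OF d] by (simp add: has_vector_derivative_def)
      show "onorm (\<lambda>t. t *\<^sub>R f' (x + s *\<^sub>R e)) \<le> M"
        using M(2)[of "x + s *\<^sub>R e"] by (intro onorm_le) (simp add: mult_left_mono mult.commute[of M])
    qed auto
    then show ?thesis by simp
  qed
  have "(\<lambda>i. LINT x|lborel. s i x) \<longlonglongrightarrow> (LINT x|lborel. f' x)"
  \<comment> \<open>The ball is enlarged by \<open>norm e\<close> because the step lengths 1/(i+1)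
    are at most 1.\<close>
  proof (rule integral_dominated_convergence[where w = "\<lambda>x. M * indicator (cball 0 (\<bar>R\<bar> + norm e)) x"])
    show "AE x in lborel. (\<lambda>i. s i x) \<longlonglongrightarrow> f' x"
    proof (rule AE_I2)
      fix x
      have "((\<lambda>t. f (x + t *\<^sub>R e)) has_vector_derivative f' x) (at 0)"
        using d by (simp add: dirder_def)
      then have "((\<lambda>t. (1 / norm t) *\<^sub>R (f (x + t *\<^sub>R e) - (f x + t *\<^sub>R f' x))) \<longlongrightarrow> 0) (at 0)"
        unfolding has_vector_derivative_def by (simp add: has_derivative_within)
      moreover have "filterlim (\<lambda>i. 1 / real (Suc i)) (at 0) sequentially"
        using LIMSEQ_inverse_real_of_nat by (auto simp: filterlim_at inverse_eq_divide)
      ultimately have "(\<lambda>i. (1 / norm (1 / real (Suc i))) *\<^sub>R (f (x + (1 / real (Suc i)) *\<^sub>R e) - (f x + (1 / real (Suc i)) *\<^sub>R f' x))) \<longlonglongrightarrow> 0"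
        by (rule filterlim_compose)
      moreover have "(1 / norm (1 / real (Suc i))) *\<^sub>R (f (x + (1 / real (Suc i)) *\<^sub>R e) - (f x + (1 / real (Suc i)) *\<^sub>R f' x)) = s i x - f' x" for i
        by (simp add: s_def scaleR_diff_right scaleR_add_right del: of_nat_Suc)
      ultimately show "(\<lambda>i. s i x) \<longlonglongrightarrow> f' x" by (simp add: LIM_zero_iff)
    qed
    show "AE x in lborel. norm (s i x) \<le> M * indicator (cball 0 (\<bar>R\<bar> + norm e)) x" for i
    proof (rule AE_I2)
      fix x
      show "norm (s i x) \<le> M * indicator (cball 0 (\<bar>R\<bar> + norm e)) x"
      proof (cases "norm x \<le> \<bar>R\<bar> + norm e")
        case True
        have "norm (s i x) \<le> real (Suc i) * (M * \<bar>1 / real (Suc i)\<bar>)"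
          unfolding s_def norm_scaleR using lip[of x "1 / real (Suc i)"] by (intro mult_mono) (auto simp del: of_nat_Suc)
        also have "\<dots> = M" by simp
        finally show ?thesis using True by (simp add: indicator_def)
      next
        case False
        have "norm x \<le> norm (x + (1 / real (Suc i)) *\<^sub>R e) + norm ((1 / real (Suc i)) *\<^sub>R e)"
          by (metis add_diff_cancel norm_triangle_ineq4)
        also have "norm ((1 / real (Suc i)) *\<^sub>R e) \<le> norm e"
          using mult_left_le_one_le[of "norm e" "1 / real (Suc i)"] by simp
        finally have "norm (x + (1 / real (Suc i)) *\<^sub>R e) > R" using False by linarith
        moreover have "norm x > R" using False norm_ge_zero[of e] by linarith
        ultimately show ?thesis using False supp by (simp add: s_def)
      qed
    qed
  qed (auto simp: s_def)
  moreover have "(LINT x|lborel. s i x) = 0" for i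
  proof -
    have int: "integrable lborel f"
      using integrable_continuous_support[OF cont(1) supp] .
    have "(LINT x|lborel. f (x + c)) = (LINT x|lborel. f x)" "integrable lborel (\<lambda>x. f (x + c))" for c
      using integral_lborel_translate[of f c] integrable_lborel_translate[OF int, of c] by (simp_all add: add.commute)
    then show ?thesis using int unfolding s_def by simp
  qed
  ultimately show ?thesis by (simp add: LIMSEQ_const_iff)
qed

section \<open>The fundamental solution of the Helmholtz equation\<close>

lemma dirder_cong:
  "dirder e f f' \<Longrightarrow> (\<And>x. g x = f x) \<Longrightarrow> (\<And>x. g' x = f' x) \<Longrightarrow> dirder e g g'"
  by (simp add: dirder_def)

lemma dirder_mult:
  fixes f g :: "'a::euclidean_space \<Rightarrow> 'b::real_normed_algebra"
  assumes "dirder e f f'" "dirder e g g'"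
  shows "dirder e (\<lambda>x. f x * g x) (\<lambda>x. f x * g' x + f' x * g x)"
proof -
  have "((\<lambda>t. f (x + t *\<^sub>R e) * g (x + t *\<^sub>R e)) has_vector_derivative f (x + 0 *\<^sub>R e) * g' x + f' x * g (x + 0 *\<^sub>R e)) (at 0)" for x
    using assms by (intro has_vector_derivative_mult) (auto simp: dirder_def)
  then show ?thesis using assms by (auto simp: dirder_def intro!: continuous_intros)
qed

lemma dirder_add:
  assumes "dirder e f f'" "dirder e g g'"
  shows "dirder e (\<lambda>x. f x + g x) (\<lambda>x. f' x + g' x)"
  using assms by (auto simp: dirder_def intro!: continuous_intros has_vector_derivative_add)

lemma dirder_cmult:
  fixes f :: "'a::euclidean_space \<Rightarrow> 'b::real_normed_algebra"
  assumes "dirder e f f'"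
  shows "dirder e (\<lambda>x. c * f x) (\<lambda>x. c * f' x)"
  using assms by (auto simp: dirder_def intro!: continuous_intros has_vector_derivative_mult_right)

lemma dirder_translate:
  assumes "dirder e f f'"
  shows "dirder e (\<lambda>x. f (x - c)) (\<lambda>x. f' (x - c))"
proof -
  have "continuous_on UNIV (\<lambda>x. f (x - c))" "continuous_on UNIV (\<lambda>x. f' (x - c))"
    using assms unfolding dirder_def
    by (auto intro!: continuous_on_compose2[of UNIV f] continuous_on_compose2[of UNIV f'] continuous_intros)
  moreover have "((\<lambda>t. f ((x - c) + t *\<^sub>R e)) has_vector_derivative f' (x - c)) (at 0)" for x
    using assms unfolding dirder_def by blast
  ultimately show ?thesis by (simp add: dirder_def algebra_simps)
qed

lemma dirder_coord:
  "dirder (axis j 1) (\<lambda>z::real^'n. complex_of_real (z $ j)) (\<lambda>_. 1)"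
proof -
  have "((\<lambda>t. complex_of_real (z $ j) + complex_of_real t) has_vector_derivative 1) (at 0)" for z :: "real^'n"
    by (rule has_vector_derivative_real_field) (auto intro!: derivative_eq_intros)
  then show ?thesis
    unfolding dirder_def by (auto intro!: continuous_intros simp: axis_def)
qed

lemma integral_by_parts:
  fixes f g :: "'a::euclidean_space \<Rightarrow> complex"
  assumes f: "dirder e f f'" and g: "dirder e g g'" and supp: "\<And>x. norm x > R \<Longrightarrow> g x = 0"
  shows "(LINT x|lborel. f x * g' x) = - (LINT x|lborel. f' x * g x)"
proof -
  have s: "f x * g x = 0" "f' x * g x = 0" "f x * g' x = 0" if "norm x > R" for x
    using supp[OF that] dirder_support[OF g supp that] by auto
  have c: "continuous_on UNIV f" "continuous_on UNIV g" "continuous_on UNIV f'" "continuous_on UNIV g'"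
    using f g by (auto simp: dirder_def)
  have "(LINT x|lborel. f x * g' x + f' x * g x) = 0"
    by (rule integral_dirder_eq_0[OF dirder_mult[OF f g] s(1)])
  moreover have "integrable lborel (\<lambda>x. f x * g' x)" "integrable lborel (\<lambda>x. f' x * g x)"
    using c s by (auto intro!: integrable_continuous_support[of _ R] continuous_intros)
  ultimately show ?thesis by (simp add: add_eq_0_iff)
qed

lemma Ck_Suc_dirder:
  assumes "Ck (Suc k) f" and "e \<in> Basis"
  shows "dirder e f (\<lambda>x. frechet_derivative f (at x) e)"
proof -
  have d: "(f has_derivative frechet_derivative f (at x)) (at x)" for x
    using assms by (auto simp: differentiable_on_def frechet_derivative_works[symmetric])
  have "((\<lambda>t. f (x + t *\<^sub>R e)) has_vector_derivative frechet_derivative f (at x) e) (at 0)" for x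
  proof -
    have "((\<lambda>t. x + t *\<^sub>R e) has_derivative (\<lambda>t. t *\<^sub>R e)) (at 0)"
      by (auto intro!: derivative_eq_intros)
    from has_derivative_compose[OF this, of f "frechet_derivative f (at x)"] d[of x]
    have "((\<lambda>t. f (x + t *\<^sub>R e)) has_derivative (\<lambda>t. frechet_derivative f (at x) (t *\<^sub>R e))) (at 0)" by simp
    then show ?thesis
      using d[of x] by (simp add: has_vector_derivative_def linear_scale has_derivative_linear)
  qed
  moreover have "continuous_on UNIV g" if "Ck j g" for j and g :: "'a \<Rightarrow> 'b"
    using that by (cases j) (auto intro: differentiable_imp_continuous_on)
  ultimately show ?thesis
    using assms unfolding dirder_def by (auto intro: differentiable_imp_continuous_on)
qed

lemma dirder_partial:
  assumes "Ck (Suc k) f"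
  shows "dirder (axis j 1) f (partial j f)" "Ck k (partial j f)"
  using assms Ck_Suc_dirder[OF assms, of "axis j 1"] 
  by (auto simp: partial_def[abs_def] axis_in_Basis_iff)

lemma compactly_supported_ball:
  assumes "compactly_supported (f :: 'a::euclidean_space \<Rightarrow> 'b::zero)"
  obtains R where "R > 0" "\<And>x. norm x > R \<Longrightarrow> f x = 0"
proof -
  have "bounded (closure {x. f x \<noteq> 0})" using assms compact_imp_bounded unfolding compactly_supported_def by blast
  then obtain R where R: "\<forall>x\<in>closure {x. f x \<noteq> 0}. norm x \<le> R" by (auto simp: bounded_iff)
  have "f x = 0" if "norm x > max R 1" for x
  proof (rule ccontr)
    assume "f x \<noteq> 0"
    then have "x \<in> closure {x. f x \<noteq> 0}" using closure_subset by fastforce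
    with R that show False by auto
  qed
  then show thesis by (intro that[of "max R 1"]) auto
qed

text \<open>Replacing \<open>|z|\<close> by \<open>rho \<epsilon> z\<close> makes the kernels below smooth; their identities follow by letting \<open>\<epsilon>\<close> tend to \<open>0\<close>.\<close>

definition rho :: "real \<Rightarrow> real^3 \<Rightarrow> real" where
  "rho \<epsilon> z = sqrt ((norm z)\<^sup>2 + \<epsilon>\<^sup>2)"

lemma rho_pos: "\<epsilon> > 0 \<Longrightarrow> rho \<epsilon> z > 0"
  by (simp add: rho_def add_nonneg_pos)

lemma rho_ge: "norm z \<le> rho \<epsilon> z"
  unfolding rho_def by (rule real_le_rsqrt) simp

lemma rho_ge_eps: "\<epsilon> \<ge> 0 \<Longrightarrow> \<epsilon> \<le> rho \<epsilon> z"
  unfolding rho_def by (rule real_le_rsqrt) simp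

lemma rho_sq: "(rho \<epsilon> z)\<^sup>2 = (norm z)\<^sup>2 + \<epsilon>\<^sup>2"
  by (simp add: rho_def)

lemma rho_0: "rho 0 z = norm z"
  by (simp add: rho_def)

text \<open>This homogeneity turns the concentrating term in \<open>Phi_fundamental\<close> into a
  fixed density.\<close>

lemma rho_scale: "\<epsilon> > 0 \<Longrightarrow> rho \<epsilon> (\<epsilon> *\<^sub>R z) = \<epsilon> * rho 1 z"
  unfolding rho_def by (rule real_sqrt_unique) (auto simp: power_mult_distrib algebra_simps)

lemma continuous_rho [continuous_intros]: "continuous_on S f \<Longrightarrow> continuous_on S (\<lambda>x. rho \<epsilon> (f x))"
  unfolding rho_def by (intro continuous_intros)

lemma rho_measurable [measurable]: "rho \<epsilon> \<in> borel_measurable borel"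
  by (intro borel_measurable_continuous_onI continuous_intros)

lemma dirder_radial:
  fixes F F' :: "real \<Rightarrow> complex"
  assumes e: "\<epsilon> > 0" and F: "\<And>r. r > 0 \<Longrightarrow> (F has_vector_derivative F' r) (at r)"
    and cF': "continuous_on {0<..} F'"
  shows "dirder (axis j 1) (\<lambda>z. F (rho \<epsilon> z)) (\<lambda>z. F' (rho \<epsilon> z) * of_real (z $ j / rho \<epsilon> z))"
proof -
  have cF: "continuous_on {0<..} F"
    using F by (auto intro!: continuous_at_imp_continuous_on has_vector_derivative_continuous)
  have "continuous_on UNIV (\<lambda>z. F (rho \<epsilon> z))" "continuous_on UNIV (\<lambda>z. F' (rho \<epsilon> z))"
    by (rule continuous_on_compose2[OF cF] continuous_on_compose2[OF cF'], intro continuous_intros, use rho_pos[OF e] in auto)+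
  moreover have "((\<lambda>t. F (rho \<epsilon> (z + t *\<^sub>R axis j 1))) has_vector_derivative F' (rho \<epsilon> z) * of_real (z $ j / rho \<epsilon> z)) (at 0)" for z
  proof -
    have n: "(norm (z + t *\<^sub>R axis j 1))\<^sup>2 = (norm z)\<^sup>2 + 2 * t * (z $ j) + t\<^sup>2" for t
      by (simp only: power2_norm_eq_inner inner_add_left inner_add_right inner_scaleR_left inner_scaleR_right)
         (simp add: inner_axis inner_commute[of "axis j 1"] power2_eq_square algebra_simps)
    have pos: "0 < (norm z)\<^sup>2 + \<epsilon>\<^sup>2" using e by (simp add: add_nonneg_pos)
    have "((\<lambda>t. rho \<epsilon> (z + t *\<^sub>R axis j 1)) has_vector_derivative (z $ j / rho \<epsilon> z)) (at 0)"
      unfolding rho_def n has_real_derivative_iff_has_vector_derivative[symmetric]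
      using pos by (auto intro!: derivative_eq_intros simp: field_simps)
    moreover have "(F has_vector_derivative F' (rho \<epsilon> z)) (at (rho \<epsilon> (z + 0 *\<^sub>R axis j 1)))"
      using F rho_pos[OF e] by simp
    ultimately have "(F \<circ> (\<lambda>t. rho \<epsilon> (z + t *\<^sub>R axis j 1)) has_vector_derivative (z $ j / rho \<epsilon> z) *\<^sub>R F' (rho \<epsilon> z)) (at 0)"
      by (rule vector_diff_chain_at)
    then show ?thesis by (simp add: o_def scaleR_conv_of_real mult.commute)
  qed
  ultimately show ?thesis using rho_pos[OF e]
    unfolding dirder_def by (auto intro!: continuous_intros simp: less_imp_neq[THEN not_sym])
qed

text \<open>At the origin \<open>Phi\<close> and \<open>DPhi\<close> take the value \<open>0\<close>, by division by zero.\<close>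

definition Phi :: "complex \<Rightarrow> real^3 \<Rightarrow> complex" where
  "Phi k z = exp (\<i> * k * of_real (norm z)) / of_real (norm z)"

definition DPhi :: "complex \<Rightarrow> 3 \<Rightarrow> real^3 \<Rightarrow> complex" where
  "DPhi k j z = (\<i> * k / of_real (norm z) - 1 / of_real ((norm z)\<^sup>2)) * exp (\<i> * k * of_real (norm z))
      * of_real (z $ j / norm z)"

lemma Phi_measurable [measurable]: "Phi k \<in> borel_measurable borel"
  unfolding Phi_def[abs_def] by measurable

lemma DPhi_measurable [measurable]: "DPhi k j \<in> borel_measurable borel"
proof -
  have [measurable]: "(\<lambda>z::real^3. z $ j) \<in> borel_measurable borel"
    by (intro borel_measurable_continuous_onI continuous_intros)
  show ?thesis unfolding DPhi_def[abs_def] by measurable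
qed

lemma Phi_minus: "Phi k (x - y) = Phi k (y - x)"
  by (simp add: Phi_def norm_minus_commute)

lemma DPhi_minus: "DPhi k j (- z) = - DPhi k j z" "DPhi k j (x - y) = - DPhi k j (y - x)"
proof -
  show "DPhi k j (- z) = - DPhi k j z" for z by (simp add: DPhi_def)
  from this[of "y - x"] show "DPhi k j (x - y) = - DPhi k j (y - x)" by simp
qed

lemma norm_exp_le_1: "Im k \<ge> 0 \<Longrightarrow> r \<ge> 0 \<Longrightarrow> norm (exp (\<i> * k * of_real r)) \<le> 1"
  by (simp add: norm_exp_eq_Re)

text \<open>The radial profile of \<open>Phi\<close> with \<open>rad1\<close> =
  \<open>rad0\<close>'/r and \<open>rad2\<close> = \<open>rad1\<close>'. Dividing by r makes the
  j-th derivative of \<open>rad0 k (rho \<epsilon> z)\<close> equal to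
  \<open>rad1 k (rho \<epsilon> z)\<close> times z_j, without a quotient, so the next derivative is
  a plain product rule.\<close>

definition rad0 :: "complex \<Rightarrow> real \<Rightarrow> complex" where
  "rad0 k r = exp (\<i> * k * of_real r) / of_real r"
definition rad1 :: "complex \<Rightarrow> real \<Rightarrow> complex" where
  "rad1 k r = (\<i> * k / of_real (r^2) - 1 / of_real (r^3)) * exp (\<i> * k * of_real r)"
definition rad2 :: "complex \<Rightarrow> real \<Rightarrow> complex" where
  "rad2 k r = (- k\<^sup>2 / of_real (r^2) - 3 * \<i> * k / of_real (r^3) + 3 / of_real (r^4)) * exp (\<i> * k * of_real r)"

lemma rad0_deriv: "r > 0 \<Longrightarrow> (rad0 k has_vector_derivative of_real r * rad1 k r) (at r)"
  unfolding rad0_def[abs_def] rad1_def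
  by (rule has_vector_derivative_real_field[where f = "\<lambda>r. exp (\<i> * k * r) / r", THEN has_vector_derivative_eq_rhs])
     (auto intro!: derivative_eq_intros simp: field_simps power2_eq_square power3_eq_cube)

lemma rad1_deriv: "r > 0 \<Longrightarrow> (rad1 k has_vector_derivative rad2 k r) (at r)"
  unfolding rad1_def[abs_def] rad2_def of_real_power
  by (rule has_vector_derivative_real_field[where f = "\<lambda>r. (\<i> * k / r^2 - 1 / r^3) * exp (\<i> * k * r)"])
     (auto intro!: derivative_eq_intros simp: field_simps power2_eq_square power3_eq_cube power4_eq_xxxx)

lemma rad_cont: "continuous_on {0<..} (rad0 k)" "continuous_on {0<..} (rad1 k)" "continuous_on {0<..} (rad2 k)"
  unfolding rad0_def[abs_def] rad1_def[abs_def] rad2_def[abs_def] by (auto intro!: continuous_intros)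

lemma dirder_rad0: "\<epsilon> > 0 \<Longrightarrow> dirder (axis j 1) (\<lambda>z. rad0 k (rho \<epsilon> z)) (\<lambda>z. rad1 k (rho \<epsilon> z) * of_real (z $ j))"
  by (rule dirder_cong[OF dirder_radial[where F = "rad0 k" and F' = "\<lambda>r. of_real r * rad1 k r"]])
     (use rho_pos[of \<epsilon>] in \<open>auto intro!: rad0_deriv continuous_intros rad_cont simp: less_imp_neq[THEN not_sym]\<close>)

lemma dirder_rad1: "\<epsilon> > 0 \<Longrightarrow> dirder (axis j 1) (\<lambda>z. rad1 k (rho \<epsilon> z) * of_real (z $ j))
     (\<lambda>z. rad1 k (rho \<epsilon> z) + rad2 k (rho \<epsilon> z) * of_real ((z $ j)\<^sup>2 / rho \<epsilon> z))"
  by (rule dirder_cong[OF dirder_mult[OF dirder_radial[where F = "rad1 k" and F' = "rad2 k"] dirder_coord]])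
     (auto intro!: rad1_deriv rad_cont simp: power2_eq_square)

text \<open>As \<open>rho \<epsilon> z\<close> is at least |z|, this bound and the next are uniform
  in \<epsilon>. At \<epsilon> = 0 they yield the bounds for \<open>Phi\<close> and
  \<open>DPhi\<close>.\<close>

lemma norm_rad0_le:
  assumes "Im k \<ge> 0" "z \<noteq> 0"
  shows "norm (rad0 k (rho \<epsilon> z)) \<le> sing z"
proof -
  have r: "rho \<epsilon> z > 0" "rho \<epsilon> z \<ge> norm z"
    using rho_ge[of z \<epsilon>] assms less_le_trans[of 0 "norm z" "rho \<epsilon> z"] by auto
  have "norm (rad0 k (rho \<epsilon> z)) = norm (exp (\<i> * k * of_real (rho \<epsilon> z))) / rho \<epsilon> z"
    using r by (simp add: rad0_def norm_divide)
  also have "\<dots> \<le> 1 / norm z"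
    using r assms by (intro frac_le norm_exp_le_1) auto
  also have "\<dots> \<le> sing z" by (rule sing_ge_inverse)
  finally show ?thesis .
qed

lemma norm_rad1_le:
  assumes "Im k \<ge> 0" "z \<noteq> 0"
  shows "norm (rad1 k (rho \<epsilon> z) * of_real (z $ j)) \<le> (norm k + 1) * sing z"
proof -
  have r: "rho \<epsilon> z > 0" "rho \<epsilon> z \<ge> norm z"
    using rho_ge[of z \<epsilon>] assms less_le_trans[of 0 "norm z" "rho \<epsilon> z"] by auto
  have "norm (rad1 k (rho \<epsilon> z) * of_real (z $ j)) 
    \<le> norm (\<i> * k / of_real ((rho \<epsilon> z)^2) - 1 / of_real ((rho \<epsilon> z)^3)) * 1 * rho \<epsilon> z"
    unfolding rad1_def norm_mult using r assms component_le_norm_cart[of z j]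
    by (intro mult_mono norm_exp_le_1) auto
  also have "\<dots> \<le> (norm k / (rho \<epsilon> z)^2 + 1 / (rho \<epsilon> z)^3) * rho \<epsilon> z"
    using r norm_triangle_ineq4[of "\<i> * k / of_real ((rho \<epsilon> z)^2)" "1 / of_real ((rho \<epsilon> z)^3)"]
    by (intro mult_right_mono) (auto simp: norm_divide norm_mult norm_power)
  also have "\<dots> = norm k * (1 / rho \<epsilon> z) + 1 / (rho \<epsilon> z)^2"
    using r by (simp add: field_simps power2_eq_square power3_eq_cube)
  also have "\<dots> \<le> norm k * (1 / norm z) + 1 / (norm z)^2"
    using r assms by (intro add_mono mult_left_mono divide_left_mono power_mono) auto
  also have "\<dots> \<le> norm k * sing z + sing z"
    by (intro add_mono mult_left_mono sing_ge_inverse) auto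
  finally show ?thesis by (simp add: algebra_simps)
qed

lemma tendsto_rho: "(\<lambda>n. rho (1 / real (Suc n)) z) \<longlonglongrightarrow> norm z"
proof -
  have "(\<lambda>n. sqrt ((norm z)\<^sup>2 + (1 / real (Suc n))\<^sup>2)) \<longlonglongrightarrow> sqrt ((norm z)\<^sup>2 + 0\<^sup>2)"
    using LIMSEQ_inverse_real_of_nat by (intro tendsto_intros) (simp add: inverse_eq_divide)
  then show ?thesis by (simp add: rho_def)
qed

lemma tendsto_radial:
  assumes "continuous_on {0<..} F" "z \<noteq> 0"
  shows "(\<lambda>n. F (rho (1 / real (Suc n)) z)) \<longlonglongrightarrow> F (norm z)"
proof (rule isCont_tendsto_compose[OF _ tendsto_rho])
  show "isCont F (norm z)"
    using assms by (intro continuous_on_interior[OF assms(1)]) (simp add: interior_open)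
qed

section \<open>Integrals against weakly singular kernels\<close>

lemma AE_neq_lborel: "AE y in lborel. y \<noteq> (x :: 'a::euclidean_space)"
  using AE_lborel_singleton[of x] .

text \<open>The constant does not involve x, so the second conclusion serves below as a sup norm
  bound for operators with such kernels.\<close>

lemma kernel_integrable:
  fixes K :: "real^3 \<Rightarrow> complex"
  assumes [measurable]: "K \<in> borel_measurable borel" "\<phi> \<in> borel_measurable borel"
    and K: "\<And>z. z \<noteq> 0 \<Longrightarrow> norm (K z) \<le> C * sing z" and C: "C \<ge> 0"
    and \<phi>: "\<And>y. norm y > R \<Longrightarrow> \<phi> y = 0" "\<And>y. norm (\<phi> y) \<le> M"
  shows "integrable lborel (\<lambda>y. K (y - x) * \<phi> y)"
    and "norm (LINT y|lborel. K (y - x) * \<phi> y) \<le> C * M * sing_bound R"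
proof -
  define w where "w = (\<lambda>y. C * M * (indicator (cball 0 R) y * sing (x - y)))"
  have M: "M \<ge> 0" using \<phi>(2)[of 0] norm_ge_zero order_trans by blast
  have w: "integrable lborel w"
    unfolding w_def by (intro integrable_mult_right sing_integral_cball)
  have b: "AE y in lborel. norm (K (y - x) * \<phi> y) \<le> w y"
    using AE_neq_lborel[of x]
  proof eventually_elim
    case (elim y)
    have "norm (K (y - x) * \<phi> y) \<le> (C * sing (x - y)) * (M * indicator (cball 0 R) y)"
      unfolding norm_mult using K[of "y - x"] elim \<phi>(1)[of y] \<phi>(2)[of y] C M sing_ge1[of "x - y"]
      by (intro mult_mono) (auto simp: sing_minus[of x y] indicator_def)
    then show ?case by (simp add: w_def mult_ac)
  qed
  show i: "integrable lborel (\<lambda>y. K (y - x) * \<phi> y)"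
    by (rule Bochner_Integration.integrable_bound[OF w]) (use b in \<open>auto elim!: eventually_mono\<close>)
  have "norm (LINT y|lborel. K (y - x) * \<phi> y) \<le> (LINT y|lborel. norm (K (y - x) * \<phi> y))"
    by (rule integral_norm_bound)
  also have "\<dots> \<le> (LINT y|lborel. w y)"
    using b w by (intro integral_mono_AE integrable_norm i)
  also have "\<dots> \<le> C * M * sing_bound R"
    unfolding w_def using sing_integral_cball[of R x] C M by (simp add: mult_left_mono)
  finally show "norm (LINT y|lborel. K (y - x) * \<phi> y) \<le> C * M * sing_bound R" .
qed

lemma kernel_limit:
  fixes K :: "real^3 \<Rightarrow> complex"
  assumes [measurable]: "K \<in> borel_measurable borel" "\<And>n. Kn n \<in> borel_measurable borel" "\<phi> \<in> borel_measurable borel"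
    and K: "\<And>n z. z \<noteq> 0 \<Longrightarrow> norm (Kn n z) \<le> C * sing z" and C: "C \<ge> 0"
    and lim: "\<And>z. z \<noteq> 0 \<Longrightarrow> (\<lambda>n. Kn n z) \<longlonglongrightarrow> K z"
    and \<phi>: "\<And>y. norm y > R \<Longrightarrow> \<phi> y = 0" "\<And>y. norm (\<phi> y) \<le> M"
  shows "(\<lambda>n. LINT y|lborel. Kn n (y - x) * \<phi> y) \<longlonglongrightarrow> (LINT y|lborel. K (y - x) * \<phi> y)"
proof (rule integral_dominated_convergence[where w = "\<lambda>y. C * M * (indicator (cball 0 R) y * sing (x - y))"])
  have M: "M \<ge> 0" using \<phi>(2)[of 0] norm_ge_zero order_trans by blast
  show "integrable lborel (\<lambda>y. C * M * (indicator (cball 0 R) y * sing (x - y)))"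
    by (intro integrable_mult_right sing_integral_cball)
  show "AE y in lborel. norm (Kn n (y - x) * \<phi> y) \<le> C * M * (indicator (cball 0 R) y * sing (x - y))" for n
    using AE_neq_lborel[of x]
  proof eventually_elim
    case (elim y)
    have "norm (Kn n (y - x) * \<phi> y) \<le> (C * sing (x - y)) * (M * indicator (cball 0 R) y)"
      unfolding norm_mult using K[of "y - x" n] elim \<phi>(1)[of y] \<phi>(2)[of y] C M sing_ge1[of "x - y"]
      by (intro mult_mono) (auto simp: sing_minus[of x y] indicator_def)
    then show ?case by (simp add: mult_ac)
  qed
  show "AE y in lborel. (\<lambda>n. Kn n (y - x) * \<phi> y) \<longlonglongrightarrow> K (y - x) * \<phi> y"
    using AE_neq_lborel[of x] by eventually_elim (intro tendsto_intros lim, simp)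
qed measurable

lemma Phi_eq_rad0: "Phi k z = rad0 k (norm z)"
  by (simp add: Phi_def rad0_def)

lemma rad0_norm_measurable [measurable]: "(\<lambda>z::real^3. rad0 k (norm z)) \<in> borel_measurable borel"
  using Phi_measurable[of k] by (simp add: Phi_eq_rad0[abs_def])

lemma DPhi_eq_rad1: "z \<noteq> 0 \<Longrightarrow> DPhi k j z = rad1 k (norm z) * of_real (z $ j)"
  by (simp add: DPhi_def rad1_def field_simps power2_eq_square power3_eq_cube)

lemma norm_Phi_le: "Im k \<ge> 0 \<Longrightarrow> z \<noteq> 0 \<Longrightarrow> norm (Phi k z) \<le> sing z"
  using norm_rad0_le[of k z 0] by (simp add: Phi_eq_rad0 rho_0)

lemma norm_DPhi_le: "Im k \<ge> 0 \<Longrightarrow> z \<noteq> 0 \<Longrightarrow> norm (DPhi k j z) \<le> (norm k + 1) * sing z"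
  using norm_rad1_le[of k z 0 j] by (simp add: DPhi_eq_rad1 rho_0)

lemma rad_rho_measurable [measurable]:
  assumes "\<epsilon> > 0"
  shows "(\<lambda>z. rad0 k (rho \<epsilon> z)) \<in> borel_measurable borel" 
    "(\<lambda>z. rad1 k (rho \<epsilon> z) * of_real (z $ j)) \<in> borel_measurable borel"
  using dirder_rad0[OF assms, of _ k] by (auto simp: dirder_def intro!: borel_measurable_continuous_onI)

text \<open>For the regularised kernels this is integration by parts of continuous functions, and
  both sides pass to the limit under the majorant \<open>sing\<close>. The pole is never excised, so
  no boundary term has to be estimated.\<close>

theorem Phi_gradient:
  assumes k: "Im k \<ge> 0" and d: "dirder (axis j 1) \<phi> \<phi>'" and supp: "\<And>y. norm y > R \<Longrightarrow> \<phi> y = 0"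
  shows "(LINT y|lborel. Phi k (y - x) * \<phi>' y) = - (LINT y|lborel. DPhi k j (y - x) * \<phi> y)"
proof -
  have supp': "norm y > R \<Longrightarrow> \<phi>' y = 0" for y by (rule dirder_support[OF d supp])
  have c: "continuous_on UNIV \<phi>" "continuous_on UNIV \<phi>'" using d by (auto simp: dirder_def)
  then have [measurable]: "\<phi> \<in> borel_measurable borel" "\<phi>' \<in> borel_measurable borel"
    by (auto intro: borel_measurable_continuous_onI)
  obtain M where M: "\<And>y. norm (\<phi> y) \<le> M" using bounded_of_compact_support[of \<phi> R] c supp by auto
  obtain M' where M': "\<And>y. norm (\<phi>' y) \<le> M'" using bounded_of_compact_support[of \<phi>' R] c supp' by auto
  let ?e = "\<lambda>n. 1 / real (Suc n)"
  have 1: "(\<lambda>n. LINT y|lborel. rad0 k (rho (?e n) (y - x)) * \<phi>' y) \<longlonglongrightarrow> (LINT y|lborel. Phi k (y - x) * \<phi>' y)"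
    by (rule kernel_limit[where Kn = "\<lambda>n z. rad0 k (rho (?e n) z)" and C = 1 and R = R and M = M'])
       (use norm_rad0_le[OF k] supp' M' in \<open>auto simp: Phi_eq_rad0 intro!: tendsto_radial rad_cont rad_rho_measurable rad0_norm_measurable simp del: of_nat_Suc\<close>)
  have 2: "(\<lambda>n. LINT y|lborel. (rad1 k (rho (?e n) (y - x)) * of_real ((y - x) $ j)) * \<phi> y) \<longlonglongrightarrow> (LINT y|lborel. DPhi k j (y - x) * \<phi> y)"
    by (rule kernel_limit[where Kn = "\<lambda>n z. rad1 k (rho (?e n) z) * of_real (z $ j)" and C = "norm k + 1" and R = R and M = M])
       (use norm_rad1_le[OF k] supp M in \<open>auto simp: DPhi_eq_rad1 intro!: tendsto_mult[OF tendsto_radial[OF rad_cont(2)] tendsto_const] rad_rho_measurable simp del: of_nat_Suc\<close>)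
  have eq: "(LINT y|lborel. rad0 k (rho (?e n) (y - x)) * \<phi>' y) = - (LINT y|lborel. (rad1 k (rho (?e n) (y - x)) * of_real ((y - x) $ j)) * \<phi> y)" for n
    by (rule integral_by_parts[OF dirder_translate[OF dirder_rad0] d supp]) simp
  show ?thesis
    using LIMSEQ_unique[OF 1] tendsto_minus[OF 2] unfolding eq by blast
qed

text \<open>The primitive of r^2 (r^2 + 1)^(-5/2) is a third of the cube of r / sqrt(r^2 + 1). The
  value fixes the mass of the approximate delta function in \<open>Phi_fundamental\<close>;
  integrability is used again for the weighted norms of the scattered wave.\<close>

lemma integral_inverse_rho_power5:
  shows "integrable lborel (\<lambda>z. 1 / (rho 1 z)^5)" "(LINT z|lborel. 1 / (rho 1 z)^5) = 4 * pi / 3"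
proof -
  let ?s = "\<lambda>r::real. sqrt (r\<^sup>2 + 1)"
  have s: "?s r > 0" "(?s r)\<^sup>2 = r\<^sup>2 + 1" for r :: real
    by (auto simp: add_nonneg_pos)
  have meas [measurable]: "(\<lambda>z. 1 / (rho 1 z)^5) \<in> borel_measurable borel" by measurable
  have "(\<integral>\<^sup>+z. ennreal (1 / (rho 1 z)^5) \<partial>lborel) = (\<integral>\<^sup>+z. (\<lambda>r. ennreal (1 / (?s r)^5)) (norm (z::real^3)) \<partial>lborel)"
    by (simp add: rho_def)
  also have "\<dots> = (\<integral>\<^sup>+r. ennreal (4 * pi * r\<^sup>2) * ennreal (1 / (?s r)^5) * indicator {0..} r \<partial>lborel)"
    by (rule nn_integral_radial) measurable
  also have "\<dots> = (\<integral>\<^sup>+r. ennreal (4 * pi * r\<^sup>2 / (?s r)^5) * indicator {0..} r \<partial>lborel)"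
    by (intro nn_integral_cong) (simp add: ennreal_mult[symmetric])
  also have "\<dots> = ennreal (4 * pi / 3 - 4 * pi / 3 * (0 / ?s 0)^3)"
  proof (rule nn_integral_FTC_atLeast)
    fix r :: real
    have "((\<lambda>r. r / ?s r) has_real_derivative (1 / (?s r)^3)) (at r)"
    proof -
      have "((\<lambda>r. r / ?s r) has_real_derivative ((1 * ?s r - r * (r / ?s r)) / (?s r * ?s r))) (at r)"
        using s[of r] by (auto intro!: derivative_eq_intros simp: field_simps)
      moreover have "(1 * ?s r - r * (r / ?s r)) / (?s r * ?s r) = ((?s r)\<^sup>2 - r\<^sup>2) / (?s r)^3"
        using s(1)[of r] by (simp add: field_simps power2_eq_square power3_eq_cube)
      ultimately show ?thesis using s(2)[of r] by simp
    qed
    then have "((\<lambda>r. 4 * pi / 3 * (r / ?s r)^3) has_real_derivative 4 * pi / 3 * (3 * (r / ?s r)^2 * (1 / (?s r)^3))) (at r)"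
      using DERIV_cmult[OF DERIV_power, of "\<lambda>r. r / ?s r" "1 / (?s r)^3" r UNIV "4 * pi / 3" 3] by (simp add: mult_ac)
    moreover have "4 * pi / 3 * (3 * (r / ?s r)^2 * (1 / (?s r)^3)) = 4 * pi * r\<^sup>2 / (?s r)^5"
      using s(1)[of r] by (simp add: field_simps eval_nat_numeral)
    ultimately show "((\<lambda>r. 4 * pi / 3 * (r / ?s r)^3) has_real_derivative 4 * pi * r\<^sup>2 / (?s r)^5) (at r)"
      by simp
    show "0 \<le> 4 * pi * r\<^sup>2 / (?s r)^5" using s(1)[of r] by simp
  next
    have "((\<lambda>r. r / ?s r) \<longlongrightarrow> 1) at_top" by real_asymp
    then have "((\<lambda>r. 4 * pi / 3 * (r / ?s r)^3) \<longlongrightarrow> 4 * pi / 3 * 1^3) at_top" by (intro tendsto_intros)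
    then show "((\<lambda>r. 4 * pi / 3 * (r / ?s r)^3) \<longlongrightarrow> 4 * pi / 3) at_top" by simp
  qed measurable
  finally have nn: "(\<integral>\<^sup>+z. ennreal (1 / (rho 1 z)^5) \<partial>lborel) = ennreal (4 * pi / 3)" by simp
  show "integrable lborel (\<lambda>z. 1 / (rho 1 z)^5)"
    using nn rho_pos[of 1] by (intro integrableI_nonneg) (auto simp: less_imp_le)
  show "(LINT z|lborel. 1 / (rho 1 z)^5) = 4 * pi / 3"
    using nn rho_pos[of 1] by (intro integral_eq_nn_integral[THEN trans]) (auto simp: less_imp_le)
qed

lemma Ck_imp_continuous: "Ck k f \<Longrightarrow> continuous_on UNIV f"
  by (cases k) (auto intro: differentiable_imp_continuous_on)

text \<open>Complex \<open>k\<close> is allowed in order to cover \<open>k = \<i> \<kappa>\<close>, the decaying part of the biharmonic kernel.\<close>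

theorem Phi_fundamental:
  fixes \<phi> :: "real^3 \<Rightarrow> complex"
  assumes k: "Im k \<ge> 0"
    and d1: "\<And>j. dirder (axis j 1) \<phi> (\<phi>1 j)" and d2: "\<And>j. dirder (axis j 1) (\<phi>1 j) (\<phi>2 j)"
    and supp: "\<And>y. norm y > R \<Longrightarrow> \<phi> y = 0"
  shows "(LINT y|lborel. Phi k (y - x) * ((\<Sum>j\<in>UNIV. \<phi>2 j y) + k\<^sup>2 * \<phi> y)) = - 4 * pi * \<phi> x"
proof -
  have supp1: "norm y > R \<Longrightarrow> \<phi>1 j y = 0" for y j by (rule dirder_support[OF d1 supp])
  have supp2: "norm y > R \<Longrightarrow> \<phi>2 j y = 0" for y j by (rule dirder_support[OF d2 supp1])
  have c: "continuous_on UNIV \<phi>" "continuous_on UNIV (\<phi>1 j)" "continuous_on UNIV (\<phi>2 j)" for j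
    using d1[of j] d2[of j] by (auto simp: dirder_def)
  let ?L = "\<lambda>y. (\<Sum>j\<in>UNIV. \<phi>2 j y) + k\<^sup>2 * \<phi> y"
  have cL: "continuous_on UNIV ?L" by (intro continuous_intros c)
  have sL: "norm y > R \<Longrightarrow> ?L y = 0" for y using supp supp2 by simp
  have [measurable]: "\<phi> \<in> borel_measurable borel" "?L \<in> borel_measurable borel"
    using c cL by (auto intro: borel_measurable_continuous_onI)
  obtain M where M: "M \<ge> 0" "\<And>y. norm (\<phi> y) \<le> M" using bounded_of_compact_support[of \<phi> R] c supp by auto
  obtain M' where M': "\<And>y. norm (?L y) \<le> M'" using bounded_of_compact_support[of ?L R] cL sL by auto
  let ?e = "\<lambda>n. 1 / real (Suc n)"
  \<comment> \<open>The defect of the regularised kernel: \<open>\<Delta> + k\<^sup>2\<close>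
    applied to \<open>rad0 k (rho \<epsilon> z)\<close> gives \<open>- E \<epsilon> z\<close>
    instead of 0.\<close>
  define E where "E \<epsilon> z = \<epsilon>\<^sup>2 * rad2 k (rho \<epsilon> z) / rho \<epsilon> z" for \<epsilon> and z
  have lim1: "(\<lambda>n. LINT y|lborel. rad0 k (rho (?e n) (y - x)) * ?L y) \<longlonglongrightarrow> (LINT y|lborel. Phi k (y - x) * ?L y)"
    by (rule kernel_limit[where Kn = "\<lambda>n z. rad0 k (rho (?e n) z)" and C = 1 and R = R and M = M'])
       (use norm_rad0_le[OF k] sL M' in \<open>auto simp: Phi_eq_rad0 intro!: tendsto_radial rad_cont rad_rho_measurable rad0_norm_measurable simp del: of_nat_Suc\<close>)
  have id: "(LINT y|lborel. rad0 k (rho \<epsilon> (y - x)) * ?L y) = - (LINT y|lborel. E \<epsilon> (y - x) * \<phi> y)" if e: "\<epsilon> > 0" for \<epsilon>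
  proof -
    let ?D0 = "\<lambda>y. rad0 k (rho \<epsilon> (y - x))"
    let ?D1 = "\<lambda>j y. rad1 k (rho \<epsilon> (y - x)) * of_real ((y - x) $ j)"
    let ?D2 = "\<lambda>j y. rad1 k (rho \<epsilon> (y - x)) + rad2 k (rho \<epsilon> (y - x)) * of_real (((y - x) $ j)\<^sup>2 / rho \<epsilon> (y - x))"
    have D0: "dirder (axis j 1) ?D0 (?D1 j)" for j by (rule dirder_translate[OF dirder_rad0[OF e]])
    have D1: "dirder (axis j 1) (?D1 j) (?D2 j)" for j by (rule dirder_translate[OF dirder_rad1[OF e]])
    have cD: "continuous_on UNIV ?D0" "continuous_on UNIV (?D2 j)" for j
      using D0[of j] D1[of j] by (auto simp: dirder_def)
    have 1: "(LINT y|lborel. ?D0 y * \<phi>2 j y) = (LINT y|lborel. ?D2 j y * \<phi> y)" for j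
      using integral_by_parts[OF D0 d2[of j] supp1] integral_by_parts[OF D1 d1[of j] supp] by simp
    have i1: "integrable lborel (\<lambda>y. ?D0 y * \<phi>2 j y)" for j
      by (rule integrable_continuous_support[of _ R]) (use supp2 in \<open>auto intro!: continuous_intros cD c\<close>)
    have i2: "integrable lborel (\<lambda>y. ?D2 j y * \<phi> y)" for j
      by (rule integrable_continuous_support[of _ R], intro continuous_on_mult cD c) (simp add: supp)
    have i3: "integrable lborel (\<lambda>y. k\<^sup>2 * (?D0 y * \<phi> y))"
      by (rule integrable_continuous_support[of _ R]) (use supp in \<open>auto intro!: continuous_intros cD c\<close>)
    have "(LINT y|lborel. ?D0 y * ?L y) = (LINT y|lborel. (\<Sum>j\<in>UNIV. ?D0 y * \<phi>2 j y) + k\<^sup>2 * (?D0 y * \<phi> y))"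
      by (simp only: distrib_left sum_distrib_left mult.left_commute)
    also have "\<dots> = (\<Sum>j\<in>UNIV. LINT y|lborel. ?D0 y * \<phi>2 j y) + (LINT y|lborel. k\<^sup>2 * (?D0 y * \<phi> y))"
      by (subst Bochner_Integration.integral_add) (auto intro!: Bochner_Integration.integrable_sum i1 i3 simp: Bochner_Integration.integral_sum i1)
    also have "\<dots> = (LINT y|lborel. (\<Sum>j\<in>UNIV. ?D2 j y * \<phi> y) + k\<^sup>2 * (?D0 y * \<phi> y))"
      unfolding 1 by (simp only: Bochner_Integration.integral_add[OF Bochner_Integration.integrable_sum[OF i2] i3] Bochner_Integration.integral_sum[OF i2])
    also have "\<dots> = (LINT y|lborel. - (E \<epsilon> (y - x) * \<phi> y))"
    proof (rule Bochner_Integration.integral_cong[OF refl])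
      fix y
      define r where "r = rho \<epsilon> (y - x)"
      have r: "r > 0" "r \<noteq> 0" using rho_pos[OF e] by (auto simp: r_def less_imp_neq[THEN not_sym])
      have sq: "(\<Sum>j\<in>UNIV. ((y - x) $ j)\<^sup>2) = r\<^sup>2 - \<epsilon>\<^sup>2"
        unfolding r_def rho_sq norm_vec_def L2_set_def by (simp add: sum_nonneg)
      have "(\<Sum>j\<in>UNIV. ?D2 j y) = 3 * rad1 k r + rad2 k r * of_real ((\<Sum>j\<in>UNIV. ((y - x) $ j)\<^sup>2) / r)"
        by (simp add: r_def sum.distrib sum_distrib_left sum_divide_distrib)
      also have "\<dots> + k\<^sup>2 * rad0 k r = - (\<epsilon>\<^sup>2 * rad2 k r / r)"
      proof -
        \<comment> \<open>The radial Helmholtz equation. It would be exact if the squares of the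
          coordinates summed to r^2; they sum to r^2 - \<epsilon>^2, and the difference is the
          defect.\<close>
        have "3 * rad1 k r + rad2 k r * of_real r + k\<^sup>2 * rad0 k r = 0"
          using r unfolding rad0_def rad1_def rad2_def
          by (simp add: field_simps power2_eq_square power3_eq_cube power4_eq_xxxx)
        then have "3 * rad1 k r + (rad2 k r * of_real r - d) + k\<^sup>2 * rad0 k r = - d" for d
          by (simp add: algebra_simps)
        moreover have "rad2 k r * of_real ((r\<^sup>2 - \<epsilon>\<^sup>2) / r) = rad2 k r * of_real r - \<epsilon>\<^sup>2 * rad2 k r / r"
          using r by (simp add: field_simps power2_eq_square)
        ultimately show ?thesis unfolding sq by simp
      qed
      finally have "((\<Sum>j\<in>UNIV. ?D2 j y) + k\<^sup>2 * ?D0 y) * \<phi> y = - (E \<epsilon> (y - x)) * \<phi> y"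
        by (simp add: E_def r_def)
      then show "(\<Sum>j\<in>UNIV. ?D2 j y * \<phi> y) + k\<^sup>2 * (?D0 y * \<phi> y) = - (E \<epsilon> (y - x) * \<phi> y)"
        unfolding sum_distrib_right[symmetric] by (simp add: distrib_right[where c = "\<phi> y"] mult.assoc[of "k\<^sup>2"] del: of_real_divide of_real_power)
    qed
    finally show ?thesis by simp
  qed
  \<comment> \<open>\<open>A\<close> collects the two terms of the defect that carry a factor k and
    vanish in the limit; \<open>B\<close> is the remaining term, an approximation of 4 pi times the
    delta function.\<close>
  define A where "A \<epsilon> z = \<epsilon>\<^sup>2 * (- k\<^sup>2 / of_real ((rho \<epsilon> z)^3) - 3 * \<i> * k / of_real ((rho \<epsilon> z)^4)) * exp (\<i> * k * of_real (rho \<epsilon> z))" for \<epsilon> and z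
  define B where "B \<epsilon> z = 3 * \<epsilon>\<^sup>2 / of_real ((rho \<epsilon> z)^5) * exp (\<i> * k * of_real (rho \<epsilon> z))" for \<epsilon> and z
  have EAB: "E \<epsilon> z = A \<epsilon> z + B \<epsilon> z" if "\<epsilon> > 0" for \<epsilon> z
    using rho_pos[OF that, of z] by (simp add: E_def A_def B_def rad2_def field_simps eval_nat_numeral)
  have meas [measurable]: "A \<epsilon> \<in> borel_measurable borel" "B \<epsilon> \<in> borel_measurable borel" for \<epsilon>
    unfolding A_def[abs_def] B_def[abs_def] by measurable
  \<comment> \<open>Since \<epsilon> is at most \<open>rho \<epsilon> z\<close>, the factor
    \<epsilon>^2 removes two powers from the denominators rho^3 and rho^4, leaving orders -1 and -2,
    which \<open>sing\<close> dominates.\<close>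
  have normA: "norm (A \<epsilon> z) \<le> ((norm k)\<^sup>2 + 3 * norm k) * sing z" if e: "\<epsilon> > 0" and z: "z \<noteq> 0" for \<epsilon> z
  proof -
    define r where "r = rho \<epsilon> z"
    have r: "r > 0" "norm z \<le> r" "\<epsilon> \<le> r" using rho_pos[OF e] rho_ge rho_ge_eps[of \<epsilon>] e by (auto simp: r_def)
    have "norm (A \<epsilon> z) \<le> \<epsilon>\<^sup>2 * ((norm k)\<^sup>2 / r^3 + 3 * norm k / r^4) * 1"
      unfolding A_def r_def[symmetric] norm_mult
      using norm_triangle_ineq4[of "- k\<^sup>2 / of_real (r^3)" "3 * \<i> * k / of_real (r^4)"] k r
      by (intro mult_mono norm_exp_le_1) (auto simp: norm_divide norm_mult norm_power)
    also have "\<dots> \<le> r\<^sup>2 * ((norm k)\<^sup>2 / r^3 + 3 * norm k / r^4)"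
      using r e by (simp add: mult_right_mono power_mono)
    also have "\<dots> = (norm k)\<^sup>2 * (1 / r) + 3 * norm k * (1 / r\<^sup>2)"
      using r by (simp add: field_simps eval_nat_numeral)
    also have "\<dots> \<le> (norm k)\<^sup>2 * (1 / norm z) + 3 * norm k * (1 / (norm z)\<^sup>2)"
      using r z by (intro add_mono mult_left_mono divide_left_mono power_mono) auto
    also have "\<dots> \<le> (norm k)\<^sup>2 * sing z + 3 * norm k * sing z"
      by (intro add_mono mult_left_mono sing_ge_inverse) auto
    finally show ?thesis by (simp add: algebra_simps)
  qed
  have limA: "(\<lambda>n. LINT y|lborel. A (?e n) (y - x) * \<phi> y) \<longlonglongrightarrow> (LINT y|lborel. 0 * \<phi> y)"
  proof (rule kernel_limit[where Kn = "\<lambda>n z. A (?e n) z" and K = "\<lambda>_. 0" and C = "(norm k)\<^sup>2 + 3 * norm k" and R = R and M = M])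
    fix z :: "real^3" assume z: "z \<noteq> 0"
    have e0: "(\<lambda>n. ?e n) \<longlonglongrightarrow> 0"
      using LIMSEQ_inverse_real_of_nat by (simp add: inverse_eq_divide)
    have "(\<lambda>n. A (?e n) z) \<longlonglongrightarrow> (of_real 0)\<^sup>2 * (- k\<^sup>2 / of_real ((norm z)^3) - 3 * \<i> * k / of_real ((norm z)^4)) * exp (\<i> * k * of_real (norm z))"
      unfolding A_def using z by (intro tendsto_intros e0 tendsto_rho) auto
    then show "(\<lambda>n. A (?e n) z) \<longlonglongrightarrow> 0" by simp
  qed (use normA supp M in \<open>auto simp del: of_nat_Suc\<close>)
  have B_eq: "(LINT y|lborel. B \<epsilon> (y - x) * \<phi> y)
       = (LINT z|lborel. 3 * exp (\<i> * k * of_real (\<epsilon> * rho 1 z)) / of_real ((rho 1 z)^5) * \<phi> (x + \<epsilon> *\<^sub>R z))" if e: "\<epsilon> > 0" for \<epsilon>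
  proof -
    \<comment> \<open>Substitution y = x + \<epsilon> z: the volume factor \<epsilon>^3 cancels the
      \<epsilon>^-3 left by \<epsilon>^2 / (\<epsilon> rho)^5. The remaining density 3 / rho^5 has
      total mass 4 pi.\<close>
    have "(LINT y|lborel. B \<epsilon> (y - x) * \<phi> y) = \<epsilon> ^ 3 *\<^sub>R (LINT z|lborel. B \<epsilon> (\<epsilon> *\<^sub>R z) * \<phi> (x + \<epsilon> *\<^sub>R z))"
      using integral_lborel_scale[of "\<lambda>y. B \<epsilon> (y - x) * \<phi> y" \<epsilon> x] e by simp
    also have "\<dots> = (LINT z|lborel. \<epsilon> ^ 3 *\<^sub>R (B \<epsilon> (\<epsilon> *\<^sub>R z) * \<phi> (x + \<epsilon> *\<^sub>R z)))"
      by simp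
    also have "\<dots> = (LINT z|lborel. 3 * exp (\<i> * k * of_real (\<epsilon> * rho 1 z)) / of_real ((rho 1 z)^5) * \<phi> (x + \<epsilon> *\<^sub>R z))"
    proof (intro Bochner_Integration.integral_cong refl)
      fix z
      have r: "rho 1 z \<noteq> 0" "\<epsilon> \<noteq> 0" using rho_pos[of 1 z] e by auto
      define X Y where "X = exp (\<i> * k * of_real (\<epsilon> * rho 1 z))" and "Y = \<phi> (x + \<epsilon> *\<^sub>R z)"
      show "\<epsilon> ^ 3 *\<^sub>R (B \<epsilon> (\<epsilon> *\<^sub>R z) * \<phi> (x + \<epsilon> *\<^sub>R z))
          = 3 * exp (\<i> * k * of_real (\<epsilon> * rho 1 z)) / of_real ((rho 1 z)^5) * \<phi> (x + \<epsilon> *\<^sub>R z)"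
        unfolding B_def rho_scale[OF e] X_def[symmetric] Y_def[symmetric] scaleR_conv_of_real[where 'a = complex]
        using r by (simp add: field_simps eval_nat_numeral)
    qed
    finally show ?thesis .
  qed
  have limB: "(\<lambda>n. LINT y|lborel. B (?e n) (y - x) * \<phi> y) \<longlonglongrightarrow> 4 * pi * \<phi> x"
  proof -
    let ?f = "\<lambda>\<epsilon> z. 3 * exp (\<i> * k * of_real (\<epsilon> * rho 1 z)) / of_real ((rho 1 z)^5) * \<phi> (x + \<epsilon> *\<^sub>R z)"
    have "(\<lambda>n. LINT z|lborel. ?f (?e n) z) \<longlonglongrightarrow> (LINT z|lborel. 3 * \<phi> x * of_real (1 / (rho 1 z)^5))"
    proof (rule integral_dominated_convergence[where w = "\<lambda>z. 3 * M * (1 / (rho 1 z)^5)"])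
      show "integrable lborel (\<lambda>z. 3 * M * (1 / (rho 1 z)^5))"
        by (intro integrable_mult_right integral_inverse_rho_power5)
      show "AE z in lborel. norm (?f (?e n) z) \<le> 3 * M * (1 / (rho 1 z)^5)" for n
      proof (rule AE_I2)
        fix z
        have r: "rho 1 z > 0" by (rule rho_pos) simp
        define X where "X = exp (\<i> * k * of_real (?e n * rho 1 z))"
        have X: "norm X \<le> 1" unfolding X_def using k r by (intro norm_exp_le_1) auto
        have "norm (3 * X / of_real ((rho 1 z)^5) * \<phi> (x + ?e n *\<^sub>R z)) \<le> (3 * 1 / (rho 1 z)^5) * M"
          unfolding norm_mult norm_divide using X M r
          by (intro mult_mono) (auto simp: norm_power intro!: divide_right_mono simp del: of_nat_Suc)
        then show "norm (?f (?e n) z) \<le> 3 * M * (1 / (rho 1 z)^5)" unfolding X_def by (simp add: mult_ac del: of_nat_Suc norm_mult norm_exp_eq_Re)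
      qed
      show "AE z in lborel. (\<lambda>n. ?f (?e n) z) \<longlonglongrightarrow> 3 * \<phi> x * of_real (1 / (rho 1 z)^5)"
      proof (rule AE_I2)
        fix z
        have r: "rho 1 z > 0" by (rule rho_pos) simp
        have e: "(\<lambda>n. ?e n) \<longlonglongrightarrow> 0"
          using LIMSEQ_inverse_real_of_nat by (simp add: inverse_eq_divide)
        have "(\<lambda>n. x + ?e n *\<^sub>R z) \<longlonglongrightarrow> x + 0 *\<^sub>R z"
          by (intro tendsto_intros e)
        then have "(\<lambda>n. \<phi> (x + ?e n *\<^sub>R z)) \<longlonglongrightarrow> \<phi> (x + 0 *\<^sub>R z)"
          by (rule isCont_tendsto_compose[rotated]) (use c(1) in \<open>simp add: continuous_on_eq_continuous_at\<close>)
        moreover have "(\<lambda>n. exp (\<i> * k * of_real (?e n * rho 1 z))) \<longlonglongrightarrow> exp (\<i> * k * of_real (0 * rho 1 z))"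
          by (intro tendsto_intros e)
        ultimately have "(\<lambda>n. ?f (?e n) z) \<longlonglongrightarrow> 3 * exp (\<i> * k * of_real (0 * rho 1 z)) / of_real ((rho 1 z)^5) * \<phi> (x + 0 *\<^sub>R z)"
          using r by (intro tendsto_mult tendsto_divide tendsto_const) auto
        then show "(\<lambda>n. ?f (?e n) z) \<longlonglongrightarrow> 3 * \<phi> x * of_real (1 / (rho 1 z)^5)"
          by (simp add: mult_ac divide_inverse del: of_nat_Suc)
      qed
    qed measurable
    also have "(LINT z|lborel. 3 * \<phi> x * of_real (1 / (rho 1 z)^5)) = 3 * \<phi> x * of_real (LINT z|lborel. 1 / (rho 1 z)^5)"
      by (simp only: integral_mult_right_zero integral_complex_of_real)
    also have "\<dots> = 4 * pi * \<phi> x" unfolding integral_inverse_rho_power5 by simp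
    finally show ?thesis by (subst B_eq) (simp_all del: of_nat_Suc)
  qed
  have "(LINT y|lborel. E (?e n) (y - x) * \<phi> y) = (LINT y|lborel. A (?e n) (y - x) * \<phi> y) + (LINT y|lborel. B (?e n) (y - x) * \<phi> y)" for n
  proof -
    have e: "?e n > 0" by simp
    have cE: "continuous_on UNIV (\<lambda>y. A (?e n) (y - x))" "continuous_on UNIV (\<lambda>y. B (?e n) (y - x))"
      unfolding A_def B_def using rho_pos[OF e] by (auto intro!: continuous_intros simp: less_imp_neq[THEN not_sym] simp del: of_nat_Suc)
    show ?thesis
      unfolding EAB[OF e] distrib_right
      by (intro Bochner_Integration.integral_add integrable_continuous_support[of _ R]) (use supp in \<open>auto intro!: continuous_intros cE c simp del: of_nat_Suc\<close>)
  qed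
  then have "(\<lambda>n. LINT y|lborel. E (?e n) (y - x) * \<phi> y) \<longlonglongrightarrow> (LINT y|lborel. 0 * \<phi> y) + 4 * pi * \<phi> x"
    using tendsto_add[OF limA limB] by simp
  then have "(\<lambda>n. - (LINT y|lborel. E (?e n) (y - x) * \<phi> y)) \<longlonglongrightarrow> - (4 * pi * \<phi> x)"
    using tendsto_minus by fastforce
  then show ?thesis
    using lim1 LIMSEQ_unique unfolding id[of "?e _", simplified] by (auto simp: id)
qed

section \<open>Test functions and uniqueness of weak gradients\<close>

lemma Ck_Suc_D: "Ck (Suc k) f \<Longrightarrow> Ck k f"
proof (induction k arbitrary: f)
  case 0
  then show ?case by (auto intro: differentiable_imp_continuous_on)
qed auto

lemma Ck_mono: "Ck k f \<Longrightarrow> j \<le> k \<Longrightarrow> Ck j f"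
  by (induction k) (auto simp: le_Suc_eq simp del: Ck.simps dest: Ck_Suc_D)

text \<open>Together with \<open>Ck_Suc_E\<close>, this trades \<open>frechet_derivative\<close> for
  an arbitrary witness, so the inductions below can use the derivative rules directly.\<close>

lemma Ck_Suc_I:
  assumes "\<And>x. (f has_derivative f' x) (at x)" and "\<And>b. b \<in> Basis \<Longrightarrow> Ck k (\<lambda>x. f' x b)"
  shows "Ck (Suc k) f"
proof -
  have "frechet_derivative f (at x) = f' x" for x
    using frechet_derivative_at[OF assms(1)] by simp
  then show ?thesis
    using assms by (auto simp: differentiable_on_def differentiable_def)
qed

lemma Ck_Suc_E:
  assumes "Ck (Suc k) f"
  obtains f' where "\<And>x. (f has_derivative f' x) (at x)" "\<And>b. b \<in> Basis \<Longrightarrow> Ck k (\<lambda>x. f' x b)"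
  by (rule that[of "\<lambda>x. frechet_derivative f (at x)"])
     (use assms in \<open>auto simp: differentiable_on_def frechet_derivative_works[symmetric]\<close>)

lemma Ck_const: "Ck k (\<lambda>x. c)"
proof (induction k arbitrary: c)
  case (Suc k)
  show ?case by (rule Ck_Suc_I[where f' = "\<lambda>x h. 0"]) (auto simp: Suc)
qed auto

lemma Ck_add: "Ck k f \<Longrightarrow> Ck k g \<Longrightarrow> Ck k (\<lambda>x. f x + g x)"
proof (induction k arbitrary: f g)
  case 0
  then show ?case by (auto intro!: continuous_intros)
next
  case (Suc k)
  from Ck_Suc_E[OF Suc.prems(1)] obtain f'
    where f: "\<And>x. (f has_derivative f' x) (at x)" "\<And>b. b \<in> Basis \<Longrightarrow> Ck k (\<lambda>x. f' x b)" by blast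
  from Ck_Suc_E[OF Suc.prems(2)] obtain g'
    where g: "\<And>x. (g has_derivative g' x) (at x)" "\<And>b. b \<in> Basis \<Longrightarrow> Ck k (\<lambda>x. g' x b)" by blast
  show ?case
    by (rule Ck_Suc_I[where f' = "\<lambda>x h. f' x h + g' x h"]) (auto intro!: has_derivative_add f g Suc.IH)
qed

lemma Ck_mult:
  fixes f g :: "_ \<Rightarrow> 'b::real_normed_algebra"
  shows "Ck k f \<Longrightarrow> Ck k g \<Longrightarrow> Ck k (\<lambda>x. f x * g x)"
proof (induction k arbitrary: f g)
  case 0
  then show ?case by (auto intro!: continuous_intros)
next
  case (Suc k)
  from Ck_Suc_E[OF Suc.prems(1)] obtain f'
    where f: "\<And>x. (f has_derivative f' x) (at x)" "\<And>b. b \<in> Basis \<Longrightarrow> Ck k (\<lambda>x. f' x b)" by blast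
  from Ck_Suc_E[OF Suc.prems(2)] obtain g'
    where g: "\<And>x. (g has_derivative g' x) (at x)" "\<And>b. b \<in> Basis \<Longrightarrow> Ck k (\<lambda>x. g' x b)" by blast
  show ?case
    by (rule Ck_Suc_I[where f' = "\<lambda>x h. f x * g' x h + f' x h * g x"])
       (auto intro!: has_derivative_mult f g Ck_add Suc.IH Ck_Suc_D[OF Suc.prems(1)] Ck_Suc_D[OF Suc.prems(2)])
qed

lemma Ck_cmult:
  fixes f :: "_ \<Rightarrow> 'b::real_normed_algebra"
  shows "Ck k f \<Longrightarrow> Ck k (\<lambda>x. c * f x)"
  by (rule Ck_mult[OF Ck_const])

lemma Ck_sum: "finite I \<Longrightarrow> (\<And>i. i \<in> I \<Longrightarrow> Ck k (f i)) \<Longrightarrow> Ck k (\<lambda>x. \<Sum>i\<in>I. f i x)"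
  by (induction I rule: finite_induct) (auto intro!: Ck_const Ck_add)

lemma Ck_prod:
  fixes f :: "_ \<Rightarrow> _ \<Rightarrow> 'b::{real_normed_algebra_1,comm_monoid_mult}"
  shows "finite I \<Longrightarrow> (\<And>i. i \<in> I \<Longrightarrow> Ck k (f i)) \<Longrightarrow> Ck k (\<lambda>x. \<Prod>i\<in>I. f i x)"
  by (induction I rule: finite_induct) (auto intro!: Ck_const Ck_mult)

lemma Ck_bounded_linear:
  assumes "bounded_linear L"
  shows "Ck k f \<Longrightarrow> Ck k (\<lambda>x. L (f x))"
proof (induction k arbitrary: f)
  case 0
  then show ?case by (auto intro: bounded_linear.continuous_on[OF assms])
next
  case (Suc k)
  from Ck_Suc_E[OF Suc.prems(1)] obtain f'
    where f: "\<And>x. (f has_derivative f' x) (at x)" "\<And>b. b \<in> Basis \<Longrightarrow> Ck k (\<lambda>x. f' x b)" by blast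
  show ?case
    by (rule Ck_Suc_I[where f' = "\<lambda>x h. L (f' x h)"])
       (auto intro!: bounded_linear.has_derivative[OF assms] f Suc.IH)
qed

text \<open>Each induction step consumes one derivative, so the hypothesis concerns a whole sequence
  of successive derivatives and the index \<open>m\<close> is generalised.\<close>

lemma Ck_coordinate:
  fixes B :: "nat \<Rightarrow> real \<Rightarrow> real"
  assumes B: "\<And>m t. (B m has_real_derivative B (Suc m) t) (at t)"
  shows "Ck k (\<lambda>x::real^'n. complex_of_real (B m (c * (x $ j) + d)))"
proof (induction k arbitrary: m)
  case 0
  have "continuous_on UNIV (B m)"
    using B by (intro continuous_at_imp_continuous_on) (auto intro: DERIV_isCont)
  then show ?case by (auto intro!: continuous_intros continuous_on_compose2[of UNIV "B m"])
next
  case (Suc k)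
  have "((\<lambda>x::real^'n. c * (x $ j) + d) has_derivative (\<lambda>h. c * (h $ j))) (at x)" for x
    by (auto intro!: derivative_eq_intros bounded_linear.has_derivative[OF bounded_linear_vec_nth])
  from has_derivative_compose[OF this] B
  have D: "((\<lambda>x::real^'n. B m (c * (x $ j) + d)) has_derivative (\<lambda>h. B (Suc m) (c * (x $ j) + d) * (c * (h $ j)))) (at x)" for x
    unfolding has_field_derivative_def by blast
  then have "((\<lambda>x::real^'n. complex_of_real (B m (c * (x $ j) + d))) has_derivative (\<lambda>h. of_real (c * (h $ j)) * of_real (B (Suc m) (c * (x $ j) + d)))) (at x)" for x
      using has_derivative_of_real[where 'a = complex, OF D[of x]] by (simp add: mult_ac)
  then show ?case
    by (rule Ck_Suc_I) (intro Ck_cmult Suc.IH)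
qed

text \<open>The classical smooth function exp(-1/t), continued by 0. The polynomial in 1/t makes the
  family closed under differentiation.\<close>

definition flat :: "real poly \<Rightarrow> real \<Rightarrow> real" where
  "flat p t = (if t > 0 then poly p (1 / t) * exp (- (1 / t)) else 0)"

lemma poly_times_exp_tendsto_0: "((\<lambda>x. poly p x * exp (- x)) \<longlongrightarrow> (0::real)) at_top"
proof -
  have "((\<lambda>x. \<Sum>i\<le>degree p. coeff p i * (x ^ i / exp x)) \<longlongrightarrow> (\<Sum>i\<le>degree p. coeff p i * 0)) at_top"
    by (intro tendsto_intros tendsto_power_div_exp_0)
  then show ?thesis
    by (simp add: poly_altdef exp_minus sum_distrib_right divide_inverse mult.assoc)
qed

text \<open>With s = 1/t the derivative multiplies exp(-s) by s^2 (p(s) - p'(s)); the two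
  \<open>pCons 0\<close> encode the factor s^2.\<close>

lemma flat_deriv: "(flat p has_real_derivative flat (pCons 0 (pCons 0 (p - pderiv p))) t) (at t)"
proof (cases t "0::real" rule: linorder_cases)
  case less
  have "((\<lambda>_. 0) has_real_derivative 0) (at t)" by simp
  moreover have "eventually (\<lambda>s. s < 0) (nhds t)"
    using less by (intro eventually_nhds_in_open[of "{..<0}", simplified]) auto
  then have "eventually (\<lambda>s. flat p s = 0) (nhds t)" by eventually_elim (simp add: flat_def)
  ultimately have "(flat p has_real_derivative 0) (at t)"
    by (subst DERIV_cong_ev[OF refl _ refl]) auto
  then show ?thesis using less by (simp add: flat_def)
next
  case greater
  have "((\<lambda>t. poly p (1 / t) * exp (- (1 / t))) has_real_derivative
      poly p (1 / t) * (exp (- (1 / t)) * (1 / t^2)) + poly (pderiv p) (1 / t) * (- 1 / t^2) * exp (- (1 / t))) (at t)"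
    using greater by (auto intro!: derivative_eq_intros DERIV_chain'[of "\<lambda>t. 1 / t" _ _ UNIV "poly p"] poly_DERIV simp: power2_eq_square)
  moreover have "eventually (\<lambda>s. s > 0) (nhds t)"
    using greater by (intro eventually_nhds_in_open[of "{0<..}", simplified]) auto
  then have "eventually (\<lambda>s. flat p s = poly p (1 / s) * exp (- (1 / s))) (nhds t)" 
    by eventually_elim (simp add: flat_def)
  ultimately have "(flat p has_real_derivative poly p (1 / t) * (exp (- (1 / t)) * (1 / t^2)) + poly (pderiv p) (1 / t) * (- 1 / t^2) * exp (- (1 / t))) (at t)"
    by (subst DERIV_cong_ev[OF refl _ refl]) auto
  moreover have "poly p (1 / t) * (exp (- (1 / t)) * (1 / t^2)) + poly (pderiv p) (1 / t) * (- 1 / t^2) * exp (- (1 / t))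
     = flat (pCons 0 (pCons 0 (p - pderiv p))) t"
    using greater by (simp add: flat_def field_simps power2_eq_square)
  ultimately show ?thesis by simp
next
  case equal
  have "((\<lambda>h. flat p h / h) \<longlongrightarrow> 0) (at 0)"
  \<comment> \<open>From the right, dividing by h is one more factor 1/h, that is one more degree of
    the polynomial, and the exponential still wins.\<close>
  proof (rule filterlim_split_at)
    have "eventually (\<lambda>h. flat p h / h = 0) (at_left (0::real))"
      by (auto simp: eventually_at_filter flat_def)
    then show "((\<lambda>h. flat p h / h) \<longlongrightarrow> 0) (at_left 0)" by (rule tendsto_eventually)
    have "((\<lambda>h. poly (pCons 0 p) (inverse h) * exp (- inverse h)) \<longlongrightarrow> 0) (at_right 0)"
      by (rule filterlim_compose[OF poly_times_exp_tendsto_0 filterlim_inverse_at_top_right])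
    moreover have "eventually (\<lambda>h. poly (pCons 0 p) (inverse h) * exp (- inverse h) = flat p h / h) (at_right (0::real))"
      by (auto simp: eventually_at_filter flat_def divide_inverse)
    ultimately show "((\<lambda>h. flat p h / h) \<longlongrightarrow> 0) (at_right 0)"
      by (rule Lim_transform_eventually)
  qed
  then have "(flat p has_real_derivative 0) (at 0)"
    by (simp add: has_field_derivative_iff flat_def)
  then show ?thesis using equal by (simp add: flat_def)
qed

lemma Ck_flat: "Ck k (\<lambda>x::real^'n. complex_of_real (flat p (c * (x $ j) + d)))"
proof -
  define B where "B m = flat (((\<lambda>p. pCons 0 (pCons 0 (p - pderiv p))) ^^ m) p)" for m
  have "(B m has_real_derivative B (Suc m) t) (at t)" for m t
    unfolding B_def by (simp add: flat_deriv)
  from Ck_coordinate[of B, OF this, of k 0 c j d] show ?thesis by (simp add: B_def)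
qed

text \<open>For t > 0 the factor exp(-1/(n t)) tends to 1 and for other t it is 0. These products
  therefore approximate the indicator of the open box pointwise, bounded by 1, without
  mollification. The arguments have the affine form that \<open>Ck_flat\<close> expects.\<close>

definition box_bump :: "real^3 \<Rightarrow> real^3 \<Rightarrow> nat \<Rightarrow> real^3 \<Rightarrow> complex" where
  "box_bump a b n x = (\<Prod>j\<in>UNIV. of_real (flat 1 (real n * (x $ j) + (- (real n * (a $ j))))) *
      of_real (flat 1 (- real n * (x $ j) + real n * (b $ j))))"

lemma compactly_supportedI:
  assumes "compact K" "\<And>x. x \<notin> K \<Longrightarrow> f x = 0"
  shows "compactly_supported (f :: 'a::t2_space \<Rightarrow> 'b::zero)"
proof -
  have "closure {x. f x \<noteq> 0} \<subseteq> K"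
    using assms by (intro closure_minimal compact_imp_closed) auto
  then show ?thesis
    unfolding compactly_supported_def using assms(1) closed_closure
    by (metis compact_Int_closed inf.absorb_iff2)
qed

lemma flat_1_bounds: "0 \<le> flat 1 t" "flat 1 t \<le> 1" "t \<le> 0 \<Longrightarrow> flat 1 t = 0"
  by (auto simp: flat_def)

lemma flat_1_limit: "(\<lambda>n. flat 1 (real n * t)) \<longlonglongrightarrow> (if t > 0 then 1 else 0)"
proof (cases "t > 0")
  case True
  have "(\<lambda>n. exp (- (inverse (real n) * inverse t))) \<longlonglongrightarrow> exp (- (0 * inverse t))"
    by (intro tendsto_intros lim_inverse_n)
  moreover have "eventually (\<lambda>n. exp (- (inverse (real n) * inverse t)) = flat 1 (real n * t)) sequentially"
    using eventually_gt_at_top[of 0] by eventually_elim (use True in \<open>simp add: flat_def field_simps\<close>)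
  ultimately have "(\<lambda>n. flat 1 (real n * t)) \<longlonglongrightarrow> exp (- (0 * inverse t))"
    by (rule Lim_transform_eventually)
  then show ?thesis using True by simp
next
  case False
  then have "flat 1 (real n * t) = 0" for n
    by (intro flat_1_bounds) (simp add: mult_nonneg_nonpos)
  then show ?thesis using False by simp
qed

lemma box_bump_zero: "x \<notin> box a b \<Longrightarrow> box_bump a b n x = 0"
proof -
  assume "x \<notin> box a b"
  then obtain j where "x $ j \<le> a $ j \<or> b $ j \<le> x $ j"
    by (auto simp: box_def Basis_vec_def inner_axis not_less)
  then have "flat 1 (real n * (x $ j) + (- (real n * (a $ j)))) = 0 \<or> flat 1 (- real n * (x $ j) + real n * (b $ j)) = 0"
    by (auto intro!: flat_1_bounds mult_left_mono)
  then show ?thesis unfolding box_bump_def by (auto intro!: prod_zero)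
qed

lemma box_bump_norm: "norm (box_bump a b n x) \<le> 1"
  unfolding box_bump_def prod_norm[symmetric] norm_mult norm_of_real
  by (intro prod_le_1 conjI mult_le_one) (auto simp: flat_1_bounds)

lemma box_bump_limit: "(\<lambda>n. box_bump a b n x) \<longlonglongrightarrow> indicator (box a b) x"
proof -
  have eq: "real n * (x $ j) + (- (real n * (a $ j))) = real n * (x $ j - a $ j)" 
    "- real n * (x $ j) + real n * (b $ j) = real n * (b $ j - x $ j)" for n j
    by (simp_all add: algebra_simps)
  have "(\<lambda>n. box_bump a b n x) \<longlonglongrightarrow> (\<Prod>j\<in>UNIV. of_real (if x $ j - a $ j > 0 then 1 else 0) * of_real (if b $ j - x $ j > 0 then 1 else 0))"
    unfolding box_bump_def eq by (intro tendsto_prod tendsto_mult tendsto_of_real flat_1_limit)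
  also have "(\<Prod>j\<in>UNIV. complex_of_real (if x $ j - a $ j > 0 then 1 else 0) * of_real (if b $ j - x $ j > 0 then 1 else 0)) = indicator (box a b) x"
  proof (cases "x \<in> box a b")
    case True
    then have "a $ j < x $ j \<and> x $ j < b $ j" for j
      by (auto simp: box_def Basis_vec_def inner_axis)
    then show ?thesis using True by simp
  next
    case False
    then obtain j where "x $ j \<le> a $ j \<or> b $ j \<le> x $ j"
      by (auto simp: box_def Basis_vec_def inner_axis not_less)
    then have "(\<Prod>j\<in>UNIV. complex_of_real (if x $ j - a $ j > 0 then 1 else 0) * of_real (if b $ j - x $ j > 0 then 1 else 0)) = 0"
      by (intro prod_zero finite bexI[of _ j]) auto
    then show ?thesis using False by simp
  qed
  finally show ?thesis .
qed

lemma test_function_box_bump: "test_function (box_bump a b n)"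
proof -
  have "Ck k (box_bump a b n)" for k
    unfolding box_bump_def[abs_def] by (intro Ck_prod Ck_mult Ck_flat) simp
  moreover have "compactly_supported (box_bump a b n)"
    by (rule compactly_supportedI[OF compact_cbox[of a b]]) (use box_bump_zero box_subset_cbox in blast)
  ultimately show ?thesis by (simp add: test_function_def)
qed

lemma test_function_partial:
  assumes "test_function \<phi>"
  shows "dirder (axis j 1) \<phi> (partial j \<phi>)" "test_function (partial j \<phi>)"
proof -
  show d: "dirder (axis j 1) \<phi> (partial j \<phi>)"
    by (rule dirder_partial[of 0]) (use assms in \<open>auto simp: test_function_def\<close>)
  obtain R where "\<And>x. norm x > R \<Longrightarrow> \<phi> x = 0"
    using assms compactly_supported_ball unfolding test_function_def by blast
  then have "norm x > R \<Longrightarrow> partial j \<phi> x = 0" for x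
    using dirder_support[OF d] by blast
  then have "compactly_supported (partial j \<phi>)"
    by (intro compactly_supportedI[OF compact_cball[of 0 R]]) auto
  moreover have "Ck k (partial j \<phi>)" for k
    using assms dirder_partial(2)[of k \<phi> j] by (auto simp: test_function_def simp del: Ck.simps)
  ultimately show "test_function (partial j \<phi>)" by (simp add: test_function_def)
qed

lemma test_function_sum:
  assumes "\<And>j. test_function (f j)"
  shows "test_function (\<lambda>x. \<Sum>j\<in>(UNIV::3 set). f j x)"
proof -
  have "\<exists>K. compact K \<and> (\<forall>x. x \<notin> K \<longrightarrow> f j x = 0)" for j
    using assms[of j] closure_subset[of "{x. f j x \<noteq> 0}"]
    by (intro exI[of _ "closure {x. f j x \<noteq> 0}"]) (auto simp: test_function_def compactly_supported_def)
  then obtain K where "\<And>j. compact (K j)" "\<And>j x. x \<notin> K j \<Longrightarrow> f j x = 0" by metis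
  then have "compactly_supported (\<lambda>x. \<Sum>j\<in>(UNIV::3 set). f j x)"
    by (intro compactly_supportedI[of "\<Union>j. K j"]) (auto intro!: compact_UN)
  moreover have "Ck k (\<lambda>x. \<Sum>j\<in>(UNIV::3 set). f j x)" for k
    using assms by (intro Ck_sum) (auto simp: test_function_def)
  ultimately show ?thesis by (simp add: test_function_def)
qed

lemma test_function_laplacian: "test_function \<phi> \<Longrightarrow> test_function (laplacian \<phi>)"
  unfolding laplacian_def[abs_def] by (intro test_function_sum test_function_partial)

lemma test_function_bounds:
  assumes "test_function \<phi>"
  obtains R M where "R > 0" "M \<ge> 0" "continuous_on UNIV \<phi>" "\<And>x. norm x > R \<Longrightarrow> \<phi> x = 0" "\<And>x. norm (\<phi> x) \<le> M"
proof -
  obtain R where R: "R > 0" "\<And>x. norm x > R \<Longrightarrow> \<phi> x = 0"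
    using assms compactly_supported_ball unfolding test_function_def by blast
  moreover have c: "continuous_on UNIV \<phi>"
    using assms by (auto simp: test_function_def dest: spec[of _ 0])
  ultimately show thesis using bounded_of_compact_support[of \<phi> R] that by blast
qed

text \<open>The positive and the negative part of \<open>r\<close> are densities of two measures
  that agree on boxes and are finite there. Boxes are a generator stable under intersection, so the
  measures coincide, and densities are unique almost everywhere.\<close>

lemma AE_zero_of_box_integrals:
  fixes r :: "'a::euclidean_space \<Rightarrow> real"
  assumes [measurable]: "r \<in> borel_measurable borel"
    and int: "\<And>a b. set_integrable lborel (box a b) r"
    and zero: "\<And>a b. (LINT x:box a b|lborel. r x) = 0"
  shows "AE x in lborel. r x = 0"
proof -
  let ?P = "density lborel (\<lambda>x. ennreal (r x))" and ?N = "density lborel (\<lambda>x. ennreal (- r x))"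
  have eq: "emeasure ?P (box a b) = emeasure ?N (box a b) \<and> emeasure ?P (box a b) < \<infinity>" for a b
  proof -
    let ?f = "\<lambda>x. indicator (box a b) x *\<^sub>R r x"
    have f: "integrable lborel ?f" using int[of a b] by (simp add: set_integrable_def)
    define I where "I = (\<integral>\<^sup>+x. ennreal (?f x) \<partial>lborel)"
    define J where "J = (\<integral>\<^sup>+x. ennreal (- ?f x) \<partial>lborel)"
    have "0 = enn2real I - enn2real J"
      using zero[of a b] real_lebesgue_integral_def[OF f] by (simp add: set_lebesgue_integral_def I_def J_def)
    then have "ennreal (enn2real I) = ennreal (enn2real J)" by simp
    moreover have fin: "I < top" "J < top"
      using f unfolding real_integrable_def I_def J_def by (auto simp: top.not_eq_extremum[symmetric])
    ultimately have "I = J" by (simp only: ennreal_enn2real)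
    moreover have "emeasure ?P (box a b) = (\<integral>\<^sup>+x. ennreal (?f x) \<partial>lborel)"
      by (subst emeasure_density) (auto intro!: nn_integral_cong simp: indicator_def)
    moreover have "emeasure ?N (box a b) = (\<integral>\<^sup>+x. ennreal (- ?f x) \<partial>lborel)"
      by (subst emeasure_density) (auto intro!: nn_integral_cong simp: indicator_def)
    ultimately show ?thesis using fin by (simp add: I_def J_def)
  qed
  have "?P = ?N"
  proof (rule measure_eqI_generator_eq)
    let ?E = "range (\<lambda>(a, b). box a b::'a set)"
    show "Int_stable ?E"
      by (auto simp: Int_stable_def box_Int_box)
    show "?E \<subseteq> Pow UNIV" "sets ?P = sigma_sets UNIV ?E" "sets ?N = sigma_sets UNIV ?E"
      by (simp_all add: borel_eq_box)
    let ?A = "\<lambda>n::nat. box (- (real n *\<^sub>R One)) (real n *\<^sub>R One) :: 'a set"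
    show "range ?A \<subseteq> ?E" "(\<Union>i. ?A i) = UNIV"
      unfolding UN_box_eq_UNIV by auto
    show "emeasure ?P (?A i) \<noteq> \<infinity>" for i using eq[of "- (real i *\<^sub>R One)" "real i *\<^sub>R One"] by auto 
    show "emeasure ?P X = emeasure ?N X" if "X \<in> ?E" for X
      using that eq by auto
  qed
  \<comment> \<open>As \<open>ennreal\<close> truncates negative numbers to 0, equality of these two
    values forces r x = 0.\<close>
  then have "AE x in lborel. ennreal (r x) = ennreal (- r x)"
    by (intro iffD1[OF sigma_finite_measure.density_unique_iff[OF sigma_finite_lborel]]) auto
  then show ?thesis
    proof eventually_elim
    case (elim x)
    then show ?case
      by (cases "r x \<ge> 0") (auto simp: ennreal_neg ennreal_eq_0_iff dest!: sym[of "ennreal _"])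
  qed
qed

lemma locally_integrableD:
  assumes "locally_integrable h"
  shows "h \<in> borel_measurable borel" "integrable lborel (\<lambda>x. indicator (cball 0 R) x * h x)"
proof -
  have i: "integrable lborel (\<lambda>x. indicator (cball 0 R) x * h x)" for R
  proof -
    have "set_integrable lborel (cball 0 R) h"
      using assms compact_cball unfolding locally_integrable_def by blast
    then show ?thesis by (simp add: set_integrable_def scaleR_conv_of_real of_real_indicator)
  qed
  show "integrable lborel (\<lambda>x. indicator (cball 0 R) x * h x)" by (rule i)
  show "h \<in> borel_measurable borel"
  proof (rule borel_measurable_LIMSEQ_metric)
    show "(\<lambda>x. indicator (cball 0 (real n)) x * h x) \<in> borel_measurable borel" for n
      using borel_measurable_integrable[OF i[of "real n"]] by simp
    fix x :: "real^3"
    obtain N where N: "norm x \<le> real N" using real_arch_simple by blast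
    show "(\<lambda>n. indicator (cball 0 (real n)) x * h x) \<longlonglongrightarrow> h x"
      by (rule tendsto_eventually) (use N in \<open>auto simp: eventually_sequentially intro!: exI[of _ N]\<close>)
  qed
qed

lemma locally_integrable_times:
  assumes h: "locally_integrable h" and [measurable]: "\<phi> \<in> borel_measurable borel"
    and \<phi>: "\<And>x. norm x > R \<Longrightarrow> \<phi> x = 0" "\<And>x. norm (\<phi> x) \<le> M"
  shows "integrable lborel (\<lambda>x. h x * \<phi> x)"
proof (rule Bochner_Integration.integrable_bound)
  have [measurable]: "h \<in> borel_measurable borel" using h by (rule locally_integrableD)
  show "integrable lborel (\<lambda>x. M * norm (indicator (cball 0 R) x * h x))"
    by (intro integrable_mult_right integrable_norm locally_integrableD h)
  have M: "M \<ge> 0" using \<phi>(2)[of 0] norm_ge_zero order_trans by blast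
  have "norm (h x * \<phi> x) \<le> norm (M * norm (indicator (cball 0 R) x * h x))" for x
  proof (cases "norm x > R")
    case False
    then show ?thesis using mult_right_mono[OF \<phi>(2)[of x] norm_ge_zero[of "h x"]] M
      by (simp add: norm_mult mult.commute)
  qed (simp add: \<phi>(1))
  then show "AE x in lborel. norm (h x * \<phi> x) \<le> norm (M * norm (indicator (cball 0 R) x * h x))" by simp
  show "(\<lambda>x. h x * \<phi> x) \<in> borel_measurable lborel" by measurable
qed

lemma locally_integrable_diff:
  "locally_integrable f \<Longrightarrow> locally_integrable g \<Longrightarrow> locally_integrable (\<lambda>x. f x - g x)"
  by (auto simp: locally_integrable_def intro!: set_integral_diff)

text \<open>The fundamental lemma of the calculus of variations: dominated convergence along
  \<open>box_bump\<close> turns the hypothesis into vanishing integrals over all boxes.\<close>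

theorem AE_zero_of_test_functions:
  assumes h: "locally_integrable h"
    and zero: "\<And>\<phi>. test_function \<phi> \<Longrightarrow> (LINT x|lborel. h x * \<phi> x) = 0"
  shows "AE x in lborel. h x = 0"
proof -
  have [measurable]: "h \<in> borel_measurable borel" using h by (rule locally_integrableD)
  have bump_meas [measurable]: "box_bump a b n \<in> borel_measurable borel" for a b n
    by (rule test_function_bounds[OF test_function_box_bump[of a b n]]) (simp add: borel_measurable_continuous_onI)
  have box: "integrable lborel (\<lambda>x. h x * indicator (box a b) x)" "(LINT x|lborel. h x * indicator (box a b) x) = 0" for a b
  proof -
    obtain R where R: "cbox a b \<subseteq> cball 0 R" using bounded_cbox[of a b] unfolding bounded_iff by (auto simp: subset_iff)
    then have R': "box a b \<subseteq> cball 0 R" using box_subset_cbox by blast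
    show "integrable lborel (\<lambda>x. h x * indicator (box a b) x)"
      by (rule locally_integrable_times[OF h, of _ R 1]) (use R' in \<open>auto simp: indicator_def\<close>)
    have "(\<lambda>n. LINT x|lborel. h x * box_bump a b n x) \<longlonglongrightarrow> (LINT x|lborel. h x * indicator (box a b) x)"
    proof (rule integral_dominated_convergence[where w = "\<lambda>x. norm (indicator (cball 0 R) x * h x)"])
      show "integrable lborel (\<lambda>x. norm (indicator (cball 0 R) x * h x))"
        by (intro integrable_norm locally_integrableD h)
      show "AE x in lborel. (\<lambda>n. h x * box_bump a b n x) \<longlonglongrightarrow> h x * indicator (box a b) x"
        by (intro AE_I2 tendsto_intros box_bump_limit)
      have "norm (h x * box_bump a b n x) \<le> norm (indicator (cball 0 R) x * h x)" for x n
      proof (cases "x \<in> cball 0 R")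
        case True
        then show ?thesis using mult_left_mono[OF box_bump_norm[of a b n x] norm_ge_zero[of "h x"]]
          by (simp add: norm_mult)
      next
        case False
        then have "x \<notin> box a b" using R' by blast
        then show ?thesis by (simp add: box_bump_zero)
      qed
      then show "AE x in lborel. norm (h x * box_bump a b n x) \<le> norm (indicator (cball 0 R) x * h x)" for n by simp
    qed measurable
    then show "(LINT x|lborel. h x * indicator (box a b) x) = 0"
      using zero[OF test_function_box_bump] by (simp add: LIMSEQ_const_iff)
  qed
  have eq: "indicator (box a b) x *\<^sub>R Re (h x) = Re (h x * indicator (box a b) x)"
    "indicator (box a b) x *\<^sub>R Im (h x) = Im (h x * indicator (box a b) x)" for a b x
    by (simp_all add: indicator_def)
  have "AE x in lborel. Re (h x) = 0"
  proof (rule AE_zero_of_box_integrals)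
    fix a b
    show "set_integrable lborel (box a b) (\<lambda>x. Re (h x))"
      unfolding set_integrable_def eq by (rule integrable_Re[OF box(1)])
    show "(LINT x:box a b|lborel. Re (h x)) = 0"
      unfolding set_lebesgue_integral_def eq integral_Re[OF box(1)[of a b]] box(2) by simp
  qed measurable
  moreover have "AE x in lborel. Im (h x) = 0"
  proof (rule AE_zero_of_box_integrals)
    fix a b
    show "set_integrable lborel (box a b) (\<lambda>x. Im (h x))"
      unfolding set_integrable_def eq by (rule integrable_Im[OF box(1)])
    show "(LINT x:box a b|lborel. Im (h x)) = 0"
      unfolding set_lebesgue_integral_def eq integral_Im[OF box(1)[of a b]] box(2) by simp
  qed measurable
  ultimately show ?thesis by eventually_elim (simp add: complex_eq_iff)
qed

text \<open>This makes the choice in \<open>weak_gradient\<close> harmless: whatever representative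
  is selected, integrals involving it can be computed from any explicit weak gradient.\<close>

theorem weak_gradient_unique:
  assumes g: "has_weak_gradient u g" and g': "has_weak_gradient u g'"
  shows "AE x in lborel. g x = g' x"
proof -
  have "AE x in lborel. g x $ j - g' x $ j = 0" for j
  proof (rule AE_zero_of_test_functions)
    show "locally_integrable (\<lambda>x. g x $ j - g' x $ j)"
      using g g' by (intro locally_integrable_diff) (auto simp: has_weak_gradient_def)
    fix \<phi> assume \<phi>: "test_function \<phi>"
    obtain R M where RM: "R > 0" "M \<ge> 0" "continuous_on UNIV \<phi>" "\<And>x. norm x > R \<Longrightarrow> \<phi> x = 0" "\<And>x. norm (\<phi> x) \<le> M"
      using test_function_bounds[OF \<phi>] by blast
    have "integrable lborel (\<lambda>x. g x $ j * \<phi> x)" "integrable lborel (\<lambda>x. g' x $ j * \<phi> x)"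
      using g g' RM by (auto intro!: locally_integrable_times[of _ \<phi> R M] borel_measurable_continuous_onI simp: has_weak_gradient_def)
    then show "(LINT x|lborel. (g x $ j - g' x $ j) * \<phi> x) = 0"
      using g g' \<phi> by (simp add: has_weak_gradient_def left_diff_distrib)
  qed
  then have "AE x in lborel. \<forall>j. g x $ j - g' x $ j = 0" by (subst AE_all_countable) auto
  then show ?thesis by eventually_elim (simp add: vec_eq_iff)
qed

section \<open>The biharmonic kernel\<close>

lemma test_function_support:
  assumes "test_function \<phi>"
  shows "\<exists>R. \<forall>x. norm x > R \<longrightarrow> \<phi> x = 0"
  using assms compactly_supported_ball[of \<phi>] unfolding test_function_def by metis

lemma test_function_continuous: "test_function \<phi> \<Longrightarrow> continuous_on UNIV \<phi>"
  by (auto simp: test_function_def dest: spec[of _ 0])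

text \<open>Partial fractions of 1/(|\<xi>|^4 - \<kappa>^4) into (1/(|\<xi>|^2 - \<kappa>^2) -
  1/(|\<xi>|^2 + \<kappa>^2)) / (2 \<kappa>^2). The constant is 2 \<kappa>^2 times the normalisation
  4 pi omitted from \<open>Phi\<close>.\<close>

definition GB :: "real \<Rightarrow> real^3 \<Rightarrow> complex" where
  "GB \<kappa> z = (Phi (of_real \<kappa>) z - Phi (\<i> * of_real \<kappa>) z) / of_real (8 * pi * \<kappa>\<^sup>2)"

definition DGB :: "real \<Rightarrow> 3 \<Rightarrow> real^3 \<Rightarrow> complex" where
  "DGB \<kappa> j z = (DPhi (of_real \<kappa>) j z - DPhi (\<i> * of_real \<kappa>) j z) / of_real (8 * pi * \<kappa>\<^sup>2)"

lemma GB_measurable [measurable]: "GB \<kappa> \<in> borel_measurable borel" "DGB \<kappa> j \<in> borel_measurable borel"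
  unfolding GB_def[abs_def] DGB_def[abs_def] by measurable

lemma G0_eq_GB: "G0 x y \<kappa> = GB \<kappa> (x - y)"
proof -
  have "\<i> * (\<i> * complex_of_real \<kappa>) * of_real r = - of_real (\<kappa> * r)" for r
    by (simp add: mult.assoc[symmetric])
  then show ?thesis
    by (simp add: G0_def GB_def Phi_def diff_divide_distrib[symmetric] mult.assoc mult.commute[of "norm (x - y)"])
qed

lemma R0_eq_GB: "R0 \<kappa> f x = (LINT y|lborel. GB \<kappa> (x - y) * f y)"
  by (simp add: R0_def G0_eq_GB)

lemma exp_diff_bound: "s \<ge> 0 \<Longrightarrow> norm (exp (\<i> * complex_of_real s) - exp (- complex_of_real s)) \<le> 2 * s"
proof -
  assume s: "s \<ge> 0"
  have "norm (exp (\<i> * complex_of_real s) - exp (- complex_of_real s) - (exp (\<i> * complex_of_real 0) - exp (- complex_of_real 0))) \<le> 2 * norm (s - 0)"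
  proof (rule differentiable_bound[of "{0..s}" "\<lambda>s. exp (\<i> * complex_of_real s) - exp (- complex_of_real s)" "\<lambda>t h. h *\<^sub>R (\<i> * exp (\<i> * complex_of_real t) + exp (- complex_of_real t))"])
    fix t assume t: "t \<in> {0..s}"
    have "((\<lambda>s. exp (\<i> * complex_of_real s) - exp (- complex_of_real s)) has_vector_derivative (\<i> * exp (\<i> * complex_of_real t) + exp (- complex_of_real t))) (at t)"
      by (rule has_vector_derivative_real_field[where f = "\<lambda>s. exp (\<i> * s) - exp (- s)"]) (auto intro!: derivative_eq_intros)
    then show "((\<lambda>s. exp (\<i> * complex_of_real s) - exp (- complex_of_real s)) has_derivative (\<lambda>h. h *\<^sub>R (\<i> * exp (\<i> * complex_of_real t) + exp (- complex_of_real t)))) (at t within {0..s})"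
      by (simp add: has_vector_derivative_def has_derivative_at_withinI)
    have "norm (\<i> * exp (\<i> * complex_of_real t) + exp (- complex_of_real t)) \<le> 1 + 1"
      using t by (intro norm_triangle_mono) (auto simp: norm_mult)
    then show "onorm (\<lambda>h. h *\<^sub>R (\<i> * exp (\<i> * complex_of_real t) + exp (- complex_of_real t))) \<le> 2"
      by (intro onorm_le) (simp add: mult_left_mono mult.commute[of 2])
  qed (use s in auto)
  then show ?thesis using s by simp
qed

text \<open>The numerator of the radial derivative of \<open>GB\<close> in the variable s = \<kappa>
  |z|, over the denominator 8 pi \<kappa>^2 |z|^2.\<close>

definition grad_profile :: "real \<Rightarrow> complex" where
  "grad_profile s = (\<i> * of_real s - 1) * exp (\<i> * of_real s) + (of_real s + 1) * exp (- of_real s)"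

text \<open>The derivative is -s (exp(\<i> s) + exp(-s)), so the profile vanishes to second order at
  0: the singularities of the two Helmholtz gradients cancel. The linear bound follows from the
  quadratic one for s at most 1 and from the triangle inequality beyond.\<close>

lemma grad_profile_bound:
  assumes s: "s \<ge> 0"
  shows "norm (grad_profile s) \<le> 2 * s\<^sup>2" "norm (grad_profile s) \<le> 3 * s"
proof -
  have "norm (grad_profile s - grad_profile 0) \<le> (2 * s) * norm (s - 0)"
  proof (rule differentiable_bound[of "{0..s}" grad_profile "\<lambda>t h. h *\<^sub>R (- of_real t * (exp (\<i> * complex_of_real t) + exp (- complex_of_real t)))"])
    fix t assume t: "t \<in> {0..s}"
    have "(grad_profile has_vector_derivative (- of_real t * (exp (\<i> * complex_of_real t) + exp (- complex_of_real t)))) (at t)"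
      unfolding grad_profile_def[abs_def]
      by (rule has_vector_derivative_real_field[where f = "\<lambda>s. (\<i> * s - 1) * exp (\<i> * s) + (s + 1) * exp (- s)"])
         (auto intro!: derivative_eq_intros simp: algebra_simps)
    then show "(grad_profile has_derivative (\<lambda>h. h *\<^sub>R (- of_real t * (exp (\<i> * complex_of_real t) + exp (- complex_of_real t))))) (at t within {0..s})"
      by (simp add: has_vector_derivative_def has_derivative_at_withinI)
    have "norm (exp (\<i> * complex_of_real t) + exp (- complex_of_real t)) \<le> 1 + 1"
      using t by (intro norm_triangle_mono) auto
    then have "norm (- of_real t * (exp (\<i> * complex_of_real t) + exp (- complex_of_real t))) \<le> s * 2"
      unfolding norm_mult using t by (intro mult_mono) auto
    then show "onorm (\<lambda>h. h *\<^sub>R (- of_real t * (exp (\<i> * complex_of_real t) + exp (- complex_of_real t)))) \<le> 2 * s"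
      by (intro onorm_le) (simp add: mult_left_mono mult.commute[of "2 * s"] del: norm_mult mult_minus_left)
  qed (use s in auto)
  then show 1: "norm (grad_profile s) \<le> 2 * s\<^sup>2" using s by (simp add: grad_profile_def power2_eq_square)
  have "norm (\<i> * of_real s - 1 :: complex) \<le> s + 1"
    using norm_triangle_ineq4[of "\<i> * of_real s" "1::complex"] s by (simp add: norm_mult)
  then have a: "norm ((\<i> * of_real s - 1) * exp (\<i> * complex_of_real s)) \<le> s + 1"
    by (simp add: norm_mult)
  have "norm (of_real s + 1 :: complex) = \<bar>s + 1\<bar>"
    by (metis norm_of_real of_real_1 of_real_add)
  then have b: "norm ((of_real s + 1) * exp (- complex_of_real s)) = (s + 1) * exp (- s)"
    using s by (simp add: norm_mult)
  have "norm (grad_profile s) \<le> (s + 1) + (s + 1) * exp (- s)"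
    unfolding grad_profile_def by (rule norm_triangle_mono) (use a b in auto)
  also have "(s + 1) * exp (- s) \<le> 1"
    using exp_ge_add_one_self[of s] s by (simp add: exp_minus field_simps)
  finally have 2: "norm (grad_profile s) \<le> s + 2" by simp
  show "norm (grad_profile s) \<le> 3 * s"
  proof (cases "s \<le> 1")
    case True
    then have "2 * s\<^sup>2 \<le> 2 * s" using s by (simp add: power2_eq_square mult_left_le)
    with 1 s show ?thesis by linarith
  qed (use 2 in simp)
qed

lemma pi_ge_one: "1 \<le> pi" using pi_gt3 by simp

text \<open>Two regimes of the numerator exp(\<i> \<kappa> r) - exp(-\<kappa> r): its bound 2
  \<kappa> r cancels the singularity, its bound 2 keeps the singularity and saves another power of
  \<kappa>.\<close>

lemma GB_bounds:
  assumes k: "\<kappa> > 0"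
  shows "norm (GB \<kappa> z) \<le> 1 / \<kappa>" "norm (GB \<kappa> z) \<le> 1 / \<kappa>\<^sup>2 * sing z"
proof -
  have "norm (GB \<kappa> z) \<le> 1 / \<kappa> \<and> norm (GB \<kappa> z) \<le> 1 / \<kappa>\<^sup>2 * sing z"
  proof (cases "z = 0")
    case True
    then show ?thesis using k sing_ge1[of z] by (simp add: GB_def Phi_def)
  next
    case False
    define r where "r = norm z"
    have r: "r > 0" using False by (simp add: r_def)
    let ?X = "exp (\<i> * complex_of_real (\<kappa> * r)) - exp (- complex_of_real (\<kappa> * r))"
    have "GB \<kappa> z = ?X / of_real (8 * pi * \<kappa>\<^sup>2 * r)"
      using G0_eq_GB[of z 0 \<kappa>] by (simp add: G0_def r_def)
    then have eq: "norm (GB \<kappa> z) = norm ?X / (8 * pi * \<kappa>\<^sup>2 * r)"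
      using r by (simp add: norm_divide norm_mult norm_power)
    have X1: "norm ?X \<le> 2 * (\<kappa> * r)" using exp_diff_bound[of "\<kappa> * r"] k r by simp
    have "norm (exp (\<i> * complex_of_real (\<kappa> * r))) = 1" by (rule norm_exp_i_times)
    moreover have "norm (exp (- complex_of_real (\<kappa> * r))) \<le> 1" using k r by simp
    ultimately have X2: "norm ?X \<le> 1 + 1"
      using norm_triangle_ineq4[of "exp (\<i> * complex_of_real (\<kappa> * r))" "exp (- complex_of_real (\<kappa> * r))"] by linarith
    have "norm (GB \<kappa> z) \<le> 2 * (\<kappa> * r) / (8 * pi * \<kappa>\<^sup>2 * r)"
      unfolding eq using X1 k r by (intro divide_right_mono) auto
    also have "\<dots> = 1 / \<kappa> * (1 / (4 * pi))" using k r by (simp add: field_simps power2_eq_square)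
    also have "\<dots> \<le> 1 / \<kappa> * 1" using k pi_ge_one by (intro mult_left_mono) (auto simp: field_simps)
    finally have 1: "norm (GB \<kappa> z) \<le> 1 / \<kappa>" by simp
    have "norm (GB \<kappa> z) \<le> 2 / (8 * pi * \<kappa>\<^sup>2 * r)"
      unfolding eq using X2 k r by (intro divide_right_mono) auto
    also have "\<dots> = 1 / (4 * pi) * (1 / \<kappa>\<^sup>2 * (1 / r))" using k r by (simp add: field_simps)
    also have "\<dots> \<le> 1 * (1 / \<kappa>\<^sup>2 * sing z)"
      using k r pi_ge_one sing_ge_inverse(1)[of z] by (intro mult_mono) (auto simp: field_simps r_def)
    finally show ?thesis using 1 by simp
  qed
  then show "norm (GB \<kappa> z) \<le> 1 / \<kappa>" "norm (GB \<kappa> z) \<le> 1 / \<kappa>\<^sup>2 * sing z" by auto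
qed

text \<open>The first bound serves Fubini and the weak gradient. The second is the source of the
  operator norm O(1/\<kappa>).\<close>

lemma DGB_bounds:
  assumes k: "\<kappa> > 0"
  shows "norm (DGB \<kappa> j z) \<le> 1" "norm (DGB \<kappa> j z) \<le> 1 / \<kappa> * sing z"
proof -
  have "norm (DGB \<kappa> j z) \<le> 1 \<and> norm (DGB \<kappa> j z) \<le> 1 / \<kappa> * sing z"
  proof (cases "z = 0")
    case True
    then show ?thesis using k sing_ge1[of z] by (simp add: DGB_def DPhi_def)
  next
    case False
    define r where "r = norm z"
    have r: "r > 0" using False by (simp add: r_def)
    have "\<i> * (\<i> * complex_of_real \<kappa>) = - of_real \<kappa>" by simp
    then have "DGB \<kappa> j z = grad_profile (\<kappa> * r) * of_real (z $ j / r) / of_real (8 * pi * \<kappa>\<^sup>2 * r\<^sup>2)"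
      using r k unfolding DGB_def DPhi_def r_def[symmetric] grad_profile_def
      by (simp add: field_simps power2_eq_square)
    then have "norm (DGB \<kappa> j z) = norm (grad_profile (\<kappa> * r)) * (\<bar>z $ j\<bar> / r) / (8 * pi * \<kappa>\<^sup>2 * r\<^sup>2)"
      using r k by (simp add: norm_divide norm_mult norm_power)
    also have "\<dots> \<le> norm (grad_profile (\<kappa> * r)) * 1 / (8 * pi * \<kappa>\<^sup>2 * r\<^sup>2)"
      using r k component_le_norm_cart[of z j]
      by (intro divide_right_mono mult_left_mono) (auto simp: r_def divide_le_eq)
    finally have le: "norm (DGB \<kappa> j z) \<le> norm (grad_profile (\<kappa> * r)) / (8 * pi * \<kappa>\<^sup>2 * r\<^sup>2)" by simp
    have q: "norm (grad_profile (\<kappa> * r)) \<le> 2 * (\<kappa> * r)\<^sup>2" "norm (grad_profile (\<kappa> * r)) \<le> 3 * (\<kappa> * r)"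
      using grad_profile_bound[of "\<kappa> * r"] k r by auto
    note le
    also have "norm (grad_profile (\<kappa> * r)) / (8 * pi * \<kappa>\<^sup>2 * r\<^sup>2) \<le> 2 * (\<kappa> * r)\<^sup>2 / (8 * pi * \<kappa>\<^sup>2 * r\<^sup>2)"
      using q k r by (intro divide_right_mono) auto
    also have "\<dots> = 1 / (4 * pi)" using k r by (simp add: field_simps)
    also have "\<dots> \<le> 1" using pi_ge_one by simp
    finally have 1: "norm (DGB \<kappa> j z) \<le> 1" .
    note le
    also have "norm (grad_profile (\<kappa> * r)) / (8 * pi * \<kappa>\<^sup>2 * r\<^sup>2) \<le> 3 * (\<kappa> * r) / (8 * pi * \<kappa>\<^sup>2 * r\<^sup>2)"
      using q k r by (intro divide_right_mono) auto
    also have "\<dots> = 3 / (8 * pi) * (1 / \<kappa> * (1 / r))" using k r by (simp add: field_simps power2_eq_square)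
    also have "\<dots> \<le> 1 * (1 / \<kappa> * sing z)"
      using k r pi_ge_one sing_ge_inverse(1)[of z] by (intro mult_mono) (auto simp: field_simps r_def)
    finally show ?thesis using 1 by simp
  qed
  then show "norm (DGB \<kappa> j z) \<le> 1" "norm (DGB \<kappa> j z) \<le> 1 / \<kappa> * sing z" by auto
qed

text \<open>The origin is excluded: \<open>GB\<close> has there the conventional value 0 instead of
  its limit, and \<open>DGB\<close> depends on the direction of approach.\<close>

lemma GB_continuous:
  assumes "\<kappa> > 0"
  shows "continuous_on (- {0}) (GB \<kappa>)" "continuous_on (- {0}) (DGB \<kappa> j)"
  unfolding GB_def[abs_def] DGB_def[abs_def] Phi_def[abs_def] DPhi_def[abs_def]
  using assms by (auto intro!: continuous_intros)

lemma Im_wavenumber: "\<kappa> \<ge> 0 \<Longrightarrow> Im (complex_of_real \<kappa>) \<ge> 0" "\<kappa> \<ge> 0 \<Longrightarrow> Im (\<i> * complex_of_real \<kappa>) \<ge> 0"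
  by auto

lemma Phi_integrable:
  assumes "Im k \<ge> 0" "continuous_on UNIV \<phi>" "\<And>y. norm y > R \<Longrightarrow> \<phi> y = 0"
  shows "integrable lborel (\<lambda>y. Phi k (y - x) * \<phi> y)" "integrable lborel (\<lambda>y. DPhi k j (y - x) * \<phi> y)"
proof -
  have [measurable]: "\<phi> \<in> borel_measurable borel" using assms by (intro borel_measurable_continuous_onI)
  obtain M where M: "\<And>y. norm (\<phi> y) \<le> M" using bounded_of_compact_support[of \<phi> R] assms by auto
  show "integrable lborel (\<lambda>y. Phi k (y - x) * \<phi> y)"
    by (rule kernel_integrable[where C = 1 and R = R and M = M]) (use norm_Phi_le[OF assms(1)] M assms in auto)
  show "integrable lborel (\<lambda>y. DPhi k j (y - x) * \<phi> y)"
    by (rule kernel_integrable[where C = "norm k + 1" and R = R and M = M]) (use norm_DPhi_le[OF assms(1)] M assms in auto)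
qed

lemma GB_gradient:
  assumes k: "\<kappa> > 0" and d: "dirder (axis j 1) \<phi> \<phi>'" and supp: "\<And>y. norm y > R \<Longrightarrow> \<phi> y = 0"
  shows "(LINT y|lborel. GB \<kappa> (y - x) * \<phi>' y) = - (LINT y|lborel. DGB \<kappa> j (y - x) * \<phi> y)"
proof -
  have supp': "norm y > R \<Longrightarrow> \<phi>' y = 0" for y by (rule dirder_support[OF d supp])
  have c: "continuous_on UNIV \<phi>" "continuous_on UNIV \<phi>'" using d by (auto simp: dirder_def)
  have k0: "\<kappa> \<ge> 0" using k by simp
  have "(LINT y|lborel. GB \<kappa> (y - x) * \<phi>' y)
      = ((LINT y|lborel. Phi \<kappa> (y - x) * \<phi>' y) - (LINT y|lborel. Phi (\<i> * \<kappa>) (y - x) * \<phi>' y)) / of_real (8 * pi * \<kappa>\<^sup>2)"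
    unfolding GB_def times_divide_eq_left left_diff_distrib
    by (simp only: integral_divide_zero Bochner_Integration.integral_diff[OF Phi_integrable(1)[OF Im_wavenumber(1)[OF k0] c(2) supp'] Phi_integrable(1)[OF Im_wavenumber(2)[OF k0] c(2) supp']])
  also have "(LINT y|lborel. Phi \<kappa> (y - x) * \<phi>' y) = - (LINT y|lborel. DPhi \<kappa> j (y - x) * \<phi> y)"
    by (rule Phi_gradient[OF Im_wavenumber(1)[OF k0] d]) (rule supp)
  also have "(LINT y|lborel. Phi (\<i> * \<kappa>) (y - x) * \<phi>' y) = - (LINT y|lborel. DPhi (\<i> * \<kappa>) j (y - x) * \<phi> y)"
    by (rule Phi_gradient[OF Im_wavenumber(2)[OF k0] d]) (rule supp)
  also have "(- (LINT y|lborel. DPhi \<kappa> j (y - x) * \<phi> y) - - (LINT y|lborel. DPhi (\<i> * \<kappa>) j (y - x) * \<phi> y)) / of_real (8 * pi * \<kappa>\<^sup>2)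
     = - ((LINT y|lborel. DPhi \<kappa> j (y - x) * \<phi> y) - (LINT y|lborel. DPhi (\<i> * \<kappa>) j (y - x) * \<phi> y)) / of_real (8 * pi * \<kappa>\<^sup>2)"
    by simp
  also have "\<dots> = - (LINT y|lborel. DGB \<kappa> j (y - x) * \<phi> y)"
    unfolding DGB_def times_divide_eq_left left_diff_distrib
    by (simp only: integral_divide_zero Bochner_Integration.integral_diff[OF Phi_integrable(2)[OF Im_wavenumber(1)[OF k0] c(1) supp] Phi_integrable(2)[OF Im_wavenumber(2)[OF k0] c(1) supp]] minus_divide_left)
  finally show ?thesis .
qed

text \<open>For k = \<kappa> and for k = \<i> \<kappa> one has \<open>\<Delta>\<^sup>2 -
  \<kappa>\<^sup>4 = (\<Delta> + k\<^sup>2) (\<Delta> - k\<^sup>2)\<close>. So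
  \<open>Phi_fundamental\<close> applies to \<open>laplacian \<phi>\<close> plus c \<phi> with c =
  -k^2. In the difference of the two results the Laplacians cancel and 8 pi \<kappa>^2 \<phi>
  remains.\<close>

lemma GB_fundamental:
  assumes k: "\<kappa> > 0" and \<phi>: "test_function \<phi>"
  shows "(LINT y|lborel. GB \<kappa> (y - x) * (laplacian (laplacian \<phi>) y - of_real (\<kappa>^4) * \<phi> y)) = \<phi> x"
proof -
  have k0: "\<kappa> \<ge> 0" using k by simp
  define P where "P = (\<lambda>y. laplacian (laplacian \<phi>) y - of_real (\<kappa>^4) * \<phi> y)"
  have tf: "test_function (laplacian \<phi>)" "test_function (laplacian (laplacian \<phi>))"
    using \<phi> by (auto intro: test_function_laplacian)
  obtain R where R: "\<And>y. norm y > R \<Longrightarrow> \<phi> y = 0" using test_function_support[OF \<phi>] by blast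
  obtain R1 where R1: "\<And>y. norm y > R1 \<Longrightarrow> laplacian \<phi> y = 0" using test_function_support[OF tf(1)] by blast
  obtain R2 where R2: "\<And>y. norm y > R2 \<Longrightarrow> laplacian (laplacian \<phi>) y = 0" using test_function_support[OF tf(2)] by blast
  define Q where "Q = max R (max R1 R2)"
  have Q: "\<phi> y = 0" "laplacian \<phi> y = 0" "laplacian (laplacian \<phi>) y = 0" if "norm y > Q" for y
    using that R R1 R2 by (auto simp: Q_def)
  have c: "continuous_on UNIV \<phi>" "continuous_on UNIV (laplacian (laplacian \<phi>))"
    using \<phi> tf by (auto intro: test_function_continuous)
  have cP: "continuous_on UNIV P" unfolding P_def by (intro continuous_intros c)
  have P0: "norm y > Q \<Longrightarrow> P y = 0" for y by (simp add: P_def Q)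
  have main: "(LINT y|lborel. Phi k (y - x) * P y) = - 4 * pi * (laplacian \<phi> x + c * \<phi> x)"
    if "Im k \<ge> 0" "c = - k\<^sup>2" "k^4 = of_real (\<kappa>^4)" for k c
  proof -
    have "(LINT y|lborel. Phi k (y - x) * ((\<Sum>j\<in>UNIV. partial j (partial j (laplacian \<phi>)) y + c * partial j (partial j \<phi>) y)
           + k\<^sup>2 * (laplacian \<phi> y + c * \<phi> y))) = - 4 * pi * (laplacian \<phi> x + c * \<phi> x)"
      by (rule Phi_fundamental[OF that(1), of "\<lambda>x. laplacian \<phi> x + c * \<phi> x" "\<lambda>j x. partial j (laplacian \<phi>) x + c * partial j \<phi> x" _ Q])
         (use Q in \<open>auto intro!: dirder_add dirder_cmult test_function_partial tf \<phi>\<close>)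
    moreover have "(\<Sum>j\<in>UNIV. partial j (partial j (laplacian \<phi>)) y + c * partial j (partial j \<phi>) y)
           + k\<^sup>2 * (laplacian \<phi> y + c * \<phi> y) = P y" for y
    proof -
      have "(\<Sum>j\<in>UNIV. partial j (partial j (laplacian \<phi>)) y + c * partial j (partial j \<phi>) y)
          = laplacian (laplacian \<phi>) y + c * laplacian \<phi> y"
        by (simp add: sum.distrib sum_distrib_left laplacian_def[of "laplacian \<phi>"] laplacian_def[of \<phi> y])
      moreover have "c * k\<^sup>2 = - of_real (\<kappa>^4)" using that by (simp add: power4_eq_xxxx power2_eq_square mult.assoc)
      then have "(c * k\<^sup>2) * \<phi> y = - of_real (\<kappa>^4) * \<phi> y" by simp
      then have "k\<^sup>2 * (c * \<phi> y) = - of_real (\<kappa>^4) * \<phi> y" by (simp only: mult_ac)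
      ultimately show ?thesis using that by (simp add: P_def algebra_simps)
    qed
    ultimately show ?thesis by simp
  qed
  have "(LINT y|lborel. GB \<kappa> (y - x) * P y)
      = ((LINT y|lborel. Phi \<kappa> (y - x) * P y) - (LINT y|lborel. Phi (\<i> * \<kappa>) (y - x) * P y)) / of_real (8 * pi * \<kappa>\<^sup>2)"
    unfolding GB_def times_divide_eq_left left_diff_distrib
    by (simp only: integral_divide_zero Bochner_Integration.integral_diff[OF Phi_integrable(1)[OF Im_wavenumber(1)[OF k0] cP P0] Phi_integrable(1)[OF Im_wavenumber(2)[OF k0] cP P0]])
  also have "\<dots> = \<phi> x"
    unfolding main[of "of_real \<kappa>" "- of_real (\<kappa>\<^sup>2)", OF Im_wavenumber(1)[OF k0], simplified]
      main[of "\<i> * of_real \<kappa>" "of_real (\<kappa>\<^sup>2)", OF Im_wavenumber(2)[OF k0], simplified power_mult_distrib, simplified]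
    using k by (simp add: field_simps)
  finally show ?thesis by (simp add: P_def)
qed

section \<open>Convolution of a bounded kernel with an integrable function\<close>

lemma kernel_pair_integrable:
  fixes f g :: "'a::euclidean_space \<Rightarrow> complex" and K :: "'a \<times> 'a \<Rightarrow> complex"
  assumes [measurable]: "K \<in> borel_measurable (borel \<Otimes>\<^sub>M borel)" and K: "\<And>p. norm (K p) \<le> C"
    and f: "integrable lborel f" and g: "integrable lborel g"
  shows "integrable (lborel \<Otimes>\<^sub>M lborel) (\<lambda>(x, y). K (x, y) * f y * g x)"
proof -
  have [measurable]: "f \<in> borel_measurable borel" "g \<in> borel_measurable borel"
    using f g borel_measurable_integrable by auto
  have C: "C \<ge> 0" using K[of undefined] norm_ge_zero order_trans by blast
  have 1: "integrable (lborel \<Otimes>\<^sub>M lborel) (\<lambda>(x, y). C * norm (f y) * norm (g x))"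
    by (rule lborel_pair.Fubini_integrable) (use f g C in \<open>auto simp: abs_mult\<close>)
  show ?thesis
    by (rule Bochner_Integration.integrable_bound[OF 1])
       (auto simp: norm_mult K C mult_right_mono abs_mult)
qed

text \<open>Applied to \<open>GB\<close> and \<open>DGB\<close>, whose boundedness allows densities
  that are merely integrable, without support or sup norm control.\<close>

lemma conv_integrable:
  fixes K :: "real^3 \<Rightarrow> complex"
  assumes [measurable]: "K \<in> borel_measurable borel" and K: "\<And>z. norm (K z) \<le> C"
    and f: "integrable lborel f"
  shows "integrable lborel (\<lambda>y. K (x - y) * f y)"
    and "norm (LINT y|lborel. K (x - y) * f y) \<le> C * (LINT y|lborel. norm (f y))"
    and "(\<lambda>x. LINT y|lborel. K (x - y) * f y) \<in> borel_measurable borel"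
proof -
  have [measurable]: "f \<in> borel_measurable borel"
    using f borel_measurable_integrable by auto
  have C: "C \<ge> 0" using K[of undefined] norm_ge_zero order_trans by blast
  have b: "norm (K (x - y) * f y) \<le> C * norm (f y)" for x y
    by (simp add: norm_mult K mult_right_mono)
  have i: "integrable lborel (\<lambda>y. C * norm (f y))" using f by simp
  show 1: "integrable lborel (\<lambda>y. K (x - y) * f y)"
    by (rule Bochner_Integration.integrable_bound[OF i]) (use b C in \<open>auto simp: abs_mult norm_mult\<close>)
  have "norm (LINT y|lborel. K (x - y) * f y) \<le> (LINT y|lborel. norm (K (x - y) * f y))"
    by (rule integral_norm_bound)
  also have "\<dots> \<le> (LINT y|lborel. C * norm (f y))"
    using b i by (intro integral_mono integrable_norm 1)
  finally show "norm (LINT y|lborel. K (x - y) * f y) \<le> C * (LINT y|lborel. norm (f y))" by simp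
  have "(\<lambda>x. LINT y|lborel. K (x - y) * f y) \<in> borel_measurable lborel"
    by (rule lborel.borel_measurable_lebesgue_integral) measurable
  then show "(\<lambda>x. LINT y|lborel. K (x - y) * f y) \<in> borel_measurable borel" by simp
qed

lemma conv_Fubini:
  fixes K :: "real^3 \<Rightarrow> complex"
  assumes [measurable]: "K \<in> borel_measurable borel" and K: "\<And>z. norm (K z) \<le> C"
    and f: "integrable lborel f" and g: "integrable lborel g"
  shows "(LINT x|lborel. (LINT y|lborel. K (x - y) * f y) * g x) = (LINT y|lborel. f y * (LINT x|lborel. K (x - y) * g x))"
proof -
  have i: "integrable (lborel \<Otimes>\<^sub>M lborel) (\<lambda>(x, y). (\<lambda>(x, y). K (x - y)) (x, y) * f y * g x)"
    by (rule kernel_pair_integrable[where C = C]) (use K f g in auto)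
  have "(LINT x|lborel. (LINT y|lborel. K (x - y) * f y) * g x) = (LINT x|lborel. LINT y|lborel. K (x - y) * f y * g x)"
    by simp
  also have "\<dots> = (LINT y|lborel. LINT x|lborel. K (x - y) * f y * g x)"
    using lborel_pair.Fubini_integral[of "\<lambda>x y. K (x - y) * f y * g x"] i by simp
  also have "\<dots> = (LINT y|lborel. LINT x|lborel. f y * (K (x - y) * g x))"
    by (simp add: mult_ac)
  finally show ?thesis by simp
qed

lemma locally_integrable_bounded:
  assumes [measurable]: "u \<in> borel_measurable borel" and u: "\<And>x. norm (u x) \<le> M"
  shows "locally_integrable u"
  unfolding locally_integrable_def set_integrable_def
proof (intro allI impI)
  fix K :: "(real^3) set" assume K: "compact K"
  then have [measurable]: "K \<in> sets borel" by (simp add: compact_imp_closed)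
  obtain R where R: "\<And>x. x \<in> K \<Longrightarrow> norm x \<le> R"
    using compact_imp_bounded[OF K] unfolding bounded_iff by blast
  show "integrable lborel (\<lambda>x. indicator K x *\<^sub>R u x)"
    by (rule integrable_of_bounded_support[of _ R M])
       (use R u in \<open>force simp: indicator_def intro: order_trans[OF norm_ge_zero]\<close>)+
qed

lemma test_function_integrable: "test_function \<phi> \<Longrightarrow> integrable lborel \<phi>"
  using test_function_support[of \<phi>] test_function_continuous[of \<phi>] integrable_continuous_support[of \<phi>] by blast

text \<open>Instead of differentiating under the integral, Fubini exposes the kernel against the
  test function, where \<open>GB_gradient\<close> applies; a second use of Fubini returns to the
  convolution.\<close>

theorem R0_weak_gradient:
  assumes k: "\<kappa> > 0" and f: "integrable lborel f"
  shows "has_weak_gradient (R0 \<kappa> f) (\<lambda>x. \<chi> j. LINT y|lborel. DGB \<kappa> j (x - y) * f y)"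
  unfolding has_weak_gradient_def
proof (intro conjI allI impI)
  note c1 = conv_integrable[OF GB_measurable(1) GB_bounds(1)[OF k] f]
  note c2 = conv_integrable[OF GB_measurable(2) DGB_bounds(1)[OF k] f]
  show "locally_integrable (R0 \<kappa> f)"
    unfolding R0_eq_GB[abs_def] by (rule locally_integrable_bounded[OF c1(3) c1(2)])
  show "locally_integrable (\<lambda>x. (\<chi> j. LINT y|lborel. DGB \<kappa> j (x - y) * f y) $ j)" for j
    by simp (rule locally_integrable_bounded[OF c2(3) c2(2)])
  fix \<phi> j assume \<phi>: "test_function \<phi>"
  have \<phi>': "test_function (partial j \<phi>)" "dirder (axis j 1) \<phi> (partial j \<phi>)" using test_function_partial[OF \<phi>] by auto
  obtain R where R: "\<And>x. norm x > R \<Longrightarrow> \<phi> x = 0" using test_function_support[OF \<phi>] by blast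
  have "(LINT x|lborel. R0 \<kappa> f x * partial j \<phi> x) = (LINT y|lborel. f y * (LINT x|lborel. GB \<kappa> (x - y) * partial j \<phi> x))"
    unfolding R0_eq_GB by (rule conv_Fubini[OF _ GB_bounds(1)[OF k] f test_function_integrable[OF \<phi>'(1)]]) measurable
  also have "\<dots> = - (LINT y|lborel. f y * (LINT x|lborel. DGB \<kappa> j (x - y) * \<phi> x))"
    by (simp add: GB_gradient[OF k \<phi>'(2) R])
  also have "\<dots> = - (LINT x|lborel. (LINT y|lborel. DGB \<kappa> j (x - y) * f y) * \<phi> x)"
    by (subst conv_Fubini[OF _ DGB_bounds(1)[OF k] f test_function_integrable[OF \<phi>]]) (rule GB_measurable, simp)
  finally show "(LINT x|lborel. R0 \<kappa> f x * partial j \<phi> x) = - (LINT x|lborel. (\<chi> j. LINT y|lborel. DGB \<kappa> j (x - y) * f y) $ j * \<phi> x)"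
    by simp
qed

theorem R0_fundamental:
  assumes k: "\<kappa> > 0" and f: "integrable lborel f" and \<phi>: "test_function \<phi>"
  shows "(LINT x|lborel. R0 \<kappa> f x * (laplacian (laplacian \<phi>) x - of_real (\<kappa>^4) * \<phi> x)) = (LINT x|lborel. f x * \<phi> x)"
proof -
  have i: "integrable lborel (\<lambda>x. laplacian (laplacian \<phi>) x - of_real (\<kappa>^4) * \<phi> x)"
    using \<phi> by (intro Bochner_Integration.integrable_diff integrable_mult_right test_function_integrable test_function_laplacian)
  show ?thesis
    unfolding R0_eq_GB
    by (subst conv_Fubini[OF _ GB_bounds(1)[OF k] f i]) (rule GB_measurable, simp only: GB_fundamental[OF k \<phi>])
qed

section \<open>Plane waves against the Helmholtz kernel\<close>

lemma plane_wave_norm [simp]: "norm (plane_wave \<kappa> \<theta> x) = 1"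
  unfolding plane_wave_def by (rule norm_exp_i_times)

lemma plane_wave_add: "plane_wave \<kappa> \<theta> (x + y) = plane_wave \<kappa> \<theta> x * plane_wave \<kappa> \<theta> y"
  by (simp add: plane_wave_def inner_add_left distrib_left exp_add)

lemma plane_wave_continuous [continuous_intros]: "continuous_on S (plane_wave \<kappa> \<theta>)"
  unfolding plane_wave_def[abs_def] by (intro continuous_intros)

lemma plane_wave_measurable [measurable]: "plane_wave \<kappa> \<theta> \<in> borel_measurable borel"
  by (intro borel_measurable_continuous_onI continuous_intros)

lemma dirder_plane_wave:
  "dirder (axis j 1) (plane_wave \<kappa> \<theta>) (\<lambda>x. \<i> * of_real (\<kappa> * \<theta> $ j) * plane_wave \<kappa> \<theta> x)"
proof -
  have "((\<lambda>t. plane_wave \<kappa> \<theta> (x + t *\<^sub>R axis j 1)) has_vector_derivative \<i> * of_real (\<kappa> * \<theta> $ j) * plane_wave \<kappa> \<theta> x) (at 0)" for x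
  proof -
    have "plane_wave \<kappa> \<theta> (x + t *\<^sub>R axis j 1) = plane_wave \<kappa> \<theta> x * exp (\<i> * (of_real (\<kappa> * \<theta> $ j) * of_real t))" for t
      unfolding plane_wave_add by (simp add: plane_wave_def inner_axis inner_commute[of "axis j 1"] mult_ac)
    moreover have "((\<lambda>t. plane_wave \<kappa> \<theta> x * exp (\<i> * (of_real (\<kappa> * \<theta> $ j) * of_real t))) has_vector_derivative \<i> * of_real (\<kappa> * \<theta> $ j) * plane_wave \<kappa> \<theta> x) (at 0)"
      by (rule has_vector_derivative_real_field[where f = "\<lambda>t. plane_wave \<kappa> \<theta> x * exp (\<i> * (of_real (\<kappa> * \<theta> $ j) * t))"])
         (auto intro!: derivative_eq_intros)
    ultimately show ?thesis by simp
  qed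
  then show ?thesis unfolding dirder_def by (auto intro!: continuous_intros)
qed

lemma Ck2_dirder:
  assumes "Ck 2 b"
  shows "dirder (axis j 1) b (partial j b)" "dirder (axis j 1) (partial j b) (partial j (partial j b))"
    "b differentiable_on UNIV"
proof -
  have 2: "Ck (Suc (Suc 0)) b" using assms by (simp only: numeral_2_eq_2)
  show "dirder (axis j 1) b (partial j b)" by (rule dirder_partial[OF 2])
  show "dirder (axis j 1) (partial j b) (partial j (partial j b))"
    by (rule dirder_partial[OF dirder_partial(2)[OF 2]])
  show "b differentiable_on UNIV" using 2 by simp
qed

lemma sum_sq_sphere: "norm (\<theta> :: real^3) = 1 \<Longrightarrow> (\<Sum>j\<in>UNIV. (complex_of_real (\<theta> $ j))\<^sup>2) = 1"
proof -
  assume "norm \<theta> = 1"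
  then have "(\<Sum>j\<in>UNIV. (\<theta> $ j)\<^sup>2) = 1"
    unfolding norm_vec_def L2_set_def by simp
  then show ?thesis by (metis (mono_tags, lifting) of_real_1 of_real_power of_real_sum sum.cong)
qed

definition dirpart :: "real^3 \<Rightarrow> (real^3 \<Rightarrow> complex) \<Rightarrow> real^3 \<Rightarrow> complex" where
  "dirpart \<theta> b y = (\<Sum>j\<in>UNIV. of_real (\<theta> $ j) * partial j b y)"

text \<open>This is \<open>Phi_fundamental\<close> for the product of the plane wave with a
  translate of \<open>b\<close>. The terms of order \<kappa>^2 cancel because \<theta> is a unit
  vector, so the potential of the wave times \<open>dirpart \<theta> b\<close> is of order
  1/\<kappa>.\<close>

lemma wave_identity:
  assumes k: "\<kappa> \<ge> 0" and th: "norm \<theta> = 1" and b: "Ck 2 b" and supp: "\<And>y. norm y > R \<Longrightarrow> b y = 0"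
  shows "(LINT y|lborel. Phi \<kappa> (y - x) * (plane_wave \<kappa> \<theta> y * laplacian b (y - c)))
      + 2 * \<i> * \<kappa> * (LINT y|lborel. Phi \<kappa> (y - x) * (plane_wave \<kappa> \<theta> y * dirpart \<theta> b (y - c)))
      = - 4 * pi * (plane_wave \<kappa> \<theta> x * b (x - c))"
proof -
  let ?e = "plane_wave \<kappa> \<theta>"
  note b1 = Ck2_dirder(1)[OF b] and b2 = Ck2_dirder(2)[OF b]
  let ?b1 = "\<lambda>j. partial j b" and ?b2 = "\<lambda>j. partial j (partial j b)"
  let ?k = "\<lambda>j. \<i> * complex_of_real (\<kappa> * \<theta> $ j)"
  let ?p1 = "\<lambda>j y. ?e y * ?b1 j (y - c) + ?k j * ?e y * b (y - c)"
  let ?p2 = "\<lambda>j y. (?e y * ?b2 j (y - c) + ?k j * ?e y * ?b1 j (y - c)) + ?k j * ?p1 j y"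
  have d1: "dirder (axis j 1) (\<lambda>y. ?e y * b (y - c)) (?p1 j)" for j
    by (rule dirder_mult[OF dirder_plane_wave dirder_translate[OF b1]])
  have d2: "dirder (axis j 1) (?p1 j) (?p2 j)" for j
  proof -
    have "dirder (axis j 1) (\<lambda>y. ?e y * ?b1 j (y - c) + ?k j * (?e y * b (y - c))) (?p2 j)"
      by (intro dirder_add dirder_cmult d1 dirder_mult[OF dirder_plane_wave dirder_translate[OF b2]])
    then show ?thesis by (simp only: mult.assoc)
  qed
  have s: "norm y > \<bar>R\<bar> + norm c \<Longrightarrow> ?e y * b (y - c) = 0" for y
    using supp[of "y - c"] norm_triangle_sub[of y c] by simp
  have s1: "norm y > R \<Longrightarrow> ?b1 j y = 0" for y j by (rule dirder_support[OF b1 supp])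
  have s2: "norm y > R \<Longrightarrow> ?b2 j y = 0" for y j by (rule dirder_support[OF b2 s1])
  have sc: "norm (y - c) > R" if "norm y > \<bar>R\<bar> + norm c" for y
    using that norm_triangle_sub[of y c] by simp
  have c1: "continuous_on UNIV (\<lambda>y. ?b1 j (y - c))" "continuous_on UNIV (\<lambda>y. ?b2 j (y - c))" for j
    using dirder_translate[OF b2[of j], of c] by (auto simp: dirder_def)
  have sum: "(\<Sum>j\<in>UNIV. ?p2 j y) + (complex_of_real \<kappa>)\<^sup>2 * (?e y * b (y - c))
     = ?e y * laplacian b (y - c) + 2 * \<i> * \<kappa> * (?e y * dirpart \<theta> b (y - c))" for y
  proof -
    have "(\<Sum>j\<in>UNIV. ?p2 j y) = (\<Sum>j\<in>UNIV. ?e y * ?b2 j (y - c) + 2 * \<i> * \<kappa> * (?e y * (of_real (\<theta> $ j) * ?b1 j (y - c)))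
        - (complex_of_real \<kappa>)\<^sup>2 * (?e y * b (y - c)) * (complex_of_real (\<theta> $ j))\<^sup>2)"
      by (intro sum.cong refl) (simp add: algebra_simps power2_eq_square)
    also have "\<dots> = ?e y * laplacian b (y - c) + 2 * \<i> * \<kappa> * (?e y * dirpart \<theta> b (y - c))
        - (complex_of_real \<kappa>)\<^sup>2 * (?e y * b (y - c)) * (\<Sum>j\<in>UNIV. (complex_of_real (\<theta> $ j))\<^sup>2)"
      unfolding laplacian_def dirpart_def sum_distrib_left sum_subtractf sum.distrib ..
    finally show ?thesis unfolding sum_sq_sphere[OF th] by simp
  qed
  have "(LINT y|lborel. Phi \<kappa> (y - x) * ((\<Sum>j\<in>UNIV. ?p2 j y) + (complex_of_real \<kappa>)\<^sup>2 * (?e y * b (y - c)))) = - 4 * pi * (?e x * b (x - c))"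
    by (rule Phi_fundamental[OF Im_wavenumber(1)[OF k] d1 d2 s])
  moreover have "(LINT y|lborel. Phi \<kappa> (y - x) * ((\<Sum>j\<in>UNIV. ?p2 j y) + (complex_of_real \<kappa>)\<^sup>2 * (?e y * b (y - c))))
    = (LINT y|lborel. Phi \<kappa> (y - x) * (?e y * laplacian b (y - c))) + (LINT y|lborel. 2 * \<i> * \<kappa> * (Phi \<kappa> (y - x) * (?e y * dirpart \<theta> b (y - c))))"
  proof -
    have i1: "integrable lborel (\<lambda>y. Phi \<kappa> (y - x) * (?e y * laplacian b (y - c)))"
      by (rule Phi_integrable(1)[OF Im_wavenumber(1)[OF k], of _ "\<bar>R\<bar> + norm c"])
         (auto simp: laplacian_def s2[OF sc] intro!: continuous_intros c1)
    have i2: "integrable lborel (\<lambda>y. Phi \<kappa> (y - x) * (?e y * dirpart \<theta> b (y - c)))"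
      by (rule Phi_integrable(1)[OF Im_wavenumber(1)[OF k], of _ "\<bar>R\<bar> + norm c"])
         (auto simp: dirpart_def s1[OF sc] intro!: continuous_intros c1)
    show ?thesis unfolding sum
      by (subst Bochner_Integration.integral_add[OF i1 integrable_mult_right[OF i2], symmetric])
         (simp add: distrib_left mult.left_commute)
  qed
  ultimately show ?thesis by simp
qed

section \<open>Oscillatory integrals in the direction of propagation\<close>

lemma integrable_indicator_Icc [simp]: "integrable lborel (indicator {a..b::real} :: real \<Rightarrow> real)"
  by (simp add: integrable_indicator_iff emeasure_lborel_Icc_eq)

lemma interval_Fubini:
  fixes H :: "real \<Rightarrow> real^3 \<Rightarrow> complex"
  assumes [measurable]: "case_prod H \<in> borel_measurable (borel \<Otimes>\<^sub>M borel)"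
    and H: "\<And>t y. t \<in> {a..b} \<Longrightarrow> norm (H t y) \<le> w y" and w: "integrable lborel w" and ab: "a \<le> b"
  shows "(LINT t|lborel. indicator {a..b} t *\<^sub>R (LINT y|lborel. H t y)) = (LINT y|lborel. LINT t|lborel. indicator {a..b} t *\<^sub>R H t y)"
    and "integrable lborel (\<lambda>t. indicator {a..b} t *\<^sub>R (LINT y|lborel. H t y))"
proof -
  have [measurable]: "w \<in> borel_measurable borel" using w borel_measurable_integrable by auto
  have wn: "w y \<ge> 0" for y using order_trans[OF norm_ge_zero H[of a y]] ab by simp
  have 1: "integrable (lborel \<Otimes>\<^sub>M lborel) (\<lambda>(t, y). indicator {a..b} (t::real) * w y)"
    by (rule lborel_pair.Fubini_integrable) (use w wn in \<open>auto simp: abs_mult\<close>)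
  have 2: "integrable (lborel \<Otimes>\<^sub>M lborel) (\<lambda>(t, y). indicator {a..b} t *\<^sub>R H t y)"
    by (rule Bochner_Integration.integrable_bound[OF 1]) (use H wn in \<open>auto simp: indicator_def\<close>)
  show "(LINT t|lborel. indicator {a..b} t *\<^sub>R (LINT y|lborel. H t y)) = (LINT y|lborel. LINT t|lborel. indicator {a..b} t *\<^sub>R H t y)"
    using lborel_pair.Fubini_integral[OF 2] by simp
  show "integrable lborel (\<lambda>t. indicator {a..b} t *\<^sub>R (LINT y|lborel. H t y))"
    using lborel_pair.integrable_fst[OF 2] by simp
qed

lemma norm_interval_integral_le:
  fixes f :: "real \<Rightarrow> complex"
  assumes "integrable lborel (\<lambda>t. indicator {a..b} t *\<^sub>R f t)" and "\<And>t. t \<in> {a..b} \<Longrightarrow> norm (f t) \<le> C" and "a \<le> b"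
  shows "norm (LINT t|lborel. indicator {a..b} t *\<^sub>R f t) \<le> C * (b - a)"
proof -
  have "norm (LINT t|lborel. indicator {a..b} t *\<^sub>R f t) \<le> (LINT t|lborel. norm (indicator {a..b} t *\<^sub>R f t))"
    by (rule integral_norm_bound)
  also have "\<dots> \<le> (LINT t|lborel. C * indicator {a..b} t)"
  proof (rule integral_mono)
    show "integrable lborel (\<lambda>t. norm (indicator {a..b} t *\<^sub>R f t))" by (rule integrable_norm[OF assms(1)])
    show "integrable lborel (\<lambda>t. C * indicator {a..b} t)" by simp
  qed (use assms(2) in \<open>auto simp: indicator_def\<close>)
  also have "\<dots> = C * (b - a)" using assms(3) by simp
  finally show ?thesis .
qed

text \<open>Along a line in direction \<open>\<theta>\<close>, with \<open>r\<close> the distance to the origin and \<open>w = t + p \<bullet> \<theta> + r\<close>,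
  one has \<open>w' = w / r\<close>, which makes \<open>exp (\<i> \<kappa> (t + r)) / (\<i> \<kappa> w)\<close> an approximate primitive.\<close>

lemma line_integral_bound:
  fixes p \<theta> :: "real^3"
  assumes k: "\<kappa> > 0" and th: "norm \<theta> = 1" and p: "norm p + 1 \<le> L"
  shows "norm (LINT t|lborel. indicator {L..L+1} t *\<^sub>R (Phi \<kappa> (p + t *\<^sub>R \<theta>) * exp (\<i> * \<kappa> * t))) \<le> 3 / \<kappa>"
proof -
  define r where "r = (\<lambda>t. norm (p + t *\<^sub>R \<theta>))"
  define w where "w = (\<lambda>t. t + p \<bullet> \<theta> + r t)"
  define X where "X = (\<lambda>t. exp (\<i> * \<kappa> * complex_of_real (t + r t)))"
  have nX: "norm (X t) = 1" for t
    using norm_exp_i_times[of "\<kappa> * (t + r t)"] by (simp add: X_def mult.assoc)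
  have thth: "\<theta> \<bullet> \<theta> = 1" using th by (simp add: norm_eq_1)
  \<comment> \<open>The gap of 1 between |p| and L keeps r, and then w, at least 1 on the whole
    range, so the line stays clear of the pole and of the zeros of w.\<close>
  have r1: "r t \<ge> 1" if "t \<ge> L" for t
  proof -
    have "norm (t *\<^sub>R \<theta>) \<le> norm (p + t *\<^sub>R \<theta>) + norm p"
      by (metis add_diff_cancel_left' norm_triangle_ineq4)
    moreover have "t \<ge> 0" using that p norm_ge_zero[of p] by linarith
    then have "norm (t *\<^sub>R \<theta>) = t" using th by simp
    ultimately show ?thesis using that p by (simp add: r_def)
  qed
  have w1: "w t \<ge> 1" if "t \<ge> L" for t
  proof -
    have "\<bar>p \<bullet> \<theta>\<bar> \<le> norm p" using Cauchy_Schwarz_ineq2[of p \<theta>] th by simp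
    then show ?thesis using that p r1[OF that] by (simp add: w_def)
  qed
  have r': "(r has_real_derivative (t + p \<bullet> \<theta>) / r t) (at t)" if "t \<ge> L" for t
  proof -
    have sq: "r = (\<lambda>t. sqrt (p \<bullet> p + 2 * t * (p \<bullet> \<theta>) + t\<^sup>2))"
      unfolding r_def norm_eq_sqrt_inner
      by (simp add: fun_eq_iff inner_add_left inner_add_right thth inner_commute[of \<theta> p] power2_eq_square algebra_simps)
    have "p \<bullet> p + 2 * t * (p \<bullet> \<theta>) + t\<^sup>2 > 0"
      using r1[OF that] unfolding sq by (smt (verit) real_sqrt_le_0_iff)
    then show ?thesis unfolding sq by (auto intro!: derivative_eq_intros simp: field_simps)
  qed
  have w': "(w has_real_derivative w t / r t) (at t)" if "t \<ge> L" for t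
    unfolding w_def[abs_def] using r1[OF that] by (auto intro!: derivative_eq_intros r'[OF that] simp: w_def field_simps)
  have rc: "continuous_on {L..} r" "continuous_on {L..} w"
    using r' w' by (auto intro!: continuous_at_imp_continuous_on DERIV_isCont)
  have Xc: "continuous_on {L..} X"
    unfolding X_def by (intro continuous_intros rc)
  have rw0: "r t \<noteq> 0" "w t \<noteq> 0" if "t \<ge> L" for t using r1[OF that] w1[OF that] by auto
  \<comment> \<open>\<open>?f\<close> is the integrand and \<open>?La\<close> the approximate
    primitive. Its derivative is \<open>?f - ?g\<close>, where \<open>?g\<close> comes from
    differentiating 1/w and already has size 1/\<kappa>.\<close>
  let ?f = "\<lambda>t. X t / r t" and ?g = "\<lambda>t. X t / (\<i> * \<kappa> * (r t * w t))"
  let ?La = "\<lambda>t. X t / (\<i> * \<kappa> * w t)"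
  have cf: "continuous_on {L..L+1} ?f" and cg: "continuous_on {L..L+1} ?g"
    using rw0 k by (auto intro!: continuous_intros continuous_on_subset[OF rc(1)] continuous_on_subset[OF rc(2)] continuous_on_subset[OF Xc])
  have La: "(?La has_vector_derivative ?f t - ?g t) (at t)" if t: "t \<ge> L" for t
  proof -
    have "(t + p \<bullet> \<theta>) / r t + 1 = w t / r t" using rw0[OF t] by (simp add: w_def field_simps)
    then have "((\<lambda>t. t + r t) has_real_derivative w t / r t) (at t)"
      by (auto intro!: derivative_eq_intros r'[OF t])
    then have "((\<lambda>t. complex_of_real (t + r t)) has_vector_derivative complex_of_real (w t / r t)) (at t)"
      by (intro has_vector_derivative_of_real)
    then have 1: "(X has_vector_derivative complex_of_real (w t / r t) * (\<i> * \<kappa> * X t)) (at t)"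
      unfolding X_def
      by (intro field_vector_diff_chain_at[where g = "\<lambda>z. exp (\<i> * \<kappa> * z)", unfolded o_def])
         (auto intro!: derivative_eq_intros)
    have "((\<lambda>t. complex_of_real (w t)) has_vector_derivative complex_of_real (w t / r t)) (at t)"
      using w'[OF t] by (intro has_vector_derivative_of_real)
    then have 2: "((\<lambda>t. inverse (complex_of_real (w t))) has_vector_derivative complex_of_real (w t / r t) * (- inverse ((complex_of_real (w t))\<^sup>2))) (at t)"
      by (intro field_vector_diff_chain_at[where g = inverse, unfolded o_def])
         (use rw0[OF t] in \<open>auto intro!: derivative_eq_intros simp: power2_eq_square\<close>)
    have "((\<lambda>t. (X t * inverse (complex_of_real (w t))) * (1 / (\<i> * \<kappa>))) has_vector_derivative
       (X t * (complex_of_real (w t / r t) * (- inverse ((complex_of_real (w t))\<^sup>2))) + complex_of_real (w t / r t) * (\<i> * \<kappa> * X t) * inverse (complex_of_real (w t))) * (1 / (\<i> * \<kappa>))) (at t)"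
      by (intro has_vector_derivative_mult_left has_vector_derivative_mult 1 2)
    moreover have "(X t * (complex_of_real (w t / r t) * (- inverse ((complex_of_real (w t))\<^sup>2))) + complex_of_real (w t / r t) * (\<i> * \<kappa> * X t) * inverse (complex_of_real (w t))) * (1 / (\<i> * \<kappa>)) = ?f t - ?g t"
      using rw0[OF t] k by (simp add: field_simps power2_eq_square)
    moreover have "(\<lambda>t. (X t * inverse (complex_of_real (w t))) * (1 / (\<i> * \<kappa>))) = ?La"
      by (simp add: fun_eq_iff field_simps)
    ultimately show ?thesis by simp
  qed
  have ftc: "(LINT t|lborel. indicator {L..L+1} t *\<^sub>R (?f t - ?g t)) = ?La (L + 1) - ?La L"
    by (rule integral_FTC_Icc, simp, rule has_vector_derivative_at_within, rule La, assumption, intro continuous_on_diff cf cg)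
  have int: "integrable lborel (\<lambda>t. indicator {L..L+1} t *\<^sub>R ?f t)" "integrable lborel (\<lambda>t. indicator {L..L+1} t *\<^sub>R ?g t)"
    using borel_integrable_compact[OF compact_Icc cf] borel_integrable_compact[OF compact_Icc cg] .
  have split: "(LINT t|lborel. indicator {L..L+1} t *\<^sub>R ?f t) = (?La (L + 1) - ?La L) + (LINT t|lborel. indicator {L..L+1} t *\<^sub>R ?g t)"
    unfolding ftc[symmetric] scaleR_diff_right by (subst Bochner_Integration.integral_diff[OF int]) simp
  have La_le: "norm (?La t) \<le> 1 / \<kappa>" if "t \<ge> L" for t
  proof -
    have "norm (?La t) = 1 / (\<kappa> * w t)"
      using k w1[OF that] nX[of t] by (simp add: norm_divide norm_mult)
    also have "\<dots> \<le> 1 / (\<kappa> * 1)"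
      using k w1[OF that] by (intro divide_left_mono mult_left_mono) auto
    finally show ?thesis by simp
  qed
  have g_le: "norm (LINT t|lborel. indicator {L..L+1} t *\<^sub>R ?g t) \<le> 1 / \<kappa> * (L + 1 - L)"
  proof (rule norm_interval_integral_le[OF int(2)])
    fix t assume "t \<in> {L..L+1}"
    then have t: "t \<ge> L" by simp
    have "1 * 1 \<le> r t * w t" using r1[OF t] w1[OF t] by (intro mult_mono) auto
    have "norm (?g t) = 1 / (\<kappa> * (r t * w t))"
      using k w1[OF t] r1[OF t] nX[of t] by (simp add: norm_divide norm_mult)
    also have "\<dots> \<le> 1 / (\<kappa> * 1)"
      using k \<open>1 * 1 \<le> r t * w t\<close> by (intro divide_left_mono mult_left_mono) auto
    finally show "norm (?g t) \<le> 1 / \<kappa>" by simp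
  qed simp
  \<comment> \<open>Two boundary values of the primitive and the integral of \<open>?g\<close>, each
    at most 1/\<kappa>, give the constant 3.\<close>
  have "norm (LINT t|lborel. indicator {L..L+1} t *\<^sub>R ?f t) \<le> (1 / \<kappa> + 1 / \<kappa>) + 1 / \<kappa> * (L + 1 - L)"
    unfolding split by (intro norm_triangle_mono norm_triangle_le_diff add_mono La_le g_le) auto
  moreover have "Phi \<kappa> (p + t *\<^sub>R \<theta>) * exp (\<i> * \<kappa> * t) = ?f t" for t
    by (simp add: Phi_def X_def r_def distrib_left exp_add mult_ac)
  ultimately show ?thesis by simp
qed

lemma norm_Phi_le': "Im k \<ge> 0 \<Longrightarrow> norm (Phi k z) \<le> sing z"
  using norm_Phi_le[of k z] sing_ge1[of z] by (cases "z = 0") (auto simp: Phi_def)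

lemma uniform_bound:
  fixes f :: "'i::finite \<Rightarrow> 'a::euclidean_space \<Rightarrow> 'b::real_normed_vector"
  assumes "\<And>i. continuous_on UNIV (f i)" "\<And>i x. norm x > R \<Longrightarrow> f i x = 0"
  shows "\<exists>M\<ge>0. \<forall>i x. norm (f i x) \<le> M"
proof -
  have "\<forall>i. \<exists>M\<ge>0. \<forall>x. norm (f i x) \<le> M"
    using bounded_of_compact_support assms by blast
  then obtain M where M: "\<And>i. M i \<ge> 0" "\<And>i x. norm (f i x) \<le> M i" by metis
  have "norm (f i x) \<le> (\<Sum>i\<in>UNIV. M i)" for i x
    by (rule order_trans[OF M(2) member_le_sum[where f = M]]) (auto simp: M)
  then show ?thesis using M by (intro exI[of _ "\<Sum>i\<in>UNIV. M i"]) (auto intro: sum_nonneg)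
qed

lemma component_le_one: "norm (\<theta> :: real^3) = 1 \<Longrightarrow> \<bar>\<theta> $ j\<bar> \<le> 1"
  using component_le_norm_cart[of \<theta> j] by simp

text \<open>
  \<open>S t\<close> is the potential of \<open>b\<close> translated by \<open>t \<theta>\<close>, and \<open>- E t\<close> its derivative. The bound on \<open>E\<close> compares
  \<open>S 0\<close> with the mean of \<open>S\<close> over \<open>{L..L+1}\<close>, to which the line integral estimate applies.
\<close>

lemma Phi_wave_bound:
  assumes b: "Ck 2 b" and supp: "\<And>y. norm y > R \<Longrightarrow> b y = 0" and R: "R > 0"
  shows "\<exists>C\<ge>0. \<forall>\<kappa> \<theta> x. \<kappa> \<ge> 1 \<longrightarrow> norm \<theta> = 1 \<longrightarrow> norm x \<le> R \<longrightarrow>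
     norm (LINT y|lborel. Phi (of_real \<kappa>) (y - x) * (plane_wave \<kappa> \<theta> y * b y)) \<le> C / \<kappa>"
proof -
  \<comment> \<open>For x and y in the ball of radius R, the vector y - x satisfies the requirement
    of \<open>line_integral_bound\<close> with this L.\<close>
  define L where "L = 2 * R + 1"
  \<comment> \<open>A ball containing the support of every translate of b by t \<theta> with t up to
    L + 1.\<close>
  define Q where "Q = R + (L + 1)"
  note b1 = Ck2_dirder(1)[OF b] and b2 = Ck2_dirder(2)[OF b]
  have s1: "norm y > R \<Longrightarrow> partial j b y = 0" for y j by (rule dirder_support[OF b1 supp])
  have s2: "norm y > R \<Longrightarrow> partial j (partial j b) y = 0" for y j by (rule dirder_support[OF b2 s1])
  have cb: "continuous_on UNIV b" using b1 by (auto simp: dirder_def)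
  have cb1: "continuous_on UNIV (partial j b)" for j using b2 by (auto simp: dirder_def)
  have cb2: "continuous_on UNIV (laplacian b)" 
    unfolding laplacian_def[abs_def] using b2 by (auto simp: dirder_def intro!: continuous_intros)
  have sl: "norm y > R \<Longrightarrow> laplacian b y = 0" for y by (simp add: laplacian_def s2)
  have cd: "continuous_on UNIV (dirpart \<theta> b)" for \<theta>
    unfolding dirpart_def[abs_def] by (intro continuous_intros cb1)
  have sd: "norm y > R \<Longrightarrow> dirpart \<theta> b y = 0" for y \<theta> by (simp add: dirpart_def s1)
  have [measurable]: "b \<in> borel_measurable borel" "laplacian b \<in> borel_measurable borel" "dirpart \<theta> b \<in> borel_measurable borel" for \<theta>
    using cb cb2 cd by (auto intro: borel_measurable_continuous_onI)
  obtain M0 where M0: "M0 \<ge> 0" "\<And>y. norm (b y) \<le> M0" using bounded_of_compact_support[of b R] cb supp by auto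
  obtain M2 where M2: "M2 \<ge> 0" "\<And>y. norm (laplacian b y) \<le> M2" using bounded_of_compact_support[of "laplacian b" R] cb2 sl by auto
  obtain M1 where M1: "M1 \<ge> 0" "\<And>j y. norm (partial j b y) \<le> M1" using uniform_bound[of "\<lambda>j. partial j b" R] cb1 s1 by blast
  have Md: "norm (dirpart \<theta> b y) \<le> 3 * M1" if "norm \<theta> = 1" for \<theta> y
  proof -
    have "norm (dirpart \<theta> b y) \<le> (\<Sum>j\<in>(UNIV::3 set). 1 * M1)"
      unfolding dirpart_def
      by (intro sum_norm_le) (auto simp: norm_mult intro!: mult_mono[of _ 1 _ M1, simplified] M1 component_le_one[OF that])
    then show ?thesis by simp
  qed
  \<comment> \<open>Obtained by solving \<open>wave_identity\<close> for the term with factor 2 \<i>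
    \<kappa>.\<close>
  define C1 where "C1 = (4 * pi * M0 + M2 * sing_bound Q) / 2"
  have C1: "C1 \<ge> 0" using M0 M2 sing_bound_pos[of Q] by (simp add: C1_def)
  \<comment> \<open>The first term pays for the translation by at most L + 1, the second for the
    averaged potential far downstream.\<close>
  define C where "C = C1 * (L + 1) + 3 * M0 * measure lborel (cball (0::real^3) R)"
  have main: "norm (LINT y|lborel. Phi (of_real \<kappa>) (y - x) * (plane_wave \<kappa> \<theta> y * b y)) \<le> C / \<kappa>"
    if k: "\<kappa> \<ge> 1" and th: "norm \<theta> = 1" and x: "norm x \<le> R" for \<kappa> \<theta> x
  proof -
    have k0: "\<kappa> \<ge> 0" "\<kappa> > 0" using k by auto
    let ?e = "plane_wave \<kappa> \<theta>"
    have far: "norm (y - t *\<^sub>R \<theta>) > R" if "norm y > Q" "t \<in> {0..L+1}" for y t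
      using that norm_triangle_sub[of y "t *\<^sub>R \<theta>"] th by (simp add: Q_def)
    define E where "E = (\<lambda>t. LINT y|lborel. Phi (of_real \<kappa>) (y - x) * (?e y * dirpart \<theta> b (y - t *\<^sub>R \<theta>)))"
    define S where "S = (\<lambda>t. LINT y|lborel. Phi (of_real \<kappa>) (y - x) * (?e y * b (y - t *\<^sub>R \<theta>)))"
    have E: "norm (E t) \<le> C1 / \<kappa>" if t: "t \<in> {0..L+1}" for t
    proof -
      have "norm (LINT y|lborel. Phi (of_real \<kappa>) (y - x) * (?e y * laplacian b (y - t *\<^sub>R \<theta>))) \<le> 1 * M2 * sing_bound Q"
        by (rule kernel_integrable(2)) (use norm_Phi_le'[OF Im_wavenumber(1)[OF k0(1)]] M2 sl[OF far[OF _ t]] in \<open>auto simp: norm_mult\<close>)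
      moreover have "norm (- 4 * pi * (?e x * b (x - t *\<^sub>R \<theta>))) \<le> 4 * pi * M0"
        using M0 by (simp add: norm_mult)
      moreover have "2 * \<i> * \<kappa> * E t = - 4 * pi * (?e x * b (x - t *\<^sub>R \<theta>)) - (LINT y|lborel. Phi (of_real \<kappa>) (y - x) * (?e y * laplacian b (y - t *\<^sub>R \<theta>)))"
      proof -
        have "(LINT y|lborel. Phi (of_real \<kappa>) (y - x) * (?e y * laplacian b (y - t *\<^sub>R \<theta>))) + 2 * \<i> * \<kappa> * E t
            = - 4 * pi * (?e x * b (x - t *\<^sub>R \<theta>))"
          unfolding E_def by (rule wave_identity[OF k0(1) th b supp])
        then show ?thesis by (simp add: algebra_simps)
      qed
      ultimately have "norm (2 * \<i> * \<kappa> * E t) \<le> 4 * pi * M0 + M2 * sing_bound Q"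
        by (metis (no_types, lifting) add_mono mult_1 norm_triangle_le_diff)
      then have "2 * \<kappa> * norm (E t) \<le> 4 * pi * M0 + M2 * sing_bound Q"
        using k0 by (simp add: norm_mult)
      then show ?thesis using k0 by (simp add: C1_def field_simps)
    qed
    have D: "norm (S 0 - S \<tau>) \<le> C1 / \<kappa> * (L + 1)" if \<tau>: "\<tau> \<in> {0..L+1}" for \<tau>
    proof -
      let ?H = "\<lambda>t y. Phi (of_real \<kappa>) (y - x) * (?e y * dirpart \<theta> b (y - t *\<^sub>R \<theta>))"
      let ?w = "\<lambda>y. 3 * M1 * (indicator (cball 0 Q) y * sing (x - y))"
      have w: "integrable lborel ?w" by (intro integrable_mult_right sing_integral_cball)
      have H: "norm (?H t y) \<le> ?w y" if "t \<in> {0..\<tau>}" for t y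
      proof (cases "norm y > Q")
        case True
        then have "dirpart \<theta> b (y - t *\<^sub>R \<theta>) = 0" using that \<tau> by (intro sd far) auto
        then show ?thesis using M1 sing_ge1[of "x - y"] by simp
      next
        case False
        have "norm (?H t y) \<le> sing (y - x) * (1 * (3 * M1))"
          unfolding norm_mult using M1 sing_ge1[of "y - x"]
          by (intro mult_mono norm_Phi_le' Im_wavenumber k0 Md th) auto
        then show ?thesis using False by (simp add: sing_minus[of y x] mult_ac)
      qed
      have Hm: "case_prod ?H \<in> borel_measurable (borel \<Otimes>\<^sub>M borel)" by measurable
      have inner: "(LINT t|lborel. indicator {0..\<tau>} t *\<^sub>R ?H t y) = Phi (of_real \<kappa>) (y - x) * (?e y * b (y - 0 *\<^sub>R \<theta>)) - Phi (of_real \<kappa>) (y - x) * (?e y * b (y - \<tau> *\<^sub>R \<theta>))" for y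
      proof -
        have "((\<lambda>t. b (y - t *\<^sub>R \<theta>)) has_vector_derivative - dirpart \<theta> b (y - t *\<^sub>R \<theta>)) (at t)" for t
        proof -
          have bd: "(b has_derivative frechet_derivative b (at (y - t *\<^sub>R \<theta>))) (at (y - t *\<^sub>R \<theta>))"
            using Ck2_dirder(3)[OF b] by (auto simp: differentiable_on_def frechet_derivative_works[symmetric])
          then have lin: "linear (frechet_derivative b (at (y - t *\<^sub>R \<theta>)))" by (rule has_derivative_linear)
          have "((\<lambda>t. y - t *\<^sub>R \<theta>) has_derivative (\<lambda>h. - (h *\<^sub>R \<theta>))) (at t)"
            by (auto intro!: derivative_eq_intros)
          from has_derivative_compose[OF this bd]
          have 1: "((\<lambda>t. b (y - t *\<^sub>R \<theta>)) has_derivative (\<lambda>h. h *\<^sub>R (- frechet_derivative b (at (y - t *\<^sub>R \<theta>)) \<theta>))) (at t)"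
            by (simp add: linear_neg[OF lin] linear_scale[OF lin])
          have "frechet_derivative b (at (y - t *\<^sub>R \<theta>)) \<theta> = frechet_derivative b (at (y - t *\<^sub>R \<theta>)) (\<Sum>j\<in>UNIV. \<theta> $ j *\<^sub>R axis j 1)"
            using basis_expansion[of \<theta>] by (simp add: scalar_mult_eq_scaleR)
          also have "\<dots> = dirpart \<theta> b (y - t *\<^sub>R \<theta>)"
            unfolding linear_sum[OF lin] linear_scale[OF lin] by (simp add: dirpart_def partial_def scaleR_conv_of_real)
          finally show ?thesis using 1 by (simp add: has_vector_derivative_def)
        qed
        then have "((\<lambda>t. - (Phi (of_real \<kappa>) (y - x) * (?e y * b (y - t *\<^sub>R \<theta>)))) has_vector_derivative - (Phi (of_real \<kappa>) (y - x) * (?e y * (- dirpart \<theta> b (y - t *\<^sub>R \<theta>))))) (at t)" for t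
          by (intro has_vector_derivative_minus has_vector_derivative_mult_right)
        then have der: "((\<lambda>t. - (Phi (of_real \<kappa>) (y - x) * (?e y * b (y - t *\<^sub>R \<theta>)))) has_vector_derivative ?H t y) (at t)" for t
          by simp
        have "(LINT t|lborel. indicator {0..\<tau>} t *\<^sub>R ?H t y) = - (Phi (of_real \<kappa>) (y - x) * (?e y * b (y - \<tau> *\<^sub>R \<theta>))) - - (Phi (of_real \<kappa>) (y - x) * (?e y * b (y - 0 *\<^sub>R \<theta>)))"
        proof (rule integral_FTC_Icc)
          show "0 \<le> \<tau>" using \<tau> by simp
          show "((\<lambda>t. - (Phi (of_real \<kappa>) (y - x) * (?e y * b (y - t *\<^sub>R \<theta>)))) has_vector_derivative ?H t y) (at t within {0..\<tau>})" for t
            by (rule has_vector_derivative_at_within[OF der])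
          show "continuous_on {0..\<tau>} (\<lambda>t. ?H t y)"
            by (intro continuous_intros continuous_on_compose2[OF cd]) auto
        qed
        then show ?thesis by simp
      qed
      have int: "integrable lborel (\<lambda>y. Phi (of_real \<kappa>) (y - x) * (?e y * b (y - t *\<^sub>R \<theta>)))" if t: "t \<in> {0..L+1}" for t
        by (rule Phi_integrable(1)[OF Im_wavenumber(1)[OF k0(1)], of _ Q])
           (use supp[OF far[OF _ t]] in \<open>auto intro!: continuous_intros continuous_on_compose2[OF cb]\<close>)
      have "(LINT t|lborel. indicator {0..\<tau>} t *\<^sub>R E t) = S 0 - S \<tau>"
      proof -
        have "(LINT t|lborel. indicator {0..\<tau>} t *\<^sub>R E t) = (LINT y|lborel. LINT t|lborel. indicator {0..\<tau>} t *\<^sub>R ?H t y)"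
          unfolding E_def by (rule interval_Fubini(1)[OF Hm H w]) (use \<tau> in auto)
        also have "\<dots> = S 0 - S \<tau>"
          unfolding inner S_def by (rule Bochner_Integration.integral_diff[OF int int]) (use \<tau> R L_def in auto)
        finally show ?thesis .
      qed
      moreover have "norm (LINT t|lborel. indicator {0..\<tau>} t *\<^sub>R E t) \<le> C1 / \<kappa> * (\<tau> - 0)"
      proof (rule norm_interval_integral_le)
        show "integrable lborel (\<lambda>t. indicator {0..\<tau>} t *\<^sub>R E t)"
          unfolding E_def by (rule interval_Fubini(2)[OF Hm H w]) (use \<tau> in auto)
      qed (use \<tau> E in auto)
      moreover have "C1 / \<kappa> * (\<tau> - 0) \<le> C1 / \<kappa> * (L + 1)"
        using \<tau> C1 k0 by (intro mult_left_mono) auto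
      ultimately show ?thesis by simp
    qed
    \<comment> \<open>After the substitution y to y + t \<theta> the function b stands still and the
      kernel moves; the wave contributes the phase exp(\<i> \<kappa> t) that
      \<open>line_integral_bound\<close> needs.\<close>
    let ?G = "\<lambda>t y. Phi (of_real \<kappa>) ((y - x) + t *\<^sub>R \<theta>) * exp (\<i> * \<kappa> * t) * (?e y * b y)"
    let ?v = "\<lambda>y::real^3. M0 * indicator (cball 0 R) y"
    have v: "integrable lborel (\<lambda>y::real^3. ?v y)" by simp
    have G: "norm (?G t y) \<le> ?v y" if t: "t \<in> {L..L+1}" for t y
    proof (cases "norm y > R")
      case True
      then show ?thesis using supp M0 by simp
    next
      case False
      have "norm (t *\<^sub>R \<theta>) \<le> norm ((y - x) + t *\<^sub>R \<theta>) + norm (y - x)"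
        by (metis add_diff_cancel_left' norm_triangle_ineq4)
      moreover have "norm (y - x) \<le> 2 * R" using norm_triangle_ineq4[of y x] False x by simp
      moreover have "norm (t *\<^sub>R \<theta>) = t" using t th R by (simp add: L_def)
      ultimately have "norm ((y - x) + t *\<^sub>R \<theta>) \<ge> 1" using t by (simp add: L_def)
      then have "norm (Phi (of_real \<kappa>) ((y - x) + t *\<^sub>R \<theta>)) \<le> 1 / 1"
        unfolding Phi_def norm_divide using norm_exp_le_1[OF Im_wavenumber(1)[OF k0(1)], of "norm ((y - x) + t *\<^sub>R \<theta>)"]
        by (intro frac_le) auto
      moreover have "norm (exp (\<i> * complex_of_real \<kappa> * complex_of_real t)) = 1"
        using norm_exp_i_times[of "\<kappa> * t"] by (simp add: mult.assoc)
      ultimately have "norm (?G t y) \<le> 1 * 1 * (1 * M0)"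
        unfolding norm_mult using M0 by (intro mult_mono) auto
      then show ?thesis using False by simp
    qed
    have Gm: "case_prod ?G \<in> borel_measurable (borel \<Otimes>\<^sub>M borel)" by measurable
    have S_eq: "S t = (LINT y|lborel. ?G t y)" for t
    proof -
      have "S t = (LINT y|lborel. Phi (of_real \<kappa>) (t *\<^sub>R \<theta> + y - x) * (?e (t *\<^sub>R \<theta> + y) * b (t *\<^sub>R \<theta> + y - t *\<^sub>R \<theta>)))"
        unfolding S_def by (rule integral_lborel_translate[symmetric]) measurable
      moreover have "?e (t *\<^sub>R \<theta>) = exp (\<i> * \<kappa> * t)"
        using th by (simp add: plane_wave_def norm_eq_1 mult.assoc)
      ultimately show ?thesis
        by (simp add: plane_wave_add algebra_simps)
    qed
    have A: "norm (LINT t|lborel. indicator {L..L+1} t *\<^sub>R S t) \<le> 3 * M0 * measure lborel (cball (0::real^3) R) / \<kappa>"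
    proof -
      have "(LINT t|lborel. indicator {L..L+1} t *\<^sub>R S t) = (LINT y|lborel. LINT t|lborel. indicator {L..L+1} t *\<^sub>R ?G t y)"
        unfolding S_eq by (rule interval_Fubini(1)[OF Gm G v]) auto
      also have "\<dots> = (LINT y|lborel. (?e y * b y) * (LINT t|lborel. indicator {L..L+1} t *\<^sub>R (Phi (of_real \<kappa>) ((y - x) + t *\<^sub>R \<theta>) * exp (\<i> * \<kappa> * t))))"
        by (subst integral_mult_right_zero[symmetric]) (simp add: mult_ac)
      also have "norm \<dots> \<le> (LINT y|lborel. norm ((?e y * b y) * (LINT t|lborel. indicator {L..L+1} t *\<^sub>R (Phi (of_real \<kappa>) ((y - x) + t *\<^sub>R \<theta>) * exp (\<i> * \<kappa> * t)))))"
        by (rule integral_norm_bound)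
      also have "\<dots> \<le> (LINT y|lborel. 3 / \<kappa> * ?v y)"
      proof (rule Bochner_Integration.integral_mono')
        show "integrable lborel (\<lambda>y::real^3. 3 / \<kappa> * ?v y)" by simp
        fix y :: "real^3"
        show "norm ((?e y * b y) * (LINT t|lborel. indicator {L..L+1} t *\<^sub>R (Phi (of_real \<kappa>) ((y - x) + t *\<^sub>R \<theta>) * exp (\<i> * \<kappa> * t)))) \<le> 3 / \<kappa> * ?v y"
        proof (cases "norm y > R")
          case False
          have "norm (y - x) + 1 \<le> L" using norm_triangle_ineq4[of y x] False x by (simp add: L_def)
          from line_integral_bound[OF k0(2) th this]
          have "norm ((?e y * b y) * (LINT t|lborel. indicator {L..L+1} t *\<^sub>R (Phi (of_real \<kappa>) ((y - x) + t *\<^sub>R \<theta>) * exp (\<i> * \<kappa> * t)))) \<le> (1 * M0) * (3 / \<kappa>)"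
            unfolding norm_mult using M0 k0 by (intro mult_mono) auto
          then show ?thesis using False by (simp add: mult_ac)
        qed (use supp M0 k0 in simp)
        show "0 \<le> 3 / \<kappa> * ?v y" using M0 k0 by simp
      qed
      also have "\<dots> = 3 * M0 * measure lborel (cball (0::real^3) R) / \<kappa>" by simp
      finally show ?thesis .
    qed
    have Sint: "integrable lborel (\<lambda>t. indicator {L..L+1} t *\<^sub>R S t)"
      unfolding S_eq by (rule interval_Fubini(2)[OF Gm G v]) auto
    have cint: "integrable lborel (\<lambda>t. indicator {L..L+1} t *\<^sub>R S 0)"
      by (rule integrable_scaleR_left) simp
    \<comment> \<open>The interval has length one, so S 0 is its own mean, and differs from the mean
      of S by at most the bound \<open>D\<close>.\<close>
    have "norm (LINT t|lborel. indicator {L..L+1} t *\<^sub>R (S 0 - S t)) \<le> C1 / \<kappa> * (L + 1) * (L + 1 - L)"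
    proof (rule norm_interval_integral_le)
      show "integrable lborel (\<lambda>t. indicator {L..L+1} t *\<^sub>R (S 0 - S t))"
        unfolding scaleR_diff_right by (rule Bochner_Integration.integrable_diff[OF cint Sint])
      show "norm (S 0 - S t) \<le> C1 / \<kappa> * (L + 1)" if "t \<in> {L..L+1}" for t
        using that R by (intro D) (auto simp: L_def)
    qed simp
    moreover have "(LINT t|lborel. indicator {L..L+1} t *\<^sub>R (S 0 - S t)) = S 0 - (LINT t|lborel. indicator {L..L+1} t *\<^sub>R S t)"
      unfolding scaleR_diff_right Bochner_Integration.integral_diff[OF cint Sint] by simp
    ultimately have "norm (S 0) \<le> C1 / \<kappa> * (L + 1) + 3 * M0 * measure lborel (cball (0::real^3) R) / \<kappa>"
      using A norm_triangle_sub[of "S 0" "LINT t|lborel. indicator {L..L+1} t *\<^sub>R S t"] by simp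
    also have "\<dots> = C / \<kappa>" using k0 by (simp add: C_def field_simps)
    finally show ?thesis by (simp add: S_def)
  qed
  have "C \<ge> 0" using C1 M0 R by (simp add: C_def L_def)
  with main show ?thesis by blast
qed

text \<open>The inequality exp(-s) \<le> 1/s buys the factor 1/\<kappa> for one more power of 1/|z|,
  which \<open>sing\<close> still majorises.\<close>

lemma norm_Phi_imag_le:
  assumes k: "\<kappa> > 0"
  shows "norm (Phi (\<i> * of_real \<kappa>) z) \<le> 1 / \<kappa> * sing z"
proof (cases "z = 0")
  case False
  define r where "r = norm z"
  have r: "r > 0" using False by (simp add: r_def)
  have "exp (- (\<kappa> * r)) \<le> 1 / (\<kappa> * r)"
  proof -
    have "\<kappa> * r \<le> exp (\<kappa> * r)" using exp_ge_add_one_self[of "\<kappa> * r"] by linarith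
    then show ?thesis using k r by (simp add: exp_minus inverse_eq_divide frac_le)
  qed
  then have "exp (- (\<kappa> * r)) / r \<le> 1 / (\<kappa> * r) / r"
    using r by (intro divide_right_mono) auto
  then have "norm (Phi (\<i> * of_real \<kappa>) z) \<le> 1 / (\<kappa> * r) / r"
    using r by (simp add: Phi_def norm_divide r_def[symmetric])
  also have "\<dots> = 1 / \<kappa> * (1 / (norm z)\<^sup>2)"
    by (simp add: r_def power2_eq_square)
  also have "\<dots> \<le> 1 / \<kappa> * sing z"
    using k by (intro mult_left_mono sing_ge_inverse) auto
  finally show ?thesis .
qed (use k sing_ge1[of z] in \<open>simp add: Phi_def\<close>)

text \<open>Two powers of 1/\<kappa> come from the normalisation of \<open>GB\<close>; the third
  comes from oscillation for wave number \<kappa> and from decay for \<i> \<kappa>.\<close>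

lemma GB_wave_bound:
  assumes b: "Ck 2 b" and supp: "\<And>y. norm y > R \<Longrightarrow> b y = 0" and R: "R > 0"
  shows "\<exists>C\<ge>0. \<forall>\<kappa> \<theta> x. \<kappa> \<ge> 1 \<longrightarrow> norm \<theta> = 1 \<longrightarrow> norm x \<le> R \<longrightarrow>
     norm (LINT y|lborel. GB \<kappa> (y - x) * (plane_wave \<kappa> \<theta> y * b y)) \<le> C / \<kappa>^3"
proof -
  have cb: "continuous_on UNIV b" using Ck2_dirder(1)[OF b] by (auto simp: dirder_def)
  then have [measurable]: "b \<in> borel_measurable borel" by (rule borel_measurable_continuous_onI)
  obtain M where M: "M \<ge> 0" "\<And>y. norm (b y) \<le> M" using bounded_of_compact_support[of b R] cb supp by auto
  obtain C where C: "C \<ge> 0" "\<And>\<kappa> \<theta> x. \<kappa> \<ge> 1 \<Longrightarrow> norm \<theta> = 1 \<Longrightarrow> norm x \<le> R \<Longrightarrow>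
     norm (LINT y|lborel. Phi (of_real \<kappa>) (y - x) * (plane_wave \<kappa> \<theta> y * b y)) \<le> C / \<kappa>"
    using Phi_wave_bound[OF b supp R] by auto
  have "norm (LINT y|lborel. GB \<kappa> (y - x) * (plane_wave \<kappa> \<theta> y * b y)) \<le> (C + M * sing_bound R) / \<kappa>^3"
    if k: "\<kappa> \<ge> 1" and th: "norm \<theta> = 1" and x: "norm x \<le> R" for \<kappa> \<theta> x
  proof -
    have k0: "\<kappa> > 0" "\<kappa> \<ge> 0" using k by auto
    let ?f = "\<lambda>y. plane_wave \<kappa> \<theta> y * b y"
    have cf: "continuous_on UNIV ?f" by (intro continuous_intros cb)
    have sf: "norm y > R \<Longrightarrow> ?f y = 0" for y by (simp add: supp)
    let ?P = "LINT y|lborel. Phi (of_real \<kappa>) (y - x) * ?f y" and ?Q = "LINT y|lborel. Phi (\<i> * of_real \<kappa>) (y - x) * ?f y"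
    have "(LINT y|lborel. GB \<kappa> (y - x) * ?f y) = (?P - ?Q) / of_real (8 * pi * \<kappa>\<^sup>2)"
      unfolding GB_def times_divide_eq_left left_diff_distrib
      by (simp only: integral_divide_zero Bochner_Integration.integral_diff[OF Phi_integrable(1)[OF Im_wavenumber(1)[OF k0(2)] cf sf] Phi_integrable(1)[OF Im_wavenumber(2)[OF k0(2)] cf sf]])
    then have "norm (LINT y|lborel. GB \<kappa> (y - x) * ?f y) = norm (?P - ?Q) / (8 * pi * \<kappa>\<^sup>2)"
      using k0 by (simp add: norm_divide norm_mult norm_power)
    also have "\<dots> \<le> (C / \<kappa> + 1 / \<kappa> * M * sing_bound R) / (8 * pi * \<kappa>\<^sup>2)"
    proof (rule divide_right_mono)
      have "norm ?Q \<le> 1 / \<kappa> * M * sing_bound R"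
        by (rule kernel_integrable(2)) (use norm_Phi_imag_le[OF k0(1)] k0 M supp in \<open>auto simp: norm_mult\<close>)
      then show "norm (?P - ?Q) \<le> C / \<kappa> + 1 / \<kappa> * M * sing_bound R"
        by (intro norm_triangle_le_diff add_mono C k th x)
    qed simp
    also have "\<dots> = (C + M * sing_bound R) / \<kappa>^3 * (1 / (8 * pi))"
      using k0 by (simp add: field_simps power2_eq_square power3_eq_cube)
    also have "\<dots> \<le> (C + M * sing_bound R) / \<kappa>^3 * 1"
    proof (rule mult_left_mono)
      show "0 \<le> (C + M * sing_bound R) / \<kappa>^3" using C M k0 sing_bound_pos[of R] by simp
    qed (use pi_ge_one in simp)
    finally show ?thesis by simp
  qed
  moreover have "C + M * sing_bound R \<ge> 0" using C M sing_bound_pos[of R] by simp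
  ultimately show ?thesis by blast
qed

lemma GB_minus: "GB \<kappa> (x - y) = GB \<kappa> (y - x)" "DGB \<kappa> j (x - y) = - DGB \<kappa> j (y - x)"
  unfolding GB_def DGB_def using Phi_minus[of _ x y] DPhi_minus(2)[of _ j x y]
  by (simp_all add: minus_divide_left)

text \<open>The operator \<open>(A \<cdot> \<nabla> + V) R\<^sub>0\<close>, and \<open>A \<cdot> \<nabla> + V\<close> applied to the plane wave.\<close>

definition born_op :: "(real^3 \<Rightarrow> complex^3) \<Rightarrow> (real^3 \<Rightarrow> complex) \<Rightarrow> real \<Rightarrow> (real^3 \<Rightarrow> complex) \<Rightarrow> real^3 \<Rightarrow> complex" where
  "born_op A V \<kappa> f x = (\<Sum>j\<in>UNIV. A x $ j * (LINT y|lborel. DGB \<kappa> j (x - y) * f y)) + V x * (LINT y|lborel. GB \<kappa> (x - y) * f y)"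

definition pert0 :: "(real^3 \<Rightarrow> complex^3) \<Rightarrow> (real^3 \<Rightarrow> complex) \<Rightarrow> real \<Rightarrow> real^3 \<Rightarrow> real^3 \<Rightarrow> complex" where
  "pert0 A V \<kappa> \<theta> y = (\<i> * \<kappa> * (\<Sum>l\<in>UNIV. of_real (\<theta> $ l) * A y $ l) + V y) * plane_wave \<kappa> \<theta> y"

lemma dirder_zero: "dirder e (\<lambda>x. 0) (\<lambda>x. 0)"
  by (simp add: dirder_def)

lemma dirder_sum:
  assumes "finite I" "\<And>i. i \<in> I \<Longrightarrow> dirder e (f i) (f' i)"
  shows "dirder e (\<lambda>x. \<Sum>i\<in>I. f i x) (\<lambda>x. \<Sum>i\<in>I. f' i x)"
  using assms by (induction I rule: finite_induct) (auto intro!: dirder_add dirder_zero)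

text \<open>In the gradient part, \<open>GB_gradient\<close> lets the derivative fall on
  \<open>pert0\<close>. Only where it hits the wave in front of \<open>A\<close> do two factors
  \<kappa> appear, and there \<open>GB_wave_bound\<close> gives \<kappa>^-3. Everything else has
  size \<kappa> and needs only the bound \<kappa>^-2 of \<open>GB\<close>. Points x outside the ball
  are trivial, since \<open>A\<close> and \<open>V\<close> vanish there.\<close>

lemma born_op_pert0_bound:
  assumes A: "\<And>l. Ck 2 (\<lambda>y. A y $ l)" and V: "Ck 2 V" and R: "R > 0"
    and sA: "\<And>y. norm y > R \<Longrightarrow> A y = 0" and sV: "\<And>y. norm y > R \<Longrightarrow> V y = 0"
  shows "\<exists>C\<ge>0. \<forall>\<kappa> \<theta> x. \<kappa> \<ge> 1 \<longrightarrow> norm \<theta> = 1 \<longrightarrow> norm (born_op A V \<kappa> (pert0 A V \<kappa> \<theta>) x) \<le> C / \<kappa>"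
proof -
  let ?A = "\<lambda>l y. A y $ l"
  have sA': "norm y > R \<Longrightarrow> ?A l y = 0" for l y by (simp add: sA)
  note A1 = Ck2_dirder(1)[OF A] and V1 = Ck2_dirder(1)[OF V]
  have cA: "continuous_on UNIV (?A l)" "continuous_on UNIV (partial j (?A l))" for j l
    using A1[of j l] by (auto simp: dirder_def)
  have cV: "continuous_on UNIV V" "continuous_on UNIV (partial j V)" for j
    using V1[of j] by (auto simp: dirder_def)
  have sA1: "norm y > R \<Longrightarrow> partial j (?A l) y = 0" for j l y by (rule dirder_support[OF A1 sA'])
  have sV1: "norm y > R \<Longrightarrow> partial j V y = 0" for j y by (rule dirder_support[OF V1 sV])
  obtain MA where MA: "MA \<ge> 0" "\<And>l y. norm (A y $ l) \<le> MA" using uniform_bound[of ?A R] cA sA' by blast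
  obtain MA' where MA': "MA' \<ge> 0" "\<And>p y. norm (partial (fst p) (?A (snd p)) y) \<le> MA'"
    using uniform_bound[of "\<lambda>p. partial (fst p) (?A (snd p))" R] cA sA1 by blast
  obtain MV where MV: "MV \<ge> 0" "\<And>y. norm (V y) \<le> MV" using bounded_of_compact_support[of V R] cV sV by auto
  obtain MV' where MV': "MV' \<ge> 0" "\<And>j y. norm (partial j V y) \<le> MV'" using uniform_bound[of "\<lambda>j. partial j V" R] cV sV1 by blast
  have "\<forall>l. \<exists>C\<ge>0. \<forall>\<kappa> \<theta> x. \<kappa> \<ge> 1 \<longrightarrow> norm \<theta> = 1 \<longrightarrow> norm x \<le> R \<longrightarrow>
     norm (LINT y|lborel. GB \<kappa> (y - x) * (plane_wave \<kappa> \<theta> y * ?A l y)) \<le> C / \<kappa>^3"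
    using GB_wave_bound[OF A sA' R] by blast
  from choice[OF this] obtain W where W0: "\<And>l. W l \<ge> 0 \<and> (\<forall>\<kappa> \<theta> x. \<kappa> \<ge> 1 \<longrightarrow> norm \<theta> = 1 \<longrightarrow> norm x \<le> R \<longrightarrow>
     norm (LINT y|lborel. GB \<kappa> (y - x) * (plane_wave \<kappa> \<theta> y * ?A l y)) \<le> W l / \<kappa>^3)"
    by auto
  have W: "W l \<ge> 0" "\<And>\<kappa> \<theta> x. \<kappa> \<ge> 1 \<Longrightarrow> norm \<theta> = 1 \<Longrightarrow> norm x \<le> R \<Longrightarrow>
     norm (LINT y|lborel. GB \<kappa> (y - x) * (plane_wave \<kappa> \<theta> y * ?A l y)) \<le> W l / \<kappa>^3" for l
    using W0[of l] by auto
  define WW where "WW = (\<Sum>l\<in>UNIV. W l)"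
  have WW: "WW \<ge> 0" using W by (auto simp: WW_def intro: sum_nonneg)
  define M3 where "M3 = MV + (3 * MA' + MV')"
  have M3: "M3 \<ge> 0" using MV MA' MV' by (simp add: M3_def)
  define M4 where "M4 = 3 * MA + MV"
  have M4: "M4 \<ge> 0" using MV MA by (simp add: M4_def)
  define C where "C = 3 * (MA * (WW + M3 * sing_bound R)) + MV * (M4 * sing_bound R)"
  have C: "C \<ge> 0" using MA WW M3 MV M4 sing_bound_pos[of R] by (simp add: C_def)
  have main: "norm (born_op A V \<kappa> (pert0 A V \<kappa> \<theta>) x) \<le> C / \<kappa>" if k: "\<kappa> \<ge> 1" and th: "norm \<theta> = 1" for \<kappa> \<theta> x
  proof (cases "norm x > R")
    case True
    then show ?thesis using C k by (simp add: born_op_def sA sV)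
  next
    case False
    then have x: "norm x \<le> R" by simp
    have k0: "\<kappa> > 0" "\<kappa> \<ge> 0" using k by auto
    let ?e = "plane_wave \<kappa> \<theta>"
    let ?f = "pert0 A V \<kappa> \<theta>"
    let ?B = "\<lambda>y. \<i> * \<kappa> * (\<Sum>l\<in>UNIV. of_real (\<theta> $ l) * A y $ l) + V y"
    let ?B' = "\<lambda>j y. \<i> * \<kappa> * (\<Sum>l\<in>UNIV. of_real (\<theta> $ l) * partial j (?A l) y) + partial j V y"
    have dB: "dirder (axis j 1) ?B (?B' j)" for j
      by (intro dirder_add dirder_cmult dirder_sum A1 V1) auto
    let ?f' = "\<lambda>j y. ?B y * (\<i> * of_real (\<kappa> * \<theta> $ j) * ?e y) + ?B' j y * ?e y"
    have df: "dirder (axis j 1) ?f (?f' j)" for j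
      unfolding pert0_def[abs_def] by (rule dirder_mult[OF dB dirder_plane_wave])
    have sf: "norm y > R \<Longrightarrow> ?f y = 0" for y by (simp add: pert0_def sA sV)
    have cB: "continuous_on UNIV (?B' j)" "continuous_on UNIV ?f" for j
      using dB[of j] df[of j] by (auto simp: dirder_def)
    have fm [measurable]: "?f \<in> borel_measurable borel" by (rule borel_measurable_continuous_onI[OF cB(2)])
    have Bn: "norm (\<Sum>l\<in>UNIV. of_real (\<theta> $ l) * g l) \<le> 3 * K" if "\<And>l. norm (g l) \<le> K" for g :: "3 \<Rightarrow> complex" and K
    proof -
      have "norm (\<Sum>l\<in>UNIV. of_real (\<theta> $ l) * g l) \<le> (\<Sum>l\<in>(UNIV::3 set). 1 * K)"
        by (intro sum_norm_le) (auto simp: norm_mult intro!: mult_mono[of _ 1 _ K, simplified] that component_le_one[OF th])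
      then show ?thesis by simp
    qed
    have fn: "norm (?f y) \<le> \<kappa> * M4" for y
    proof -
      have "norm (?f y) \<le> \<kappa> * (3 * MA) + MV"
        using k0 MV by (simp add: pert0_def norm_mult) (intro norm_triangle_mono, auto simp: norm_mult intro!: mult_left_mono Bn MA)
      also have "\<dots> \<le> \<kappa> * (3 * MA) + \<kappa> * MV"
        using k MV by (simp add: mult_le_cancel_right1)
      finally show ?thesis by (simp add: M4_def algebra_simps)
    qed
    have G: "norm (LINT y|lborel. GB \<kappa> (x - y) * ?f y) \<le> M4 * sing_bound R / \<kappa>"
    proof -
      have "norm (LINT y|lborel. GB \<kappa> (y - x) * ?f y) \<le> 1 / \<kappa>\<^sup>2 * (\<kappa> * M4) * sing_bound R"
        by (rule kernel_integrable(2)) (use GB_bounds(2)[OF k0(1)] sf fn in auto)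
      then show ?thesis using k0 unfolding GB_minus(1)[of _ x] by (simp add: power2_eq_square)
    qed
    have D: "norm (LINT y|lborel. DGB \<kappa> j (x - y) * ?f y) \<le> (WW + M3 * sing_bound R) / \<kappa>" for j
    proof -
      \<comment> \<open>The part of the derivative with at most one factor \<kappa>: the derivative
        of the amplitude, and that of the wave in front of \<open>V\<close>.\<close>
      let ?r = "\<lambda>y. V y * (\<i> * of_real (\<kappa> * \<theta> $ j) * ?e y) + ?B' j y * ?e y"
      \<comment> \<open>The coefficients of the part quadratic in \<kappa>: one factor from the
        gradient already in \<open>pert0\<close>, one from differentiating the wave again.\<close>
      let ?c = "\<lambda>l. \<i> * \<kappa> * of_real (\<theta> $ l) * (\<i> * of_real (\<kappa> * \<theta> $ j))"
      have sr: "norm y > R \<Longrightarrow> ?r y = 0" for y by (simp add: sV sA1 sV1)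
      have cr: "continuous_on UNIV ?r" by (intro continuous_intros cV cB cA)
      then have rm: "?r \<in> borel_measurable borel" by (rule borel_measurable_continuous_onI)
      have eq: "?f' j y = (\<Sum>l\<in>UNIV. ?c l * (?e y * ?A l y)) + ?r y" for y
        by (simp add: sum_distrib_left sum_distrib_right algebra_simps)
      have nr: "norm (?r y) \<le> \<kappa> * M3" for y
      proof -
        have "norm (\<i> * complex_of_real \<kappa> * (\<Sum>l\<in>UNIV. of_real (\<theta> $ l) * partial j (?A l) y)) \<le> \<kappa> * (3 * MA')"
          using k0 MA'(2)[of "(j, _)"] by (auto simp: norm_mult intro!: mult_left_mono Bn)
        moreover have "norm (partial j V y) \<le> \<kappa> * MV'"
          using mult_mono[of 1 \<kappa> "norm (partial j V y)" MV'] k MV'(2)[of j y] by simp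
        ultimately have "norm (?B' j y) \<le> \<kappa> * (3 * MA') + \<kappa> * MV'"
          by (rule norm_triangle_mono)
        then have "norm (?B' j y * ?e y) \<le> \<kappa> * (3 * MA') + \<kappa> * MV'"
          by (subst norm_mult) simp
        moreover have "norm (V y * (\<i> * of_real (\<kappa> * \<theta> $ j) * ?e y)) \<le> MV * \<kappa>"
          unfolding norm_mult plane_wave_norm using MV k0 component_le_one[OF th, of j]
          by (intro mult_mono) (auto simp: abs_mult norm_mult mult_left_le)
        ultimately have "norm (?r y) \<le> MV * \<kappa> + (\<kappa> * (3 * MA') + \<kappa> * MV')"
          by (intro norm_triangle_mono)
        then show ?thesis by (simp add: M3_def algebra_simps)
      qed
      have eAm: "(\<lambda>y. ?e y * ?A l y) \<in> borel_measurable borel" for l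
        by (intro borel_measurable_continuous_onI continuous_on_mult plane_wave_continuous cA)
      have iA: "integrable lborel (\<lambda>y. GB \<kappa> (y - x) * (?e y * ?A l y))" for l
        by (rule kernel_integrable(1)[of _ _ "1 / \<kappa>\<^sup>2" R MA])
           (use GB_bounds(2)[OF k0(1)] sA MA k0 eAm in \<open>auto simp: norm_mult\<close>)
      have ir: "integrable lborel (\<lambda>y. GB \<kappa> (y - x) * ?r y)"
        by (rule kernel_integrable(1)[OF GB_measurable(1) rm GB_bounds(2)[OF k0(1)] _ sr nr]) (use k0 in simp)
      have "(LINT y|lborel. DGB \<kappa> j (x - y) * ?f y) = - (LINT y|lborel. DGB \<kappa> j (y - x) * ?f y)"
        unfolding GB_minus(2)[of _ _ x] by simp
      also have "\<dots> = (LINT y|lborel. GB \<kappa> (y - x) * ?f' j y)"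
      proof -
        have "(LINT y|lborel. GB \<kappa> (y - x) * ?f' j y) = - (LINT y|lborel. DGB \<kappa> j (y - x) * ?f y)"
          by (rule GB_gradient[OF k0(1) df sf])
        then show ?thesis by simp
      qed
      also have "\<dots> = (LINT y|lborel. (\<Sum>l\<in>UNIV. ?c l * (GB \<kappa> (y - x) * (?e y * ?A l y))) + GB \<kappa> (y - x) * ?r y)"
        unfolding eq by (simp only: distrib_left sum_distrib_left mult.left_commute)
      also have "\<dots> = (\<Sum>l\<in>UNIV. ?c l * (LINT y|lborel. GB \<kappa> (y - x) * (?e y * ?A l y))) + (LINT y|lborel. GB \<kappa> (y - x) * ?r y)"
        by (simp only: Bochner_Integration.integral_add[OF Bochner_Integration.integrable_sum[OF integrable_mult_right[OF iA]] ir]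
            Bochner_Integration.integral_sum[OF integrable_mult_right[OF iA]] integral_mult_right_zero)
      also have "norm \<dots> \<le> WW / \<kappa> + M3 * sing_bound R / \<kappa>"
      proof (rule norm_triangle_mono)
        have "norm (?c l * (LINT y|lborel. GB \<kappa> (y - x) * (?e y * ?A l y))) \<le> W l / \<kappa>" for l
        proof -
          have "norm (?c l) = (\<kappa> * \<bar>\<theta> $ l\<bar>) * (\<kappa> * \<bar>\<theta> $ j\<bar>)"
            using k0 by (simp add: norm_mult abs_mult)
          also have "\<dots> \<le> (\<kappa> * 1) * (\<kappa> * 1)"
            using k0 component_le_one[OF th, of j] component_le_one[OF th, of l]
            by (intro mult_mono) auto
          finally have "norm (?c l) \<le> (\<kappa> * 1) * (\<kappa> * 1)" .
          then have "norm (?c l * (LINT y|lborel. GB \<kappa> (y - x) * (?e y * ?A l y))) \<le> ((\<kappa> * 1) * (\<kappa> * 1)) * (W l / \<kappa>^3)"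
            unfolding norm_mult[of "?c l"] using k0 by (intro mult_mono W k th x) auto
          also have "\<dots> = W l / \<kappa>" using k0 by (simp add: power3_eq_cube)
          finally show ?thesis .
        qed
        then show "norm (\<Sum>l\<in>UNIV. ?c l * (LINT y|lborel. GB \<kappa> (y - x) * (?e y * ?A l y))) \<le> WW / \<kappa>"
          unfolding WW_def sum_divide_distrib by (intro sum_norm_le) auto
        have "norm (LINT y|lborel. GB \<kappa> (y - x) * ?r y) \<le> 1 / \<kappa>\<^sup>2 * (\<kappa> * M3) * sing_bound R"
          by (rule kernel_integrable(2)[OF GB_measurable(1) rm GB_bounds(2)[OF k0(1)] _ sr nr]) (use k0 in simp)
        then show "norm (LINT y|lborel. GB \<kappa> (y - x) * ?r y) \<le> M3 * sing_bound R / \<kappa>"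
          using k0 by (simp add: power2_eq_square)
      qed
      finally show ?thesis by (simp add: add_divide_distrib)
    qed
    have "norm (born_op A V \<kappa> ?f x) \<le> (\<Sum>j\<in>(UNIV::3 set). MA * ((WW + M3 * sing_bound R) / \<kappa>)) + MV * (M4 * sing_bound R / \<kappa>)"
    proof -
      have t1: "norm (A x $ j * (LINT y|lborel. DGB \<kappa> j (x - y) * ?f y)) \<le> MA * ((WW + M3 * sing_bound R) / \<kappa>)" for j
        unfolding norm_mult by (intro mult_mono D MA norm_ge_zero)
      have t2: "norm (V x * (LINT y|lborel. GB \<kappa> (x - y) * ?f y)) \<le> MV * (M4 * sing_bound R / \<kappa>)"
        unfolding norm_mult by (intro mult_mono G MV norm_ge_zero)
      show ?thesis unfolding born_op_def by (intro norm_triangle_mono sum_norm_le t1 t2)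
    qed
    also have "\<dots> = C / \<kappa>" using k0 by (simp add: C_def field_simps)
    finally show ?thesis .
  qed
  with C show ?thesis by blast
qed

section \<open>The integral equation\<close>

lemma conv_continuous:
  fixes K :: "real^3 \<Rightarrow> complex"
  assumes [measurable]: "K \<in> borel_measurable borel" and K: "\<And>z. norm (K z) \<le> C"
    and cK: "continuous_on (- {0}) K" and f: "integrable lborel f"
  shows "continuous_on UNIV (\<lambda>x. LINT y|lborel. K (x - y) * f y)"
  unfolding continuous_on_sequentially o_def
proof (intro allI ballI impI, elim conjE)
  fix u :: "nat \<Rightarrow> real^3" and x assume u: "u \<longlonglongrightarrow> x"
  have [measurable]: "f \<in> borel_measurable borel"
    using f borel_measurable_integrable by auto
  show "(\<lambda>n. LINT y|lborel. K (u n - y) * f y) \<longlonglongrightarrow> (LINT y|lborel. K (x - y) * f y)"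
  proof (rule integral_dominated_convergence[where w = "\<lambda>y. C * norm (f y)"])
    show "integrable lborel (\<lambda>y. C * norm (f y))" using f by simp
    show "AE y in lborel. norm (K (u n - y) * f y) \<le> C * norm (f y)" for n
      by (simp add: norm_mult K mult_right_mono)
    show "AE y in lborel. (\<lambda>n. K (u n - y) * f y) \<longlonglongrightarrow> K (x - y) * f y"
      using AE_neq_lborel[of x]
    proof eventually_elim
      case (elim y)
      then have "isCont K (x - y)"
        using cK by (simp add: continuous_on_eq_continuous_at open_Compl)
      then have "(\<lambda>n. K (u n - y)) \<longlonglongrightarrow> K (x - y)"
        by (rule isCont_tendsto_compose) (intro tendsto_intros u)
      then show ?case by (intro tendsto_intros)
    qed
  qed measurable
qed

lemma born_op_diff:
  assumes k: "\<kappa> > 0" and f: "integrable lborel f" and g: "integrable lborel g"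
  shows "born_op A V \<kappa> (\<lambda>y. f y - g y) x = born_op A V \<kappa> f x - born_op A V \<kappa> g x"
proof -
  note i1 = conv_integrable(1)[OF GB_measurable(1) GB_bounds(1)[OF k]]
  note i2 = conv_integrable(1)[OF GB_measurable(2) DGB_bounds(1)[OF k]]
  show ?thesis
    unfolding born_op_def right_diff_distrib Bochner_Integration.integral_diff[OF i1[OF f] i1[OF g]]
      Bochner_Integration.integral_diff[OF i2[OF f] i2[OF g]]
    by (simp add: sum_subtractf)
qed

text \<open>Data for the fixed point argument, with one bound M for all coefficients. Derivatives of
  the coefficients enter later, through the bound \<open>B\<close> on the first iterate.\<close>

locale potential =
  fixes A :: "real^3 \<Rightarrow> complex^3" and V :: "real^3 \<Rightarrow> complex" and R M :: real
  assumes cA: "\<And>l. continuous_on UNIV (\<lambda>y. A y $ l)" and cV: "continuous_on UNIV V"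
    and R: "R > 0" and sA: "\<And>y. norm y > R \<Longrightarrow> A y = 0" and sV: "\<And>y. norm y > R \<Longrightarrow> V y = 0"
    and MA: "\<And>y l. norm (A y $ l) \<le> M" and MV: "\<And>y. norm (V y) \<le> M"
begin

text \<open>The factor 4 counts the three components of \<open>A\<close> and the function
  \<open>V\<close>.\<close>

definition op_const :: real where "op_const = 4 * M * sing_bound R"

lemma M_nonneg: "M \<ge> 0" using MV[of 0] norm_ge_zero order_trans by blast

lemma op_const_nonneg: "op_const \<ge> 0" using M_nonneg sing_bound_pos[of R] by (simp add: op_const_def)

lemma potential_measurable [measurable]: "(\<lambda>y. A y $ l) \<in> borel_measurable borel" "V \<in> borel_measurable borel"
  using cA cV by (auto intro: borel_measurable_continuous_onI)

lemma born_op_outside: "norm x > R \<Longrightarrow> born_op A V \<kappa> f x = 0"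
  by (simp add: born_op_def sA sV)

lemma born_op_sup:
  assumes k: "\<kappa> \<ge> 1" and f: "f \<in> borel_measurable borel" "\<And>y. norm y > R \<Longrightarrow> f y = 0" "\<And>y. norm (f y) \<le> F"
  shows "norm (born_op A V \<kappa> f x) \<le> op_const / \<kappa> * F"
proof -
  have k0: "\<kappa> > 0" using k by simp
  have F: "F \<ge> 0" using f(3)[of 0] norm_ge_zero order_trans by blast
  \<comment> \<open>One power of 1/\<kappa> is given away so that \<open>GB\<close> and
    \<open>DGB\<close> share the majorant \<open>sing\<close> divided by \<kappa>.\<close>
  have "1 / \<kappa>\<^sup>2 \<le> 1 / \<kappa>" using k by (simp add: power2_eq_square field_simps)
  then have GB: "norm (GB \<kappa> z) \<le> 1 / \<kappa> * sing z" for z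
    using GB_bounds(2)[OF k0, of z] sing_ge1[of z] by (meson mult_right_mono order_trans zero_le_one)
  have D: "norm (LINT y|lborel. DGB \<kappa> j (x - y) * f y) \<le> 1 / \<kappa> * F * sing_bound R" for j
    unfolding GB_minus(2)[of _ _ x] using kernel_integrable(2)[OF GB_measurable(2) f(1), of \<kappa> j "1 / \<kappa>" R F x] DGB_bounds(2)[OF k0] k0 f by simp
  have G: "norm (LINT y|lborel. GB \<kappa> (x - y) * f y) \<le> 1 / \<kappa> * F * sing_bound R"
    unfolding GB_minus(1)[of _ x] using kernel_integrable(2)[OF GB_measurable(1) f(1), of \<kappa> "1 / \<kappa>" R F x] GB k0 f by simp
  have t1: "norm (A x $ j * (LINT y|lborel. DGB \<kappa> j (x - y) * f y)) \<le> M * (1 / \<kappa> * F * sing_bound R)" for j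
    unfolding norm_mult by (intro mult_mono D MA norm_ge_zero M_nonneg)
  have t2: "norm (V x * (LINT y|lborel. GB \<kappa> (x - y) * f y)) \<le> M * (1 / \<kappa> * F * sing_bound R)"
    unfolding norm_mult by (intro mult_mono G MV norm_ge_zero M_nonneg)
  have "norm (born_op A V \<kappa> f x) \<le> (\<Sum>j\<in>(UNIV::3 set). M * (1 / \<kappa> * F * sing_bound R)) + M * (1 / \<kappa> * F * sing_bound R)"
    unfolding born_op_def by (intro norm_triangle_mono sum_norm_le t1 t2)
  also have "\<dots> = op_const / \<kappa> * F" by (simp add: op_const_def)
  finally show ?thesis .
qed

lemma born_op_continuous:
  assumes k: "\<kappa> > 0" and f: "integrable lborel f"
  shows "continuous_on UNIV (born_op A V \<kappa> f)"
  unfolding born_op_def[abs_def]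
  by (intro continuous_on_add continuous_on_sum continuous_on_mult cA cV
      conv_continuous[OF GB_measurable(1) GB_bounds(1)[OF k] GB_continuous(1)[OF k] f]
      conv_continuous[OF GB_measurable(2) DGB_bounds(1)[OF k] GB_continuous(2)[OF k] f])

text \<open>By Tonelli the majorant of the kernel is integrated in x rather than y. The ball now
  comes from the support of \<open>A\<close> and \<open>V\<close>, so \<open>f\<close> may be any
  integrable function, as is required for the source of a competing solution.\<close>

lemma born_op_L1:
  assumes k: "\<kappa> \<ge> 1" and f: "integrable lborel f"
  shows "(\<integral>\<^sup>+x. ennreal (norm (born_op A V \<kappa> f x)) \<partial>lborel) \<le> ennreal (op_const / \<kappa>) * (\<integral>\<^sup>+y. ennreal (norm (f y)) \<partial>lborel)"
proof -
  have k0: "\<kappa> > 0" using k by simp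
  have [measurable]: "f \<in> borel_measurable borel" using f borel_measurable_integrable by auto
  have "1 / \<kappa>\<^sup>2 \<le> 1 / \<kappa>" using k by (simp add: power2_eq_square field_simps)
  then have GB: "norm (GB \<kappa> z) \<le> 1 / \<kappa> * sing z" for z
    using GB_bounds(2)[OF k0, of z] sing_ge1[of z] by (meson mult_right_mono order_trans zero_le_one)
  let ?k = "\<lambda>x y. (\<Sum>j\<in>UNIV. A x $ j * DGB \<kappa> j (x - y)) + V x * GB \<kappa> (x - y)"
  let ?w = "\<lambda>x y. 4 * M / \<kappa> * (indicator (cball 0 R) x * sing (y - x))"
  note i1 = conv_integrable(1)[OF GB_measurable(1) GB_bounds(1)[OF k0] f]
  note i2 = conv_integrable(1)[OF GB_measurable(2) DGB_bounds(1)[OF k0] f]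
  have w0: "?w x y \<ge> 0" for x y using M_nonneg k0 sing_ge1[of "y - x"] by simp
  have kw: "norm (?k x y) \<le> ?w x y" for x y
  proof (cases "norm x > R")
    case True
    then show ?thesis using w0[of x y] by (simp add: sA sV)
  next
    case False
    have "norm (?k x y) \<le> (\<Sum>j\<in>(UNIV::3 set). M * (1 / \<kappa> * sing (x - y))) + M * (1 / \<kappa> * sing (x - y))"
    proof -
      have "norm (A x $ j * DGB \<kappa> j (x - y)) \<le> M * (1 / \<kappa> * sing (x - y))" for j
        unfolding norm_mult by (intro mult_mono MA M_nonneg norm_ge_zero DGB_bounds(2)[OF k0])
      moreover have "norm (V x * GB \<kappa> (x - y)) \<le> M * (1 / \<kappa> * sing (x - y))"
        unfolding norm_mult by (intro mult_mono MV M_nonneg norm_ge_zero GB)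
      ultimately show ?thesis by (intro norm_triangle_mono sum_norm_le)
    qed
    then show ?thesis using False by (simp add: sing_minus[of x y])
  qed
  have Teq: "born_op A V \<kappa> f x = (LINT y|lborel. ?k x y * f y)" and Tint: "integrable lborel (\<lambda>y. ?k x y * f y)" for x
  proof -
    have e: "?k x y * f y = (\<Sum>j\<in>UNIV. A x $ j * (DGB \<kappa> j (x - y) * f y)) + V x * (GB \<kappa> (x - y) * f y)" for y
      by (simp add: distrib_right sum_distrib_right mult.assoc)
    show "integrable lborel (\<lambda>y. ?k x y * f y)"
      unfolding e by (intro Bochner_Integration.integrable_add Bochner_Integration.integrable_sum integrable_mult_right i1 i2)
    show "born_op A V \<kappa> f x = (LINT y|lborel. ?k x y * f y)"
      unfolding e born_op_def
      by (simp only: Bochner_Integration.integral_add[OF Bochner_Integration.integrable_sum[OF integrable_mult_right[OF i2]] integrable_mult_right[OF i1]]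
            Bochner_Integration.integral_sum[OF integrable_mult_right[OF i2]] integral_mult_right_zero)
  qed
  have "(\<integral>\<^sup>+x. ennreal (norm (born_op A V \<kappa> f x)) \<partial>lborel) \<le> (\<integral>\<^sup>+x. \<integral>\<^sup>+y. ennreal (?w x y) * ennreal (norm (f y)) \<partial>lborel \<partial>lborel)"
  proof (rule nn_integral_mono)
    fix x :: "real^3"
    have "ennreal (norm (born_op A V \<kappa> f x)) \<le> (\<integral>\<^sup>+y. ennreal (norm (?k x y * f y)) \<partial>lborel)"
      unfolding Teq by (rule integral_norm_bound_ennreal[OF Tint])
    also have "\<dots> \<le> (\<integral>\<^sup>+y. ennreal (?w x y) * ennreal (norm (f y)) \<partial>lborel)"
      by (intro nn_integral_mono) (simp only: ennreal_mult[OF w0 norm_ge_zero, symmetric] norm_mult, intro ennreal_leI mult_right_mono kw norm_ge_zero)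
    finally show "ennreal (norm (born_op A V \<kappa> f x)) \<le> (\<integral>\<^sup>+y. ennreal (?w x y) * ennreal (norm (f y)) \<partial>lborel)" .
  qed
  also have "\<dots> = (\<integral>\<^sup>+y. \<integral>\<^sup>+x. ennreal (?w x y) * ennreal (norm (f y)) \<partial>lborel \<partial>lborel)"
    by (rule lborel_pair.Fubini') measurable
  also have "\<dots> = (\<integral>\<^sup>+y. (\<integral>\<^sup>+x. ennreal (?w x y) \<partial>lborel) * ennreal (norm (f y)) \<partial>lborel)"
    by (subst nn_integral_multc) auto
  also have "\<dots> \<le> (\<integral>\<^sup>+y. ennreal (op_const / \<kappa>) * ennreal (norm (f y)) \<partial>lborel)"
  proof (intro nn_integral_mono mult_right_mono)
    fix y :: "real^3"
    have "(\<integral>\<^sup>+x. ennreal (?w x y) \<partial>lborel) = ennreal (LINT x|lborel. ?w x y)"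
      by (rule nn_integral_eq_integral) (use w0 in \<open>auto intro!: integrable_mult_right sing_integral_cball\<close>)
    also have "\<dots> \<le> ennreal (op_const / \<kappa>)"
    proof (rule ennreal_leI)
      have "(LINT x|lborel. ?w x y) = 4 * M / \<kappa> * (LINT x|lborel. indicator (cball 0 R) x * sing (y - x))" by simp
      also have "\<dots> \<le> 4 * M / \<kappa> * sing_bound R"
        using M_nonneg k0 by (intro mult_left_mono sing_integral_cball) auto
      finally show "(LINT x|lborel. ?w x y) \<le> op_const / \<kappa>" by (simp add: op_const_def)
    qed
    finally show "(\<integral>\<^sup>+x. ennreal (?w x y) \<partial>lborel) \<le> ennreal (op_const / \<kappa>)" .
  qed simp
  also have "\<dots> = ennreal (op_const / \<kappa>) * (\<integral>\<^sup>+y. ennreal (norm (f y)) \<partial>lborel)"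
    by (rule nn_integral_cmult) measurable
  finally show ?thesis .
qed

lemma born_op_fixpoint_unique:
  assumes k: "\<kappa> \<ge> 1" "2 * op_const \<le> \<kappa>" and f: "integrable lborel f" and g: "integrable lborel g"
    and ff: "AE x in lborel. f x = h x - born_op A V \<kappa> f x" and gg: "AE x in lborel. g x = h x - born_op A V \<kappa> g x"
  shows "AE x in lborel. f x = g x"
proof -
  have k0: "\<kappa> > 0" using k by simp
  define D where "D = (\<lambda>x. f x - g x)"
  have D: "integrable lborel D" unfolding D_def using f g by simp
  have [measurable]: "D \<in> borel_measurable borel" using D borel_measurable_integrable by auto
  have "AE x in lborel. norm (D x) = norm (born_op A V \<kappa> D x)"
    using ff gg
  proof eventually_elim
    case (elim x)
    have "born_op A V \<kappa> D x = born_op A V \<kappa> f x - born_op A V \<kappa> g x"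
      unfolding D_def by (rule born_op_diff[OF k0 f g])
    then have "D x = - born_op A V \<kappa> D x" using elim by (simp add: D_def)
    then show ?case by (metis norm_minus_cancel)
  qed
  then have "(\<integral>\<^sup>+x. ennreal (norm (D x)) \<partial>lborel) = (\<integral>\<^sup>+x. ennreal (norm (born_op A V \<kappa> D x)) \<partial>lborel)"
    by (intro nn_integral_cong_AE) (auto elim: eventually_mono)
  also have "\<dots> \<le> ennreal (op_const / \<kappa>) * (\<integral>\<^sup>+x. ennreal (norm (D x)) \<partial>lborel)"
    by (rule born_op_L1[OF k(1) D])
  finally have le: "(\<integral>\<^sup>+x. ennreal (norm (D x)) \<partial>lborel) \<le> ennreal (op_const / \<kappa>) * (\<integral>\<^sup>+x. ennreal (norm (D x)) \<partial>lborel)" .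
  define I where "I = (LINT x|lborel. norm (D x))"
  have I: "(\<integral>\<^sup>+x. ennreal (norm (D x)) \<partial>lborel) = ennreal I" "I \<ge> 0"
    using D by (auto simp: I_def nn_integral_eq_integral)
  have "I \<le> op_const / \<kappa> * I"
    using le I(2) op_const_nonneg k0 unfolding I(1) by (simp add: ennreal_mult[symmetric])
  also have "op_const / \<kappa> * I \<le> 1 / 2 * I" using k I(2) k0 by (intro mult_right_mono) (auto simp: field_simps)
  finally have "I = 0" using I(2) by simp
  then have "AE x in lborel. norm (D x) = 0"
    using D by (subst integral_nonneg_eq_0_iff_AE[symmetric]) (auto simp: I_def)
  then show ?thesis by eventually_elim (simp add: D_def)
qed

lemma pert0_props:
  "continuous_on UNIV (pert0 A V \<kappa> \<theta>)" "norm y > R \<Longrightarrow> pert0 A V \<kappa> \<theta> y = 0"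
  by (auto simp: pert0_def[abs_def] sA sV intro!: continuous_on_add continuous_on_mult continuous_on_sum continuous_on_const cA cV plane_wave_continuous)

text \<open>Banach's theorem on bounded continuous functions; the condition on \<kappa> makes the
  contraction factor 1/2.\<close>

lemma fixpoint_exists:
  assumes k: "\<kappa> \<ge> 1" "2 * op_const \<le> \<kappa>" and B: "\<And>x. norm (born_op A V \<kappa> (pert0 A V \<kappa> \<theta>) x) \<le> B"
  shows "\<exists>F. continuous_on UNIV F \<and> (\<forall>x. norm x > R \<longrightarrow> F x = 0) \<and> (\<forall>x. F x = pert0 A V \<kappa> \<theta> x - born_op A V \<kappa> F x)
     \<and> (\<forall>x. norm (F x - pert0 A V \<kappa> \<theta> x) \<le> 2 * B)"
proof -
  have k0: "\<kappa> > 0" using k by simp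
  let ?f0 = "pert0 A V \<kappa> \<theta>"
  have half: "op_const / \<kappa> \<le> 1 / 2" using k k0 by (simp add: field_simps)
  \<comment> \<open>The operator bound needs data supported in the ball, which a general bounded
    continuous function lacks, so the iteration truncates. The fixed point itself vanishes outside
    the ball, hence it solves the equation without truncation.\<close>
  define r where "r = (\<lambda>(f :: (real^3) \<Rightarrow>\<^sub>C complex) y. indicator (cball 0 R) y * f y)"
  have rm: "r f \<in> borel_measurable borel" for f
  proof -
    have [measurable]: "apply_bcontfun f \<in> borel_measurable borel" by (intro borel_measurable_continuous_onI) simp
    show ?thesis unfolding r_def by measurable
  qed
  have r0: "norm y > R \<Longrightarrow> r f y = 0" for f y by (simp add: r_def)
  have rb: "\<exists>K. \<forall>y. norm (r f y) \<le> K" for f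
  proof -
    obtain K where "\<And>y. norm (apply_bcontfun f y) \<le> K"
      using bounded_apply_bcontfun[of f] by (auto simp: bounded_iff)
    then have "norm (r f y) \<le> max 0 K" for y by (auto simp: r_def indicator_def le_max_iff_disj)
    then show ?thesis by blast
  qed
  have ri: "integrable lborel (r f)" for f
    using rb[of f] integrable_of_bounded_support[OF rm r0] by blast
  obtain B0 where B0: "\<And>y. norm (?f0 y) \<le> B0"
    using bounded_of_compact_support[of ?f0 R] pert0_props by blast
  have f0b: "?f0 \<in> bcontfun"
    using B0 pert0_props by (auto simp: bcontfun_def bounded_iff)
  have Tb: "born_op A V \<kappa> (r f) \<in> bcontfun" for f
  proof -
    obtain K where K: "\<And>y. norm (r f y) \<le> K" using rb by blast
    have "norm (born_op A V \<kappa> (r f) x) \<le> op_const / \<kappa> * K" for x by (rule born_op_sup[OF k(1) rm r0 K])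
    then show ?thesis using born_op_continuous[OF k0 ri] by (auto simp: bcontfun_def bounded_iff)
  qed
  define \<Gamma> where "\<Gamma> f = Bcontfun (\<lambda>x. ?f0 x - born_op A V \<kappa> (r f) x)" for f
  have \<Gamma>: "apply_bcontfun (\<Gamma> f) x = ?f0 x - born_op A V \<kappa> (r f) x" for f x
  proof -
    have "(\<lambda>x. ?f0 x - born_op A V \<kappa> (r f) x) \<in> bcontfun"
      using f0b Tb[of f] by (auto simp: bcontfun_def intro!: continuous_intros bounded_minus_comp)
    then show ?thesis by (simp add: \<Gamma>_def Bcontfun_inverse)
  qed
  have diff: "norm (born_op A V \<kappa> (r f) x - born_op A V \<kappa> (r g) x) \<le> 1 / 2 * dist f g" for f g x
  proof -
    have "norm (born_op A V \<kappa> (\<lambda>y. r f y - r g y) x) \<le> op_const / \<kappa> * dist f g"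
    proof (rule born_op_sup[OF k(1)])
      show "norm (r f y - r g y) \<le> dist f g" for y
        using dist_bounded[of f y g] by (auto simp: r_def indicator_def dist_norm)
    qed (use rm r0 in auto)
    also have "\<dots> \<le> 1 / 2 * dist f g" using half by (intro mult_right_mono) auto
    finally show ?thesis by (simp add: born_op_diff[OF k0 ri ri])
  qed
  have "\<exists>!F. \<Gamma> F = F"
  proof (rule banach_fix_type[of "1/2"])
    show "\<forall>f g. dist (\<Gamma> f) (\<Gamma> g) \<le> 1 / 2 * dist f g"
    proof (intro allI dist_bound)
      fix f g x
      have "\<Gamma> f x - \<Gamma> g x = - (born_op A V \<kappa> (r f) x - born_op A V \<kappa> (r g) x)" by (simp add: \<Gamma>)
      then show "dist (\<Gamma> f x) (\<Gamma> g x) \<le> 1 / 2 * dist f g"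
        using diff[of f x g] by (simp only: dist_norm[of "\<Gamma> f x"] norm_minus_cancel)
    qed
  qed auto
  then obtain F where F: "\<Gamma> F = F" by auto
  have Feq: "F x = ?f0 x - born_op A V \<kappa> (r F) x" for x using \<Gamma>[of F x] F by simp
  have F0: "F x = 0" if "norm x > R" for x using that by (simp add: Feq pert0_props born_op_outside)
  have rF: "r F = apply_bcontfun F"
  proof
    fix y show "r F y = F y" using F0[of y] by (cases "norm y > R") (auto simp: r_def)
  qed
  define f0 where "f0 = Bcontfun ?f0"
  have f0: "apply_bcontfun f0 = ?f0" unfolding f0_def using f0b by (rule Bcontfun_inverse)
  have rf0: "r f0 = ?f0"
  proof
    fix y show "r f0 y = ?f0 y" using pert0_props(2)[of y] by (cases "norm y > R") (auto simp: r_def f0)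
  qed
  \<comment> \<open>With T the operator \<open>born_op\<close>, the difference F - F0 equals -T F0 -
    (T F - T F0). The last term is at most half of the distance sought, hence the factor 2 in the
    conclusion.\<close>
  have "dist F f0 \<le> B + 1 / 2 * dist F f0"
  proof (rule dist_bound)
    fix x
    have "F x - f0 x = - born_op A V \<kappa> (r f0) x - (born_op A V \<kappa> (r F) x - born_op A V \<kappa> (r f0) x)"
      using Feq[of x] by (simp add: f0)
    also have "norm \<dots> \<le> B + 1 / 2 * dist F f0"
      by (rule norm_triangle_le_diff, rule add_mono) (use B[of x] diff[of F x f0] in \<open>auto simp: rf0\<close>)
    finally show "dist (F x) (f0 x) \<le> B + 1 / 2 * dist F f0" by (simp add: dist_norm)
  qed
  then have "dist F f0 \<le> 2 * B" by simp
  then have "norm (F x - ?f0 x) \<le> 2 * B" for x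
    using dist_bounded[of F x f0] by (simp add: dist_norm f0)
  then show ?thesis
    using Feq F0 continuous_on_apply_bcontfun[of UNIV F] unfolding rF by blast
qed

end

section \<open>The scattering solution\<close>

lemma has_weak_gradient_diff:
  assumes u: "has_weak_gradient u g" and v: "has_weak_gradient v h"
  shows "has_weak_gradient (\<lambda>x. u x - v x) (\<lambda>x. g x - h x)"
  unfolding has_weak_gradient_def
proof (intro conjI allI impI)
  have li: "locally_integrable u" "locally_integrable v" "locally_integrable (\<lambda>x. g x $ j)" "locally_integrable (\<lambda>x. h x $ j)" for j
    using u v by (auto simp: has_weak_gradient_def)
  show "locally_integrable (\<lambda>x. u x - v x)" by (intro locally_integrable_diff li)
  show "locally_integrable (\<lambda>x. (g x - h x) $ j)" for j by (simp add: locally_integrable_diff li)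
  fix \<phi> j assume \<phi>: "test_function \<phi>"
  have int: "integrable lborel (\<lambda>x. w x * \<psi> x)" if tf: "test_function \<psi>" and lw: "locally_integrable w" for w \<psi>
  proof -
    obtain S where S: "\<forall>x. norm x > S \<longrightarrow> \<psi> x = 0" using test_function_support[OF tf] by blast
    have c: "continuous_on UNIV \<psi>" by (rule test_function_continuous[OF tf])
    obtain B where "\<forall>x. norm (\<psi> x) \<le> B" using bounded_of_compact_support[of \<psi> S] c S by blast
    then show ?thesis
      using c S by (intro locally_integrable_times[OF lw, of \<psi> S B] borel_measurable_continuous_onI) auto
  qed
  have \<phi>': "test_function (partial j \<phi>)" by (rule test_function_partial[OF \<phi>])
  have "(LINT x|lborel. u x * partial j \<phi> x) = - (LINT x|lborel. g x $ j * \<phi> x)"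
    "(LINT x|lborel. v x * partial j \<phi> x) = - (LINT x|lborel. h x $ j * \<phi> x)"
    using u v \<phi> by (auto simp: has_weak_gradient_def)
  then show "(LINT x|lborel. (u x - v x) * partial j \<phi> x) = - (LINT x|lborel. (g x - h x) $ j * \<phi> x)"
    unfolding vector_minus_component left_diff_distrib
      Bochner_Integration.integral_diff[OF int[OF \<phi>' li(1)] int[OF \<phi>' li(2)]]
      Bochner_Integration.integral_diff[OF int[OF \<phi> li(3)] int[OF \<phi> li(4)]] by simp
qed

lemma locally_integrable_plane_wave: "locally_integrable (\<lambda>x. c * plane_wave \<kappa> \<theta> x)"
  by (rule locally_integrable_bounded[where M = "norm c"]) (auto simp: norm_mult)

lemma plane_wave_weak_gradient:
  "has_weak_gradient (plane_wave \<kappa> \<theta>) (\<lambda>x. \<chi> j. \<i> * of_real (\<kappa> * \<theta> $ j) * plane_wave \<kappa> \<theta> x)"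
  unfolding has_weak_gradient_def
proof (intro conjI allI impI)
  show "locally_integrable (plane_wave \<kappa> \<theta>)" using locally_integrable_plane_wave[of 1] by simp
  show "locally_integrable (\<lambda>x. (\<chi> j. \<i> * of_real (\<kappa> * \<theta> $ j) * plane_wave \<kappa> \<theta> x) $ j)" for j
    unfolding vec_lambda_beta by (rule locally_integrable_plane_wave)
  fix \<phi> j assume \<phi>: "test_function \<phi>"
  obtain S where S: "\<forall>x. norm x > S \<longrightarrow> \<phi> x = 0" using test_function_support[OF \<phi>] by blast
  show "(LINT x|lborel. plane_wave \<kappa> \<theta> x * partial j \<phi> x) = - (LINT x|lborel. (\<chi> j. \<i> * of_real (\<kappa> * \<theta> $ j) * plane_wave \<kappa> \<theta> x) $ j * \<phi> x)"
    unfolding vec_lambda_beta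
    by (rule integral_by_parts[OF dirder_plane_wave test_function_partial(1)[OF \<phi>], of S]) (use S in simp)
qed

lemma plane_wave_laplacian:
  assumes th: "norm \<theta> = 1" and \<phi>: "test_function \<phi>"
  shows "(LINT x|lborel. plane_wave \<kappa> \<theta> x * laplacian \<phi> x) = - (of_real \<kappa>)\<^sup>2 * (LINT x|lborel. plane_wave \<kappa> \<theta> x * \<phi> x)"
proof -
  let ?e = "plane_wave \<kappa> \<theta>"
  have ibp: "(LINT x|lborel. ?e x * partial j \<psi> x) = - (\<i> * of_real (\<kappa> * \<theta> $ j)) * (LINT x|lborel. ?e x * \<psi> x)" if "test_function \<psi>" for \<psi> j
  proof -
    have "(LINT x|lborel. ?e x * partial j \<psi> x) = - (LINT x|lborel. \<i> * of_real (\<kappa> * \<theta> $ j) * (?e x * \<psi> x))"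
      using plane_wave_weak_gradient[of \<kappa> \<theta>] that by (simp add: has_weak_gradient_def mult.assoc)
    then show ?thesis by simp
  qed
  have tf: "test_function (partial j \<phi>)" "test_function (partial j (partial j \<phi>))" for j
    using \<phi> by (auto intro: test_function_partial)
  have int: "integrable lborel (\<lambda>x. ?e x * partial j (partial j \<phi>) x)" for j
  proof -
    obtain S where S: "\<forall>x. norm x > S \<longrightarrow> partial j (partial j \<phi>) x = 0" using test_function_support[OF tf(2)] by blast
    show ?thesis
      by (rule integrable_continuous_support[of _ S], intro continuous_on_mult plane_wave_continuous test_function_continuous tf)
         (use S in simp)
  qed
  have "(LINT x|lborel. ?e x * laplacian \<phi> x) = (\<Sum>j\<in>UNIV. LINT x|lborel. ?e x * partial j (partial j \<phi>) x)"
    unfolding laplacian_def sum_distrib_left by (rule Bochner_Integration.integral_sum[OF int])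
  also have "\<dots> = (\<Sum>j\<in>UNIV. - (of_real \<kappa>)\<^sup>2 * (LINT x|lborel. ?e x * \<phi> x) * (complex_of_real (\<theta> $ j))\<^sup>2)"
    unfolding ibp[OF tf(1)] ibp[OF \<phi>] by (intro sum.cong refl) (simp add: power2_eq_square mult_ac)
  also have "\<dots> = - (of_real \<kappa>)\<^sup>2 * (LINT x|lborel. ?e x * \<phi> x) * (\<Sum>j\<in>UNIV. (complex_of_real (\<theta> $ j))\<^sup>2)"
    by (simp only: sum_distrib_left)
  finally show ?thesis unfolding sum_sq_sphere[OF th] by simp
qed

text \<open>The weight with \<open>\<delta> = 5/2\<close> is integrable, so boundedness of the scattered wave and its gradient suffices.\<close>

lemma weighted_L2_bounded:
  fixes f :: "real^3 \<Rightarrow> 'b::euclidean_space"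
  assumes [measurable]: "f \<in> borel_measurable borel" and B: "\<And>x. norm (f x) \<le> B"
  shows "weighted_L2 (5/2) f"
  unfolding weighted_L2_def
proof
  show "f \<in> borel_measurable lborel" by simp
  have i: "integrable lborel (\<lambda>x. B\<^sup>2 * (1 / (rho 1 x)^5))"
    by (intro integrable_mult_right integral_inverse_rho_power5)
  show "integrable lborel (\<lambda>x. (norm (f x))\<^sup>2 * (1 + norm x) powr (- 2 * (5/2)))"
  proof (rule Bochner_Integration.integrable_bound[OF i])
    show "AE x in lborel. norm ((norm (f x))\<^sup>2 * (1 + norm x) powr (- 2 * (5/2))) \<le> norm (B\<^sup>2 * (1 / (rho 1 x)^5))"
    proof (rule AE_I2)
      fix x :: "real^3"
      have r: "rho 1 x > 0" by (rule rho_pos) simp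
      have le: "rho 1 x \<le> 1 + norm x"
        unfolding rho_def by (rule real_le_lsqrt) (auto simp: power2_eq_square algebra_simps)
      have "(1 + norm x) powr (- 2 * (5/2)) = 1 / (1 + norm x)^5"
        using powr_minus[of "1 + norm x" 5] powr_realpow[of "1 + norm x" 5] add_pos_nonneg[of 1 "norm x"]
        by (simp add: inverse_eq_divide)
      also have "\<dots> \<le> 1 / (rho 1 x)^5" using r le by (intro divide_left_mono power_mono) auto
      finally have "(norm (f x))\<^sup>2 * (1 + norm x) powr (- 2 * (5/2)) \<le> B\<^sup>2 * (1 / (rho 1 x)^5)"
        using B[of x] by (intro mult_mono power_mono) auto
      then show "norm ((norm (f x))\<^sup>2 * (1 + norm x) powr (- 2 * (5/2))) \<le> norm (B\<^sup>2 * (1 / (rho 1 x)^5))"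
        using r by simp
    qed
  qed measurable
qed

lemma weighted_L2_bounded_vec:
  fixes h :: "3 \<Rightarrow> real^3 \<Rightarrow> complex"
  assumes m: "\<And>j. h j \<in> borel_measurable borel" and B: "\<And>j x. norm (h j x) \<le> B"
  shows "weighted_L2 (5/2) (\<lambda>x. \<chi> j. h j x)"
proof (rule weighted_L2_bounded)
  show "(\<lambda>x. \<chi> j. h j x) \<in> borel_measurable borel"
    unfolding borel_measurable_euclidean_space[of "\<lambda>x. \<chi> j. h j x"]
    using m by (auto simp: Basis_vec_def inner_axis)
  show "norm (\<chi> j. h j x) \<le> (\<Sum>j\<in>(UNIV::3 set). B)" for x
    unfolding norm_vec_def by (rule order_trans[OF L2_set_le_sum], rule norm_ge_zero, unfold vec_lambda_beta, rule sum_mono, rule B)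
qed

definition DR0 :: "real \<Rightarrow> (real^3 \<Rightarrow> complex) \<Rightarrow> real^3 \<Rightarrow> complex^3" where
  "DR0 \<kappa> f x = (\<chi> j. LINT y|lborel. DGB \<kappa> j (x - y) * f y)"

lemma total_weak_gradient:
  assumes k: "\<kappa> > 0" and f: "integrable lborel f"
  shows "has_weak_gradient (\<lambda>x. plane_wave \<kappa> \<theta> x - R0 \<kappa> f x)
    (\<lambda>x. (\<chi> j. \<i> * of_real (\<kappa> * \<theta> $ j) * plane_wave \<kappa> \<theta> x) - DR0 \<kappa> f x)"
  unfolding DR0_def by (intro has_weak_gradient_diff plane_wave_weak_gradient R0_weak_gradient k f)

lemma weak_gradient_some:
  assumes "has_weak_gradient u g"
  shows "has_weak_gradient u (weak_gradient u)" "AE x in lborel. weak_gradient u x = g x"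
proof -
  show w: "has_weak_gradient u (weak_gradient u)" unfolding weak_gradient_def by (rule someI[of "has_weak_gradient u", OF assms])
  show "AE x in lborel. weak_gradient u x = g x" by (rule weak_gradient_unique[OF w assms])
qed

text \<open>This turns the ansatz u = plane wave minus \<open>R0 \<kappa> f\<close> into the
  integral equation. It holds almost everywhere only, because \<open>weak_gradient\<close> picks an
  unspecified representative.\<close>

lemma perturbation_total:
  assumes k: "\<kappa> > 0" and f: "integrable lborel f"
  shows "AE x in lborel. perturbation A V (\<lambda>x. plane_wave \<kappa> \<theta> x - R0 \<kappa> f x) x = pert0 A V \<kappa> \<theta> x - born_op A V \<kappa> f x"
  using weak_gradient_some(2)[OF total_weak_gradient[OF k f, of \<theta>]]
proof eventually_elim
  case (elim x)
  have "cdot (A x) ((\<chi> j. \<i> * of_real (\<kappa> * \<theta> $ j) * plane_wave \<kappa> \<theta> x) - DR0 \<kappa> f x)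
     = \<i> * \<kappa> * (\<Sum>l\<in>UNIV. of_real (\<theta> $ l) * A x $ l) * plane_wave \<kappa> \<theta> x
       - (\<Sum>j\<in>UNIV. A x $ j * (LINT y|lborel. DGB \<kappa> j (x - y) * f y))"
    by (simp add: cdot_def DR0_def right_diff_distrib sum_subtractf sum_distrib_left sum_distrib_right mult_ac)
  then show ?case
    unfolding perturbation_def elim by (simp add: pert0_def born_op_def R0_eq_GB algebra_simps)
qed

context potential
begin

text \<open>Bounded coefficients with compact support need only local integrability of u and of its
  weak gradient. Any candidate solution thus has a source in \<open>L\<^sup>1\<close>.\<close>

lemma perturbation_integrable:
  assumes "has_weak_gradient u g"
  shows "integrable lborel (perturbation A V u)"
proof -
  have w: "has_weak_gradient u (weak_gradient u)" by (rule weak_gradient_some[OF assms])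
  have "integrable lborel (\<lambda>x. (\<Sum>j\<in>UNIV. weak_gradient u x $ j * A x $ j) + u x * V x)"
    using w sA sV MA MV
    by (intro Bochner_Integration.integrable_add Bochner_Integration.integrable_sum locally_integrable_times[where R = R and M = M])
       (auto simp: has_weak_gradient_def)
  then show ?thesis by (simp add: perturbation_def[abs_def] cdot_def mult.commute)
qed

text \<open>Although sources are known only almost everywhere, this gives the outgoing condition,
  and the equality of two solutions, at every point.\<close>

lemma R0_cong_AE:
  assumes f: "integrable lborel f" and g: "integrable lborel g" and fg: "AE y in lborel. f y = g y"
  shows "R0 \<kappa> f x = R0 \<kappa> g x"
proof -
  have [measurable]: "f \<in> borel_measurable borel" "g \<in> borel_measurable borel"
    using f g borel_measurable_integrable by auto
  show ?thesis unfolding R0_eq_GB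
    by (rule integral_cong_AE) (use fg in \<open>auto elim: eventually_mono\<close>)
qed

text \<open>For \<open>u\<close> the source equals F almost everywhere, which yields the outgoing
  condition and, with \<open>R0_fundamental\<close>, the equation. Conversely a solution v is the
  plane wave minus \<open>R0\<close> of its own integrable source; that source satisfies the same
  integral equation as F, so the two agree almost everywhere and v = u everywhere.\<close>

lemma scattering_solution_eq:
  assumes k: "\<kappa> \<ge> 1" "2 * op_const \<le> \<kappa>" and th: "norm \<theta> = 1"
    and cF: "continuous_on UNIV F" and F0: "\<And>x. norm x > R \<Longrightarrow> F x = 0"
    and Feq: "\<And>x. F x = pert0 A V \<kappa> \<theta> x - born_op A V \<kappa> F x"
  defines "u \<equiv> \<lambda>x. plane_wave \<kappa> \<theta> x - R0 \<kappa> F x"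
  shows "scattering_solution A V \<theta> \<kappa> = u" and "AE x in lborel. perturbation A V u x = F x"
    and "integrable lborel (perturbation A V u)" and "integrable lborel F"
proof -
  have k0: "\<kappa> > 0" using k by simp
  let ?e = "plane_wave \<kappa> \<theta>"
  show F: "integrable lborel F" by (rule integrable_continuous_support[OF cF F0])
  have ug: "has_weak_gradient u (\<lambda>x. (\<chi> j. \<i> * of_real (\<kappa> * \<theta> $ j) * ?e x) - DR0 \<kappa> F x)"
    unfolding u_def by (rule total_weak_gradient[OF k0 F])
  show p: "AE x in lborel. perturbation A V u x = F x"
    using perturbation_total[OF k0 F, of A V \<theta>] unfolding u_def Feq[symmetric] .
  show pi: "integrable lborel (perturbation A V u)" by (rule perturbation_integrable[OF ug])
  have out: "R0 \<kappa> (perturbation A V u) x = R0 \<kappa> F x" for x by (rule R0_cong_AE[OF pi F p])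
  note cR = conv_integrable[OF GB_measurable(1) GB_bounds(1)[OF k0] F]
  note cD = conv_integrable[OF GB_measurable(2) DGB_bounds(1)[OF k0] F]
  have R0m [measurable]: "R0 \<kappa> F \<in> borel_measurable borel" using cR(3) by (simp add: R0_eq_GB[abs_def])
  have R0b: "norm (R0 \<kappa> F x) \<le> 1 / \<kappa> * (LINT y|lborel. norm (F y))" for x using cR(2) by (simp add: R0_eq_GB)
  have um [measurable]: "u \<in> borel_measurable borel" unfolding u_def by measurable
  have ex: "is_scattering_solution A V \<theta> \<kappa> u"
    unfolding is_scattering_solution_def Let_def
  proof (intro conjI allI)
    have usc: "(\<lambda>x. u x - ?e x) = (\<lambda>x. - R0 \<kappa> F x)" by (simp add: u_def)
    \<comment> \<open>Subtracting from the zero function yields the weak gradient of a negative from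
      the rule for differences.\<close>
    have eq0: "has_weak_gradient (\<lambda>x. (0::complex)) (\<lambda>x. 0)"
      by (simp add: has_weak_gradient_def locally_integrable_def set_integrable_def)
    have "has_weak_gradient (\<lambda>x. - R0 \<kappa> F x) (\<lambda>x. \<chi> j. - (LINT y|lborel. DGB \<kappa> j (x - y) * F y))"
    proof -
      have "(\<lambda>x. \<chi> j. - (LINT y|lborel. DGB \<kappa> j (x - y) * F y)) = (\<lambda>x. 0 - (\<chi> j. LINT y|lborel. DGB \<kappa> j (x - y) * F y))"
        by (simp add: fun_eq_iff vec_eq_iff)
      then show ?thesis using has_weak_gradient_diff[OF eq0 R0_weak_gradient[OF k0 F]] by simp
    qed
    moreover have "weighted_L2 (5/2) (\<lambda>x. - R0 \<kappa> F x)"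
      by (rule weighted_L2_bounded[where B = "1 / \<kappa> * (LINT y|lborel. norm (F y))"]) (use R0b in auto)
    moreover have "weighted_L2 (5/2) (\<lambda>x. \<chi> j. - (LINT y|lborel. DGB \<kappa> j (x - y) * F y))"
      by (rule weighted_L2_bounded_vec[where B = "1 * (LINT y|lborel. norm (F y))"])
         (use cD(2) in \<open>auto intro!: borel_measurable_uminus cD(3)\<close>)
    moreover have "(5/2::real) > 1/2" by simp
    ultimately show "\<exists>\<delta>>1/2. \<exists>g. has_weak_gradient (\<lambda>x. u x - ?e x) g \<and> weighted_L2 \<delta> (\<lambda>x. u x - ?e x) \<and> weighted_L2 \<delta> g"
      unfolding usc by blast
    show "u x - ?e x = - R0 \<kappa> (perturbation A V u) x" for x unfolding out by (simp add: u_def)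
    show "solves_biharmonic A V \<kappa> u"
      unfolding solves_biharmonic_def
    proof (intro allI impI)
      fix \<phi> assume \<phi>: "test_function \<phi>"
      let ?L = "laplacian (laplacian \<phi>)"
      let ?P = "\<lambda>x. ?L x - of_real (\<kappa>^4) * \<phi> x"
      have tf: "test_function (laplacian \<phi>)" "test_function ?L"
        using \<phi> by (auto intro: test_function_laplacian)
      have c: "continuous_on UNIV \<phi>" "continuous_on UNIV ?L" using \<phi> tf by (auto intro: test_function_continuous)
      obtain S1 where S1: "\<forall>x. norm x > S1 \<longrightarrow> \<phi> x = 0" using test_function_support[OF \<phi>] by blast
      obtain S2 where S2: "\<forall>x. norm x > S2 \<longrightarrow> ?L x = 0" using test_function_support[OF tf(2)] by blast
      define S where "S = max S1 S2"
      have S: "\<phi> x = 0" "?L x = 0" if "norm x > S" for x using that S1 S2 by (auto simp: S_def)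
      have cP: "continuous_on UNIV ?P" by (intro continuous_intros c)
      have i1: "integrable lborel (\<lambda>x. ?e x * ?L x)" "integrable lborel (\<lambda>x. ?e x * \<phi> x)" "integrable lborel (\<lambda>x. ?e x * ?P x)"
        by (rule integrable_continuous_support[of _ S]; use S in \<open>auto intro!: continuous_intros c cP\<close>)+
      have Pm [measurable]: "?P \<in> borel_measurable borel" "\<phi> \<in> borel_measurable borel" using cP c by (auto intro: borel_measurable_continuous_onI)
      obtain B where B: "\<And>x. norm (?P x) \<le> B" using bounded_of_compact_support[of ?P S] cP S by auto
      have i2: "integrable lborel (\<lambda>x. R0 \<kappa> F x * ?P x)"
        by (rule locally_integrable_times[OF locally_integrable_bounded[OF R0m R0b] Pm(1), of S B]) (use S B in auto)
      have i3: "integrable lborel (\<lambda>x. F x * \<phi> x)"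
        by (rule integrable_continuous_support[of _ R]) (use F0 in \<open>auto intro!: continuous_intros cF c\<close>)
      have [measurable]: "perturbation A V u \<in> borel_measurable borel" "F \<in> borel_measurable borel" "?L \<in> borel_measurable borel"
        using pi F borel_measurable_integrable c(2) by (auto intro: borel_measurable_continuous_onI)
      have "(LINT x|lborel. u x * ?L x + (perturbation A V u x - of_real (\<kappa>^4) * u x) * \<phi> x)
          = (LINT x|lborel. (?e x * ?P x - R0 \<kappa> F x * ?P x) + F x * \<phi> x)"
      proof (rule integral_cong_AE)
        show "AE x in lborel. u x * ?L x + (perturbation A V u x - of_real (\<kappa>^4) * u x) * \<phi> x
            = (?e x * ?P x - R0 \<kappa> F x * ?P x) + F x * \<phi> x"
          using p by eventually_elim (simp add: u_def algebra_simps)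
      qed measurable
      also have "\<dots> = ((LINT x|lborel. ?e x * ?P x) - (LINT x|lborel. R0 \<kappa> F x * ?P x)) + (LINT x|lborel. F x * \<phi> x)"
        by (simp only: Bochner_Integration.integral_add[OF Bochner_Integration.integrable_diff[OF i1(3) i2] i3] Bochner_Integration.integral_diff[OF i1(3) i2])
      also have "(LINT x|lborel. R0 \<kappa> F x * ?P x) = (LINT x|lborel. F x * \<phi> x)"
        by (rule R0_fundamental[OF k0 F \<phi>])
      also have "(LINT x|lborel. ?e x * ?P x) = (LINT x|lborel. ?e x * ?L x) - of_real (\<kappa>^4) * (LINT x|lborel. ?e x * \<phi> x)"
      proof -
        have "?e x * ?P x = ?e x * ?L x - of_real (\<kappa>^4) * (?e x * \<phi> x)" for x by (simp add: algebra_simps)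
        then show ?thesis
          by (simp only: Bochner_Integration.integral_diff[OF i1(1) integrable_mult_right[OF i1(2)]] integral_mult_right_zero)
      qed
      \<comment> \<open>The incident wave solves the free equation: each Laplacian contributes
        -\<kappa>^2, and the square cancels \<kappa>^4.\<close>
      also have "\<dots> = 0"
        unfolding plane_wave_laplacian[OF th tf(1)] plane_wave_laplacian[OF th \<phi>]
        by (simp add: power4_eq_xxxx power2_eq_square)
      finally show "(LINT x|lborel. u x * ?L x + (perturbation A V u x - of_real (\<kappa>^4) * u x) * \<phi> x) = 0" by simp
    qed
  qed
  show "scattering_solution A V \<theta> \<kappa> = u"
    unfolding scattering_solution_def
  proof (rule the_equality[of "is_scattering_solution A V \<theta> \<kappa>" u, OF ex])
    fix v assume v: "is_scattering_solution A V \<theta> \<kappa> v"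
    then obtain g where g: "has_weak_gradient (\<lambda>x. v x - ?e x) g" and vout: "\<And>x. v x - ?e x = - R0 \<kappa> (perturbation A V v) x"
      unfolding is_scattering_solution_def Let_def by blast
    \<comment> \<open>The function v is written with differences only, so that its weak gradient
      follows from that of the incident and the scattered wave.\<close>
    have "has_weak_gradient (\<lambda>x. ?e x - (0 - (v x - ?e x))) (\<lambda>x. (\<chi> j. \<i> * of_real (\<kappa> * \<theta> $ j) * ?e x) - (0 - g x))"
      by (intro has_weak_gradient_diff plane_wave_weak_gradient g)
         (simp add: has_weak_gradient_def locally_integrable_def set_integrable_def)
    then have fi: "integrable lborel (perturbation A V v)"
      by (simp add: perturbation_integrable)
    have veq: "v = (\<lambda>x. ?e x - R0 \<kappa> (perturbation A V v) x)"
    proof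
      fix x show "v x = ?e x - R0 \<kappa> (perturbation A V v) x" using vout[of x] by (simp add: algebra_simps)
    qed
    have "AE x in lborel. perturbation A V (\<lambda>x. ?e x - R0 \<kappa> (perturbation A V v) x) x = pert0 A V \<kappa> \<theta> x - born_op A V \<kappa> (perturbation A V v) x"
      by (rule perturbation_total[OF k0 fi])
    then have pv: "AE x in lborel. perturbation A V v x = pert0 A V \<kappa> \<theta> x - born_op A V \<kappa> (perturbation A V v) x"
      unfolding veq[symmetric] .
    have "AE x in lborel. perturbation A V v x = F x"
      by (rule born_op_fixpoint_unique[OF k fi F pv]) (use Feq in auto)
    then have "R0 \<kappa> (perturbation A V v) x = R0 \<kappa> F x" for x by (rule R0_cong_AE[OF fi F])
    then show "v = u" using veq unfolding u_def by simp
  qed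
qed

section \<open>The Born term and the amplitude\<close>

lemma born_eq:
  "\<i> * of_real \<kappa> * cdot (cvec \<theta>) (fourier_vec A (\<kappa> *\<^sub>R (\<omega> - \<theta>))) + fourier V (\<kappa> *\<^sub>R (\<omega> - \<theta>))
    = (LINT y|lborel. exp (- \<i> * of_real (\<kappa> * (\<omega> \<bullet> y))) * pert0 A V \<kappa> \<theta> y)"
proof -
  let ?E = "\<lambda>y. exp (- \<i> * complex_of_real ((\<kappa> *\<^sub>R (\<omega> - \<theta>)) \<bullet> y))"
  have E: "?E y = exp (- \<i> * of_real (\<kappa> * (\<omega> \<bullet> y))) * plane_wave \<kappa> \<theta> y" for y
    by (simp add: plane_wave_def exp_add[symmetric] inner_diff_left inner_commute[of y \<theta>] algebra_simps)
  have cE: "continuous_on UNIV ?E" by (intro continuous_intros)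
  have iA: "integrable lborel (\<lambda>y. ?E y * A y $ l)" for l
    by (rule integrable_continuous_support[of _ R], intro continuous_on_mult cE cA) (simp add: sA)
  have iV: "integrable lborel (\<lambda>y. ?E y * V y)"
    by (rule integrable_continuous_support[of _ R], intro continuous_on_mult cE cV) (simp add: sV)
  have "exp (- \<i> * of_real (\<kappa> * (\<omega> \<bullet> y))) * pert0 A V \<kappa> \<theta> y = (\<Sum>l\<in>UNIV. (\<i> * of_real \<kappa> * of_real (\<theta> $ l)) * (?E y * A y $ l)) + ?E y * V y" for y
    unfolding E pert0_def by (simp add: sum_distrib_left sum_distrib_right distrib_left distrib_right mult_ac)
  then have "(LINT y|lborel. exp (- \<i> * of_real (\<kappa> * (\<omega> \<bullet> y))) * pert0 A V \<kappa> \<theta> y)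
     = (\<Sum>l\<in>UNIV. (\<i> * of_real \<kappa> * of_real (\<theta> $ l)) * (LINT y|lborel. ?E y * A y $ l)) + (LINT y|lborel. ?E y * V y)"
    by (simp only: Bochner_Integration.integral_add[OF Bochner_Integration.integrable_sum[OF integrable_mult_right[OF iA]] iV]
            Bochner_Integration.integral_sum[OF integrable_mult_right[OF iA]] integral_mult_right_zero)
  then show ?thesis
    by (simp add: cdot_def cvec_def fourier_vec_def fourier_def sum_distrib_left mult.assoc)
qed

text \<open>The exponential has modulus one and both sources vanish outside the ball, so the
  pointwise bound 2 B is simply multiplied by the volume.\<close>

lemma amplitude_bound:
  assumes k: "\<kappa> \<ge> 1" "2 * op_const \<le> \<kappa>" and th: "norm \<theta> = 1" and B: "\<And>x. norm (born_op A V \<kappa> (pert0 A V \<kappa> \<theta>) x) \<le> B"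
  shows "norm (scattering_amplitude A V \<omega> \<theta> \<kappa>
     - (\<i> * of_real \<kappa> * cdot (cvec \<theta>) (fourier_vec A (\<kappa> *\<^sub>R (\<omega> - \<theta>))) + fourier V (\<kappa> *\<^sub>R (\<omega> - \<theta>))))
     \<le> 2 * B * measure lborel (cball (0::real^3) R)"
proof -
  obtain F where F: "continuous_on UNIV F" "\<And>x. norm x > R \<Longrightarrow> F x = 0" "\<And>x. F x = pert0 A V \<kappa> \<theta> x - born_op A V \<kappa> F x"
     and d: "\<And>x. norm (F x - pert0 A V \<kappa> \<theta> x) \<le> 2 * B"
    using fixpoint_exists[OF k B] by blast
  have u: "scattering_solution A V \<theta> \<kappa> = (\<lambda>x. plane_wave \<kappa> \<theta> x - R0 \<kappa> F x)"
    "AE x in lborel. perturbation A V (\<lambda>x. plane_wave \<kappa> \<theta> x - R0 \<kappa> F x) x = F x"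
    "integrable lborel (perturbation A V (\<lambda>x. plane_wave \<kappa> \<theta> x - R0 \<kappa> F x))"
    by (rule scattering_solution_eq[OF k th F(1) F(2) F(3)], assumption)+
  let ?E = "\<lambda>y. exp (- \<i> * complex_of_real (\<kappa> * (\<omega> \<bullet> y)))"
  have nE: "norm (?E y) = 1" for y
    using norm_exp_i_times[of "- (\<kappa> * (\<omega> \<bullet> y))"] by simp
  have cE: "continuous_on UNIV ?E" by (intro continuous_intros)
  then have [measurable]: "?E \<in> borel_measurable borel" by (rule borel_measurable_continuous_onI)
  have [measurable]: "F \<in> borel_measurable borel" using F(1) by (rule borel_measurable_continuous_onI)
  have [measurable]: "perturbation A V (\<lambda>x. plane_wave \<kappa> \<theta> x - R0 \<kappa> F x) \<in> borel_measurable borel"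
    using u(3) borel_measurable_integrable by auto
  have "scattering_amplitude A V \<omega> \<theta> \<kappa> = (LINT y|lborel. ?E y * F y)"
    unfolding scattering_amplitude_def u(1)
    by (rule integral_cong_AE) (use u(2) in \<open>auto elim: eventually_mono\<close>)
  moreover have i1: "integrable lborel (\<lambda>y. ?E y * F y)"
    by (rule integrable_continuous_support[of _ R], intro continuous_on_mult cE F) (simp add: F(2))
  moreover have i2: "integrable lborel (\<lambda>y. ?E y * pert0 A V \<kappa> \<theta> y)"
    by (rule integrable_continuous_support[of _ R], intro continuous_on_mult cE pert0_props) (simp add: pert0_props)
  ultimately have "scattering_amplitude A V \<omega> \<theta> \<kappa>
     - (\<i> * of_real \<kappa> * cdot (cvec \<theta>) (fourier_vec A (\<kappa> *\<^sub>R (\<omega> - \<theta>))) + fourier V (\<kappa> *\<^sub>R (\<omega> - \<theta>)))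
     = (LINT y|lborel. ?E y * F y - ?E y * pert0 A V \<kappa> \<theta> y)"
    unfolding born_eq by simp
  also have "norm \<dots> \<le> (LINT y|lborel. norm (?E y * F y - ?E y * pert0 A V \<kappa> \<theta> y))"
    by (rule integral_norm_bound)
  also have "\<dots> \<le> (LINT y|lborel. 2 * B * indicator (cball (0::real^3) R) y)"
  proof (rule integral_mono)
    show "integrable lborel (\<lambda>y. norm (?E y * F y - ?E y * pert0 A V \<kappa> \<theta> y))"
      by (intro integrable_norm Bochner_Integration.integrable_diff i1 i2)
    show "integrable lborel (\<lambda>y. 2 * B * indicator (cball (0::real^3) R) y)" by simp
    fix y :: "real^3"
    show "norm (?E y * F y - ?E y * pert0 A V \<kappa> \<theta> y) \<le> 2 * B * indicator (cball 0 R) y"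
    proof (cases "norm y > R")
      case False
      have "norm (?E y * F y - ?E y * pert0 A V \<kappa> \<theta> y) = norm (F y - pert0 A V \<kappa> \<theta> y)"
        unfolding right_diff_distrib[symmetric] norm_mult nE by simp
      then show ?thesis using d[of y] False by simp
    qed (simp add: F(2) pert0_props)
  qed
  also have "\<dots> = 2 * B * measure lborel (cball (0::real^3) R)" by simp
  finally show ?thesis .
qed

end

theorem theorem5p1:
  shows "\<exists>k0::nat. \<forall>k\<ge>k0. \<forall>(A :: real^3 \<Rightarrow> complex^3) (V :: real^3 \<Rightarrow> complex).
    Ck k A \<and> compactly_supported A \<and> Ck k V \<and> compactly_supported V \<longrightarrow>
    (\<exists>C::real. \<forall>\<^sub>F \<kappa> in at_top. \<forall>\<omega>\<in>sphere 0 1. \<forall>\<theta>\<in>sphere 0 1.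
       norm (scattering_amplitude A V \<omega> \<theta> \<kappa>
             - (\<i> * of_real \<kappa> * cdot (cvec \<theta>) (fourier_vec A (\<kappa> *\<^sub>R (\<omega> - \<theta>)))
                + fourier V (\<kappa> *\<^sub>R (\<omega> - \<theta>))))
         \<le> C / \<kappa>)"
proof (intro exI[of _ "2::nat"] allI impI, elim conjE)
  fix k :: nat and A :: "real^3 \<Rightarrow> complex^3" and V :: "real^3 \<Rightarrow> complex"
  assume k: "2 \<le> k" and A: "Ck k A" "compactly_supported A" and V: "Ck k V" "compactly_supported V"
  \<comment> \<open>Two derivatives are what the estimate of the Helmholtz potential uses, through
    the Laplacian of b in \<open>wave_identity\<close>; hence the witness 2.\<close>
  have A2: "Ck 2 (\<lambda>y. A y $ l)" for l
    by (rule Ck_bounded_linear[OF bounded_linear_vec_nth Ck_mono[OF A(1) k]])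
  have V2: "Ck 2 V" by (rule Ck_mono[OF V(1) k])
  obtain R1 where R1: "R1 > 0" "\<And>x. norm x > R1 \<Longrightarrow> A x = 0" using compactly_supported_ball[OF A(2)] by blast
  obtain R2 where R2: "R2 > 0" "\<And>x. norm x > R2 \<Longrightarrow> V x = 0" using compactly_supported_ball[OF V(2)] by blast
  define R where "R = max R1 R2"
  have R: "R > 0" "\<And>x. norm x > R \<Longrightarrow> A x = 0" "\<And>x. norm x > R \<Longrightarrow> V x = 0"
    using R1 R2 by (auto simp: R_def)
  have cA: "continuous_on UNIV (\<lambda>y. A y $ l)" for l using A2[of l] by (rule Ck_imp_continuous)
  have cV: "continuous_on UNIV V" using V2 by (rule Ck_imp_continuous)
  obtain M1 where M1: "\<And>l y. norm (A y $ l) \<le> M1" using uniform_bound[of "\<lambda>l y. A y $ l" R] cA R(2) by auto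
  obtain M2 where M2: "\<And>y. norm (V y) \<le> M2" using bounded_of_compact_support[of V R] cV R(3) by auto
  interpret potential A V R "max M1 M2"
    by unfold_locales (use cA cV R M1 M2 in \<open>auto simp: le_max_iff_disj\<close>)
  have "\<exists>C\<ge>0. \<forall>\<kappa> \<theta> x. \<kappa> \<ge> 1 \<longrightarrow> norm \<theta> = 1 \<longrightarrow> norm (born_op A V \<kappa> (pert0 A V \<kappa> \<theta>) x) \<le> C / \<kappa>"
    by (rule born_op_pert0_bound[OF A2 V2 R]) (simp_all add: sA sV)
  then obtain C where C: "\<And>\<kappa> \<theta> x. \<kappa> \<ge> 1 \<Longrightarrow> norm \<theta> = 1 \<Longrightarrow> norm (born_op A V \<kappa> (pert0 A V \<kappa> \<theta>) x) \<le> C / \<kappa>"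
    by blast
  show "\<exists>C::real. \<forall>\<^sub>F \<kappa> in at_top. \<forall>\<omega>\<in>sphere 0 1. \<forall>\<theta>\<in>sphere 0 1.
       norm (scattering_amplitude A V \<omega> \<theta> \<kappa>
             - (\<i> * of_real \<kappa> * cdot (cvec \<theta>) (fourier_vec A (\<kappa> *\<^sub>R (\<omega> - \<theta>)))
                + fourier V (\<kappa> *\<^sub>R (\<omega> - \<theta>))))
         \<le> C / \<kappa>"
  proof (intro exI)
    show "\<forall>\<^sub>F \<kappa> in at_top. \<forall>\<omega>\<in>sphere 0 1. \<forall>\<theta>\<in>sphere 0 1.
       norm (scattering_amplitude A V \<omega> \<theta> \<kappa>
             - (\<i> * of_real \<kappa> * cdot (cvec \<theta>) (fourier_vec A (\<kappa> *\<^sub>R (\<omega> - \<theta>)))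
                + fourier V (\<kappa> *\<^sub>R (\<omega> - \<theta>))))
         \<le> 2 * C * measure lborel (cball (0::real^3) R) / \<kappa>"
      using eventually_ge_at_top[of "max 1 (2 * op_const)"]
    proof eventually_elim
      case (elim \<kappa>)
      \<comment> \<open>This threshold depends on \<open>A\<close> and \<open>V\<close> alone, which
        makes the final estimate uniform in both directions.\<close>
      then have k: "\<kappa> \<ge> 1" "2 * op_const \<le> \<kappa>" by auto
      show ?case
      proof (intro ballI)
        fix \<omega> \<theta> :: "real^3" assume "\<theta> \<in> sphere 0 1"
        then have th: "norm \<theta> = 1" by simp
        show "norm (scattering_amplitude A V \<omega> \<theta> \<kappa>
             - (\<i> * of_real \<kappa> * cdot (cvec \<theta>) (fourier_vec A (\<kappa> *\<^sub>R (\<omega> - \<theta>)))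
                + fourier V (\<kappa> *\<^sub>R (\<omega> - \<theta>))))
         \<le> 2 * C * measure lborel (cball (0::real^3) R) / \<kappa>"
          using amplitude_bound[OF k th C[OF k(1) th], of \<omega>] by simp
      qed
    qed
  qed
qed

end
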